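(* Assume (A1), (A2), (A3) and $\beta\ge0$. Define, for $r\ge0$, $\phi(r)=\exp\!\big(-\tfrac{\beta}{8\lambda_\star}r^2\big)$, $\Phi(r)=\int_0^r\phi(s\wedge R)\,ds$, $\gamma^{-1}=\int_0^R\phi(s)^{-1}\Phi(s)\,ds$, $g(r)=1-\tfrac{\gamma}{2}\int_0^r\phi(s)^{-1}\Phi(s)\,ds$ (for $r\le R$), and $$f(r)=\int_0^r\phi(s\wedge R)\,g(s\wedge R)\,ds,\qquad d_2(x,y)=f(\|x-y\|_\alpha),$$ $$c=\min\Big\{f'(R)(1-M),\ \frac{f'(R)}{2\alpha},\ 2\lambda_\star\gamma\Big\},\quad\text{where } f'(R)=\phi(R)/2 .$$ Then $f$ is strictly increasing, concave and continuous with $f(0)=0$, satisfying $\frac12\le f'(r)\exp(\frac{\beta}{8\lambda_\star}r^2)\le1$ for $0<r<R$ and $f(r)=f(R)+\frac12\exp(-\frac{\beta}{8\lambda_\star}R^2)(r-R)$ for $r\ge R$; $d_2$ is a metric equivalent to $\|\cdot\|$; and $$\mathcal{W}_{d_2}(\mu p_t,\nu p_t)\le e^{-ct}\,\mathcal{W}_{d_2}(\mu,\nu)\quad\text{for all }\mu,\nu\in\mathcal{P},\ t\ge0 .$$ If moreover $\beta>0$, then $c\ge\frac12\exp\!\big(-\frac{\beta}{8\lambda_\star}R^2\big)\min\{\beta,1-M,\frac{1}{2\alpha}\}$.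
   Context: Let $(\mathbb{H},\langle\cdot,\cdot\rangle,\|\cdot\|)$ be a separable real Hilbert space and $\mathcal{G}:\mathbb{H}\to\mathbb{H}$ a trace-class, symmetric, non-negative operator. Let $(e_k)_{k\ge1}$ be an orthonormal basis of $\mathbb{H}$ with $\mathcal{G}e_k=\lambda_ke_k$, $\lambda_k\ge0$, $\sum_k\lambda_k<\infty$. A $\mathcal{G}$-Wiener process is $W_t=\sum_k\sqrt{\lambda_k}B^k_t e_k$ with independent standard real Brownian motions $(B^k)$. Let $b:\mathbb{H}\to\mathbb{H}$ be Lipschitz and consider the SDE $dX_t=-X_t\,dt+b(X_t)\,dt+\sqrt2\,dW_t$, $X_0=x\in\mathbb{H}$, which has a unique strong continuous non-explosive solution; $(p_t)_{t\ge0}$ denote its Markov transition kernels and $\mu p_t(dx)=\int p_t(y,dx)\,\mu(dy)$. Fix $n\in\mathbb{N}_+$, let $\mathbb{H}^l=\mathrm{span}\{e_1,\dots,e_n\}$, $\mathbb{H}^h$ its orthogonal complement, $x^l,x^h$ the orthogonal projections, $b^l(x)=(b(x))^l$, $b^h(x)=(b(x))^h$. Assumption (A1): there are constants $0\le H_h<1$, $L_l,L_h,H_l\ge0$ with $\|b^h(x)-b^h(y)\|\le H_l\|x^l-y^l\|+H_h\|x^h-y^h\|$ and $\|b^l(x)-b^l(y)\|\le L_l\|x^l-y^l\|+L_h\|x^h-y^h\|$ for all $x,y\in\mathbb{H}$. Set $\alpha=\frac{1+L_h}{1-H_h}$, $\beta=\alpha H_l+L_l-1$, $\|x\|_\alpha=\|x^l\|+\alpha\|x^h\|$.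 Assumption (A2): $\lambda_k>0$ for $1\le k\le n$; $\lambda_\star=\min\{\lambda_k:1\le k\le n\}$. Assumption (A3): there are $R\in(0,\infty)$ and $0\le M<1$ such that $\|b(x)-b(y)\|_\alpha\le M\|x-y\|_\alpha$ for all $x,y$ with $\|x-y\|_\alpha\ge R$. For a continuous $d:\mathbb{H}\times\mathbb{H}\to[0,\infty)$ and Borel probability measures $\mu,\nu$, $\mathcal{W}_d(\mu,\nu)=\inf_\gamma\int d(x,y)\,\gamma(dx\,dy)$ over couplings $\gamma$ of $\mu,\nu$. $\mathcal{P}$ is the set of Borel probability measures on $\mathbb{H}$ with finite first moment. $a\wedge b=\min\{a,b\}$. *)

theory Defs
  imports "HOL-Probability.Probability"
begin

text \<open>An orthonormal basis (e_k), indexed by nat (k = 0,1,2,... corresponds to k = 1,2,3,...).\<close>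
definition orthonormal_basis :: "(nat \<Rightarrow> 'a::{real_inner,banach}) \<Rightarrow> bool" where
  "orthonormal_basis e \<longleftrightarrow>
     (\<forall>i j. e i \<bullet> e j = (if i = j then 1 else 0)) \<and> closure (span (range e)) = UNIV"

definition low_proj :: "(nat \<Rightarrow> 'a::real_inner) \<Rightarrow> nat \<Rightarrow> 'a \<Rightarrow> 'a" where
  "low_proj e n x = (\<Sum>k<n. (x \<bullet> e k) *\<^sub>R e k)"

definition high_proj :: "(nat \<Rightarrow> 'a::real_inner) \<Rightarrow> nat \<Rightarrow> 'a \<Rightarrow> 'a" where
  "high_proj e n x = x - low_proj e n x"

definition alpha_norm :: "(nat \<Rightarrow> 'a::real_inner) \<Rightarrow> nat \<Rightarrow> real \<Rightarrow> 'a \<Rightarrow> real" where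
  "alpha_norm e n \<alpha> x = norm (low_proj e n x) + \<alpha> * norm (high_proj e n x)"

definition ctr_phi :: "real \<Rightarrow> real \<Rightarrow> real \<Rightarrow> real" where
  "ctr_phi \<beta> ls r = exp (- (\<beta> / (8 * ls)) * r\<^sup>2)"

definition ctr_Phi :: "real \<Rightarrow> real \<Rightarrow> real \<Rightarrow> real \<Rightarrow> real" where
  "ctr_Phi \<beta> ls R r = integral {0..r} (\<lambda>s. ctr_phi \<beta> ls (min s R))"

definition ctr_gamma :: "real \<Rightarrow> real \<Rightarrow> real \<Rightarrow> real" where
  "ctr_gamma \<beta> ls R = 1 / integral {0..R} (\<lambda>s. ctr_Phi \<beta> ls R s / ctr_phi \<beta> ls s)"

definition ctr_g :: "real \<Rightarrow> real \<Rightarrow> real \<Rightarrow> real \<Rightarrow> real" where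
  "ctr_g \<beta> ls R r = 1 - ctr_gamma \<beta> ls R / 2 * integral {0..r} (\<lambda>s. ctr_Phi \<beta> ls R s / ctr_phi \<beta> ls s)"

definition ctr_f :: "real \<Rightarrow> real \<Rightarrow> real \<Rightarrow> real \<Rightarrow> real" where
  "ctr_f \<beta> ls R r = integral {0..r} (\<lambda>s. ctr_phi \<beta> ls (min s R) * ctr_g \<beta> ls R (min s R))"

text \<open>c = min { f'(R)(1-M), f'(R)/(2 alpha), 2 lambda_star gamma } with f'(R) = phi(R)/2.\<close>
definition ctr_rate :: "real \<Rightarrow> real \<Rightarrow> real \<Rightarrow> real \<Rightarrow> real \<Rightarrow> real" where
  "ctr_rate \<beta> ls R Mc \<alpha> =
     min (min (ctr_phi \<beta> ls R / 2 * (1 - Mc)) (ctr_phi \<beta> ls R / 2 / (2 * \<alpha>))) (2 * ls * ctr_gamma \<beta> ls R)"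

definition std_brownian :: "'w measure \<Rightarrow> (real \<Rightarrow> 'w \<Rightarrow> real) \<Rightarrow> bool" where
  "std_brownian P W \<longleftrightarrow>
     (\<forall>t\<ge>0. W t \<in> borel_measurable P) \<and>
     (AE \<omega> in P. W 0 \<omega> = 0 \<and> continuous_on {0..} (\<lambda>t. W t \<omega>)) \<and>
     (\<forall>s t. 0 \<le> s \<longrightarrow> s < t \<longrightarrow>
        distributed P lborel (\<lambda>\<omega>. W t \<omega> - W s \<omega>) (\<lambda>x. ennreal (normal_density 0 (sqrt (t - s)) x))) \<and>
     (\<forall>(m::nat) (ts::nat \<Rightarrow> real). 0 \<le> ts 0 \<longrightarrow> mono ts \<longrightarrow>
        prob_space.indep_vars P (\<lambda>_. borel) (\<lambda>i \<omega>. W (ts (Suc i)) \<omega> - W (ts i) \<omega>) {..<m})"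

definition indep_brownians :: "'w measure \<Rightarrow> (nat \<Rightarrow> real \<Rightarrow> 'w \<Rightarrow> real) \<Rightarrow> bool" where
  "indep_brownians P B \<longleftrightarrow>
     (\<forall>k. std_brownian P (B k)) \<and>
     prob_space.indep_vars P (\<lambda>_. \<Pi>\<^sub>M t\<in>{0::real..}. (borel :: real measure))
        (\<lambda>k \<omega>. restrict (\<lambda>t. B k t \<omega>) {0..}) UNIV"

text \<open>X is a (strong, continuous) solution of
  dX_t = -X_t dt + b(X_t) dt + sqrt 2 dW_t, X_0 = x, with W_t = \<Sum>k sqrt(lam k) B^k_t e_k.\<close>
definition sde_solution ::
  "'w measure \<Rightarrow> (nat \<Rightarrow> 'a::{real_inner,banach}) \<Rightarrow> (nat \<Rightarrow> real) \<Rightarrow> (nat \<Rightarrow> real \<Rightarrow> 'w \<Rightarrow> real)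
    \<Rightarrow> ('a \<Rightarrow> 'a) \<Rightarrow> 'a \<Rightarrow> (real \<Rightarrow> 'w \<Rightarrow> 'a) \<Rightarrow> bool" where
  "sde_solution P e lam B b x X \<longleftrightarrow>
     (\<forall>t\<ge>0. X t \<in> borel_measurable P) \<and>
     (AE \<omega> in P. continuous_on {0..} (\<lambda>t. X t \<omega>) \<and>
        (\<forall>t\<ge>0. \<exists>w. (\<lambda>k. (sqrt (lam k) * B k t \<omega>) *\<^sub>R e k) sums w \<and>
            X t \<omega> = x + integral {0..t} (\<lambda>s. - X s \<omega> + b (X s \<omega>)) + sqrt 2 *\<^sub>R w))"

definition first_moment_measures :: "'a::real_normed_vector measure set" where
  "first_moment_measures = {\<mu>. prob_space \<mu> \<and> sets \<mu> = sets borel \<and> (\<integral>\<^sup>+ x. ennreal (norm x) \<partial>\<mu>) < \<infinity>}"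

definition couplings :: "'a::topological_space measure \<Rightarrow> 'a measure \<Rightarrow> ('a \<times> 'a) measure set" where
  "couplings \<mu> \<nu> = {\<gamma>. sets \<gamma> = sets borel \<and> distr \<gamma> borel fst = \<mu> \<and> distr \<gamma> borel snd = \<nu>}"

definition wasserstein :: "('a::topological_space \<Rightarrow> 'a \<Rightarrow> real) \<Rightarrow> 'a measure \<Rightarrow> 'a measure \<Rightarrow> ennreal" where
  "wasserstein d \<mu> \<nu> = (INF \<gamma>\<in>couplings \<mu> \<nu>. \<integral>\<^sup>+ z. ennreal (d (fst z) (snd z)) \<partial>\<gamma>)"

definition kernel_act :: "'a measure \<Rightarrow> ('a \<Rightarrow> 'a measure) \<Rightarrow> 'a measure" where
  "kernel_act \<mu> p = bind \<mu> p"

end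

theory Submission
  imports Defs
begin

text \<open>
  Over a short time step \<open>h\<close> two solutions are driven by the same noise when their low modes are closer
  than \<open>\<delta>\<close> or when their distance is at least \<open>R - \<eta>\<close>; otherwise the second one is driven by the noise
  reflected at a hyperplane that is fixed during the step. The reflection is taken with respect to the inner product of
  the inverse covariance, so that it preserves the law of the noise and the difference of the two noises
  is a multiple of the low part of the difference of the starting points: the distance
  then changes by a drift, a centred Gaussian of variance at least \<open>8 \<lambda>\<^sub>\<star> h\<close>, and an error of
  order \<open>h\<^bsup>3/2\<^esup>\<close>. A third-order Taylor expansion of the concave profile \<open>f\<close> and its
  differential inequality show that one step multiplies the expected distance by
  \<open>1 - (c - \<epsilon>) h\<close> up to an additive error \<open>2 \<epsilon> h\<close>. By the Markov property the one-step
  couplings can be iterated \<open>t / h\<close> times; then \<open>h \<rightarrow> 0\<close> and \<open>\<epsilon> \<rightarrow> 0\<close>. This discrete scheme avoids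
  stochastic calculus: since the noise is additive, a solution is a continuous function of its driving path, the fixed point of a
  contraction, and laws of paths are compared through polygonal approximations, which are functions of
  independent Gaussian increments.
\<close>

section \<open>The concave profile\<close>

text \<open>The three entries of \<open>c\<close> are the rates of three regimes. Where the low
  parts nearly agree the reflection direction degenerates, but there the high part carries the
  distance and, by the choice of \<alpha>, lowers it at speed \<open>norm (high z)\<close>: this
  gives the entry with \<open>2 * \<alpha>\<close>. At large distance (A3) gives the entry with
  \<open>1 - M\<close>. In between only noise helps, through the concavity of \<open>f\<close>: this
  is \<open>2 * ls * \<gamma>\<close>.

  The thresholds \<delta> and \<eta> keep the expansion away from two bad points: a vanishing low
  part, where the norm is not smooth, and \<open>R\<close>, where the second derivative of
  \<open>f\<close> jumps. Constants blow up as the thresholds shrink, so \<epsilon>, \<delta>,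
  \<eta> are fixed before \<open>h\<close> tends to 0. Synchronous steps occur at unbounded
  distance, so their error must be proportional to \<open>f\<close> instead of additive.

  The measure-theoretic obstacle is that path space is not separable and that solutions are given
  for each starting point separately, almost surely. Laws are therefore compared through integrals
  of continuous functions with values in \<open>[0, 1]\<close>: these survive almost sure limits and
  determine a Borel measure.\<close>

lemma integral_upto_has_derivative:
  fixes k :: "real \<Rightarrow> real"
  assumes k: "continuous_on {0..} k" and F: "\<And>r. F r = integral {0..r} k" and t: "0 \<le> t"
  shows "(F has_real_derivative k t) (at t within {0..})"
proof -
  have "((\<lambda>x. integral {0..x} k) has_real_derivative k t) (at t within {0..t+1})"
    using t by (intro integral_has_real_derivative continuous_on_subset[OF k]) auto
  moreover have "at t within {0..t+1} = at t within {0..}"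
  proof (rule at_within_nhd[of t "{..<t+1}"])
    show "{0..t + 1} \<inter> {..<t + 1} - {t} = {0..} \<inter> {..<t + 1} - {t}"
      by auto
  qed (use t in auto)
  moreover have "F = (\<lambda>x. integral {0..x} k)" using F by auto
  ultimately show ?thesis by simp
qed

lemma has_derivative_interior_atLeast:
  fixes F :: "real \<Rightarrow> real"
  assumes "(F has_real_derivative D) (at t within {0..})" "0 < t"
  shows "(F has_real_derivative D) (at t)"
  using assms at_within_interior[of t "{0..}"] by simp

lemma integral_upto_increment:
  fixes k :: "real \<Rightarrow> real"
  assumes k: "continuous_on {0..} k" and F: "\<And>r. F r = integral {0..r} k" and uv: "0 \<le> u" "u \<le> v"
    and mono: "\<And>s. u \<le> s \<Longrightarrow> s \<le> v \<Longrightarrow> l \<le> k s \<and> k s \<le> m"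
  shows "l * (v - u) \<le> F v - F u" "F v - F u \<le> m * (v - u)"
proof -
  have int: "k integrable_on {0..v}" "k integrable_on {u..v}"
    using uv by (auto intro!: integrable_continuous_interval continuous_on_subset[OF k])
  have "F v - F u = integral {u..v} k"
    using Henstock_Kurzweil_Integration.integral_combine[OF uv int(1)] by (simp add: F)
  moreover have "integral {u..v} (\<lambda>_. l) \<le> integral {u..v} k"
    using mono int by (intro integral_le) auto
  moreover have "integral {u..v} k \<le> integral {u..v} (\<lambda>_. m)"
    using mono int by (intro integral_le) auto
  ultimately show "l * (v - u) \<le> F v - F u" "F v - F u \<le> m * (v - u)"
    using uv by (auto simp: mult.commute)
qed

locale contraction_profile =
  fixes \<beta> ls R :: real
  assumes beta: "0 \<le> \<beta>" and ls: "0 < ls" and R: "0 < R"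
begin

abbreviation "\<phi> \<equiv> ctr_phi \<beta> ls"
abbreviation "\<Phi> \<equiv> ctr_Phi \<beta> ls R"
abbreviation "\<gamma> \<equiv> ctr_gamma \<beta> ls R"
abbreviation "g \<equiv> ctr_g \<beta> ls R"
abbreviation "f \<equiv> ctr_f \<beta> ls R"

text \<open>\<open>f1\<close> is the derivative of \<open>f\<close> on the whole half line;
  \<open>f2\<close> and \<open>f3\<close> are the next two derivatives strictly between 0 and
  \<open>R\<close>. In \<open>f2\<close> the first summand comes from \<phi> and the second from
  \<open>g\<close>, whose derivative has a factor \<open>1 / \<phi>\<close> that cancels.
  \<open>q\<close> is the slope beyond \<open>R\<close>, and the smallest slope.\<close>

definition f1 :: "real \<Rightarrow> real" where "f1 s = \<phi> (min s R) * g (min s R)"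
definition f2 :: "real \<Rightarrow> real" where "f2 s = - (\<beta> / (4 * ls)) * s * f1 s - \<gamma> / 2 * \<Phi> s"
definition f3 :: "real \<Rightarrow> real" where "f3 s = - (\<beta> / (4 * ls)) * (f1 s + s * f2 s) - \<gamma> / 2 * \<phi> s"
definition q :: real where "q = \<phi> R / 2"

lemma phi_pos: "0 < \<phi> s" by (simp add: ctr_phi_def)

lemma phi_nz [simp]: "\<phi> s \<noteq> 0" using phi_pos[of s] by simp

lemma phi_le_1: "\<phi> s \<le> 1" using beta ls by (simp add: ctr_phi_def)

lemma phi_antimono: "0 \<le> s \<Longrightarrow> s \<le> t \<Longrightarrow> \<phi> t \<le> \<phi> s"
  using beta ls by (auto simp: ctr_phi_def intro!: mult_left_mono divide_right_mono power_mono)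

lemma phi_deriv: "(\<phi> has_real_derivative - (\<beta> / (4 * ls)) * s * \<phi> s) (at s within A)"
  unfolding ctr_phi_def[abs_def] using ls
  by (auto intro!: derivative_eq_intros simp: field_simps)

lemma phi_cont: "continuous_on A \<phi>"
  unfolding ctr_phi_def[abs_def] by (intro continuous_intros)

lemma phi_min_cont: "continuous_on A (\<lambda>s. \<phi> (min s R))"
  by (intro continuous_on_compose2[OF phi_cont[of UNIV]] continuous_intros) auto

lemma Phi_deriv: "0 \<le> t \<Longrightarrow> (\<Phi> has_real_derivative \<phi> (min t R)) (at t within {0..})"
  by (rule integral_upto_has_derivative[OF phi_min_cont]) (auto simp: ctr_Phi_def)

lemma Phi_cont: "continuous_on {0..} \<Phi>"
  using Phi_deriv by (auto simp: continuous_on_eq_continuous_within intro: DERIV_continuous)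

lemma Phi_0 [simp]: "\<Phi> 0 = 0" by (simp add: ctr_Phi_def)

lemma Phi_nonneg: "0 \<le> s \<Longrightarrow> 0 \<le> \<Phi> s"
  using integral_upto_increment(1)[OF phi_min_cont, where l=0 and m=1 and u=0 and v=s and F=\<Phi>] phi_pos phi_le_1
  by (auto simp: ctr_Phi_def less_imp_le)

lemma Phi_le: "0 \<le> s \<Longrightarrow> \<Phi> s \<le> s"
  using integral_upto_increment(2)[OF phi_min_cont, where l=0 and m=1 and u=0 and v=s and F=\<Phi>] phi_pos phi_le_1
  by (auto simp: ctr_Phi_def less_imp_le)

lemma Phi_pos: "0 < s \<Longrightarrow> s \<le> R \<Longrightarrow> 0 < \<Phi> s"
proof -
  assume s: "0 < s" "s \<le> R"
  have "\<phi> R * (s - 0) \<le> \<Phi> s - \<Phi> 0"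
    using phi_antimono phi_le_1 s
    by (intro integral_upto_increment(1)[OF phi_min_cont, where m=1]) (auto simp: ctr_Phi_def)
  moreover have "0 < \<phi> R * s" using phi_pos s by simp
  ultimately show ?thesis by simp
qed

abbreviation "G \<equiv> (\<lambda>r. integral {0..r} (\<lambda>s. \<Phi> s / \<phi> s))"

lemma G_integrand_cont: "continuous_on {0..} (\<lambda>s. \<Phi> s / \<phi> s)"
  by (intro continuous_intros Phi_cont phi_cont) auto

lemma G_deriv: "0 \<le> t \<Longrightarrow> (G has_real_derivative \<Phi> t / \<phi> t) (at t within {0..})"
  by (rule integral_upto_has_derivative[OF G_integrand_cont]) auto

lemma G_mono: "0 \<le> s \<Longrightarrow> s \<le> t \<Longrightarrow> G s \<le> G t"
  by (rule integral_subset_le)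
     (auto intro!: integrable_continuous_interval continuous_on_subset[OF G_integrand_cont]
        Phi_nonneg divide_nonneg_pos phi_pos)

text \<open>The integrand vanishes at 0, so the lower bound is taken on the right half of the
  interval, where it is at least \<open>\<Phi> (R/2)\<close>. Positivity ensures that \<gamma> is a
  true reciprocal and not the default value of a division by zero.\<close>

lemma G_R_pos: "0 < G R"
proof -
  have "0 < \<Phi> (R/2)" using Phi_pos[of "R/2"] R by simp
  have mono: "\<Phi> (R/2) \<le> \<Phi> s / \<phi> s \<and> \<Phi> s / \<phi> s \<le> R / \<phi> R" if "R/2 \<le> s" "s \<le> R" for s
  proof -
    have "0 * (s - R/2) \<le> \<Phi> s - \<Phi> (R/2)"
      using that R phi_pos phi_le_1
      by (intro integral_upto_increment(1)[OF phi_min_cont, where m=1]) (auto simp: ctr_Phi_def less_imp_le)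
    moreover have "\<Phi> s \<le> \<Phi> s / \<phi> s"
      using phi_le_1[of s] phi_pos[of s] Phi_nonneg[of s] that R by (simp add: pos_le_divide_eq mult_left_le)
    moreover have "\<Phi> s / \<phi> s \<le> R / \<phi> R"
      using Phi_le[of s] phi_antimono[of s R] phi_pos that R by (intro frac_le) auto
    ultimately show ?thesis by simp
  qed
  have "\<Phi> (R/2) * (R - R/2) \<le> G R - G (R/2)"
    using R mono by (intro integral_upto_increment(1)[OF G_integrand_cont, where m="R / \<phi> R"]) auto
  moreover have "0 \<le> G (R/2)" using G_mono[of 0 "R/2"] R by simp
  moreover have "0 < \<Phi> (R/2) * (R - R/2)" using \<open>0 < \<Phi> (R/2)\<close> R by simp
  ultimately show ?thesis by linarith
qed

lemma gamma_pos: "0 < \<gamma>"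
  using G_R_pos by (simp add: ctr_gamma_def)

lemma gamma_G: "\<gamma> * G R = 1" using G_R_pos by (simp add: ctr_gamma_def)

lemma g_eq: "g r = 1 - \<gamma> / 2 * G r" by (simp add: ctr_g_def)

lemma g_bounds: "0 \<le> s \<Longrightarrow> s \<le> R \<Longrightarrow> 1/2 \<le> g s \<and> g s \<le> 1"
proof -
  assume s: "0 \<le> s" "s \<le> R"
  have "0 \<le> G s" "G s \<le> G R" using G_mono[of 0 s] G_mono[of s R] s by auto
  then have "0 \<le> \<gamma> * G s" "\<gamma> * G s \<le> \<gamma> * G R" using gamma_pos by auto
  then show ?thesis using gamma_G by (simp add: g_eq)
qed

lemma g_R: "g R = 1/2" using gamma_G by (simp add: g_eq)

lemma g_antimono: "0 \<le> s \<Longrightarrow> s \<le> t \<Longrightarrow> g t \<le> g s"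
  using G_mono[of s t] gamma_pos by (auto simp: g_eq)

lemma g_deriv: "0 \<le> t \<Longrightarrow> (g has_real_derivative - (\<gamma> / 2) * (\<Phi> t / \<phi> t)) (at t within {0..})"
  unfolding ctr_g_def[abs_def] by (auto intro!: derivative_eq_intros G_deriv)

lemma g_cont: "continuous_on {0..} g"
  using g_deriv by (auto simp: continuous_on_eq_continuous_within intro: DERIV_continuous)

lemma f1_cont: "continuous_on {0..} f1"
  unfolding f1_def[abs_def]
  by (intro continuous_on_mult phi_min_cont continuous_on_compose2[OF g_cont] continuous_intros) (use R in auto)

lemma f_integral: "f r = integral {0..r} f1" by (simp add: ctr_f_def f1_def[abs_def])

lemma f_0: "f 0 = 0" by (simp add: f_integral)

lemma f_deriv: "0 \<le> t \<Longrightarrow> (f has_real_derivative f1 t) (at t within {0..})"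
  by (rule integral_upto_has_derivative[OF f1_cont f_integral])

lemma f_cont: "continuous_on {0..} f"
  using f_deriv by (auto simp: continuous_on_eq_continuous_within intro: DERIV_continuous)

lemma f1_antimono: "0 \<le> s \<Longrightarrow> s \<le> t \<Longrightarrow> f1 t \<le> f1 s"
  unfolding f1_def using R g_bounds[of "min t R"]  phi_pos
  by (intro mult_mono phi_antimono g_antimono) (auto simp: less_imp_le)

lemma q_pos: "0 < q" using phi_pos by (simp add: q_def)

lemma f1_R: "R \<le> s \<Longrightarrow> f1 s = q" by (simp add: f1_def g_R q_def min_absorb2)

lemma f1_bounds: "0 \<le> s \<Longrightarrow> q \<le> f1 s \<and> f1 s \<le> 1"
proof -
  assume s: "0 \<le> s"
  have "q \<le> f1 s" using f1_antimono[of s "max s R"] s f1_R[of "max s R"] by auto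
  moreover have "f1 s \<le> 1 * 1" unfolding f1_def
    using s R g_bounds[of "min s R"] phi_le_1 by (intro mult_mono) auto
  ultimately show ?thesis by simp
qed

text \<open>Concavity in slope form. Comparing finite increments with slopes remains valid across
  \<open>R\<close>, where \<open>f1\<close> has a kink.\<close>

lemma f_increment:
  assumes "0 \<le> u" "u \<le> v"
  shows "f1 v * (v - u) \<le> f v - f u" "f v - f u \<le> f1 u * (v - u)"
  using assms f1_antimono integral_upto_increment[OF f1_cont f_integral assms, of "f1 v" "f1 u"] by auto

lemma f_increment_bounds:
  assumes "0 \<le> u" "u \<le> v"
  shows "q * (v - u) \<le> f v - f u" "f v - f u \<le> v - u"
  using assms f1_bounds integral_upto_increment[OF f1_cont f_integral assms, of q 1] by auto

lemma f_mono: "0 \<le> u \<Longrightarrow> u \<le> v \<Longrightarrow> f u \<le> f v"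
  using f_increment_bounds(1)[of u v] q_pos by (smt (verit) mult_nonneg_nonneg)

lemma f_bounds: "0 \<le> r \<Longrightarrow> q * r \<le> f r \<and> f r \<le> r"
  using f_increment_bounds[of 0 r] by (simp add: f_0)

lemma f_nonneg: "0 \<le> r \<Longrightarrow> 0 \<le> f r"
  using f_mono[of 0 r] by (simp add: f_0)

lemma f_strict_mono: "strict_mono_on {0..} f"
proof (rule strict_mono_onI)
  fix u v :: real assume "u \<in> {0..}" "v \<in> {0..}" "u < v"
  then show "f u < f v" using f_increment_bounds(1)[of u v] q_pos
    by (smt (verit) atLeast_iff mult_pos_pos)
qed

lemma f_concave: "concave_on {0..} f"
proof (rule concave_on_linorderI)
  fix t x y :: real assume t: "0 < t" "t < 1" and xy: "x \<in> {0..}" "y \<in> {0..}" "x < y"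
  define z where "z = (1 - t) * x + t * y"
  have z1: "z - x = t * (y - x)" and z2: "y - z = (1 - t) * (y - x)" by (auto simp: z_def algebra_simps)
  have "0 \<le> z - x" "0 \<le> y - z" unfolding z1 z2 using t xy by auto
  then have "f1 z * (z - x) \<le> f z - f x" "f y - f z \<le> f1 z * (y - z)" using xy by (auto intro!: f_increment)
  then have "(1 - t) * (f1 z * (z - x)) \<le> (1 - t) * (f z - f x)" "t * (f y - f z) \<le> t * (f1 z * (y - z))"
    using t by (auto intro!: mult_left_mono)
  then have "t * (f y - f z) \<le> (1 - t) * (f z - f x)" unfolding z1 z2 by (simp add: algebra_simps)
  then show "(1 - t) * f x + t * f y \<le> f ((1 - t) *\<^sub>R x + t *\<^sub>R y)" by (simp add: z_def algebra_simps)
qed auto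

lemma f_affine: "R \<le> r \<Longrightarrow> f r = f R + q * (r - R)"
proof -
  assume r: "R \<le> r"
  then have "q * (r - R) \<le> f r - f R \<and> f r - f R \<le> q * (r - R)"
    using f_increment[of R r] f1_R R by auto
  then show ?thesis by simp
qed

text \<open>Concavity and \<open>f 0 = 0\<close>: the increment past the larger argument is at most
  the increment from 0. The case split decides which argument serves as base point.\<close>

lemma f_subadditive:
  assumes "0 \<le> u" "0 \<le> v" shows "f (u + v) \<le> f u + f v"
proof -
  have "f1 u * v \<ge> f (u + v) - f u" using f_increment(2)[of u "u+v"] assms by simp
  show ?thesis
  proof (cases "u \<le> v")
    case True
    have "f (u + v) - f v \<le> f1 v * u" using f_increment(2)[of v "u+v"] assms by simp
    also have "\<dots> \<le> f1 u * u" using f1_antimono[of u v] assms True by (intro mult_right_mono) auto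
    also have "\<dots> \<le> f u" using f_increment(1)[of 0 u] assms by (simp add: f_0)
    finally show ?thesis by simp
  next
    case False
    have "f (u + v) - f u \<le> f1 u * v" by fact
    also have "\<dots> \<le> f1 v * v" using f1_antimono[of v u] assms False by (intro mult_right_mono) auto
    also have "\<dots> \<le> f v" using f_increment(1)[of 0 v] assms by (simp add: f_0)
    finally show ?thesis by simp
  qed
qed

section \<open>Higher derivatives below \<open>R\<close>, the differential inequality and the
  third-order expansion\<close>

lemma f1_deriv: assumes t: "0 < t" "t < R" shows "(f1 has_real_derivative f2 t) (at t)"
proof -
  have "((\<lambda>s. \<phi> s * g s) has_real_derivative
      (- (\<beta> / (4 * ls)) * t * \<phi> t) * g t + (- (\<gamma> / 2) * (\<Phi> t / \<phi> t)) * \<phi> t) (at t)"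
    using t g_deriv[of t] by (intro DERIV_mult phi_deriv has_derivative_interior_atLeast[of g]) auto
  moreover have "(- (\<beta> / (4 * ls)) * t * \<phi> t) * g t + (- (\<gamma> / 2) * (\<Phi> t / \<phi> t)) * \<phi> t = f2 t"
    using t by (simp add: f2_def f1_def min_absorb1)
  ultimately have "((\<lambda>s. \<phi> s * g s) has_real_derivative f2 t) (at t)" by simp
  then show ?thesis
    by (rule has_field_derivative_transform_within_open[where S="{0<..<R}"]) (use t in \<open>auto simp: f1_def\<close>)
qed

lemma f2_deriv: assumes t: "0 < t" "t < R" shows "(f2 has_real_derivative f3 t) (at t)"
proof -
  have "((\<lambda>s. - (\<beta> / (4 * ls)) * (s * f1 s) - \<gamma> / 2 * \<Phi> s) has_real_derivative
     - (\<beta> / (4 * ls)) * (1 * f1 t + f2 t * t) - \<gamma> / 2 * \<phi> (min t R)) (at t)"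
    using t Phi_deriv[of t]
    by (intro DERIV_diff DERIV_cmult DERIV_mult DERIV_ident f1_deriv has_derivative_interior_atLeast[of \<Phi>]) auto
  then show ?thesis using t by (simp add: f2_def[abs_def] f3_def mult.assoc mult.commute[of t])
qed

lemma f2_nonpos: "0 \<le> s \<Longrightarrow> f2 s \<le> 0"
proof -
  assume s: "0 \<le> s"
  have "0 \<le> \<beta> / (4 * ls) * s * f1 s" using s beta ls f1_bounds[of s] q_pos by simp
  moreover have "0 \<le> \<gamma> / 2 * \<Phi> s" using gamma_pos Phi_nonneg s by simp
  ultimately show ?thesis by (simp add: f2_def)
qed

text \<open>The ordinary differential inequality for which the profile was designed.\<close>

lemma f2_generator: "0 \<le> r \<Longrightarrow> \<beta> * r * f1 r + 4 * ls * f2 r \<le> - (2 * ls * \<gamma>) * f r"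
proof -
  assume r: "0 \<le> r"
  have "f r \<le> \<Phi> r"
  proof -
    have "integral {0..r} f1 \<le> integral {0..r} (\<lambda>s. \<phi> (min s R))"
    proof (rule integral_le)
      show "f1 integrable_on {0..r}" "(\<lambda>s. \<phi> (min s R)) integrable_on {0..r}"
        by (auto intro!: integrable_continuous_interval continuous_on_subset[OF f1_cont] phi_min_cont)
      show "f1 s \<le> \<phi> (min s R)" if "s \<in> {0..r}" for s
        using that g_bounds[of "min s R"] phi_pos[of "min s R"] R by (auto simp: f1_def mult_left_le)
    qed
    then show ?thesis by (simp add: f_integral ctr_Phi_def)
  qed
  then have "2 * ls * \<gamma> * f r \<le> 2 * ls * \<gamma> * \<Phi> r" using gamma_pos ls by simp
  \<comment> \<open>This cancellation fixes the exponent of \<phi>: differentiating \<phi> produces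
    exactly the term that offsets the drift. Only the contribution of \<open>g\<close> remains, and
    it supplies the rate.\<close>
  moreover have "\<beta> * r * f1 r + 4 * ls * f2 r = - (2 * ls * \<gamma> * \<Phi> r)"
    using ls by (simp add: f2_def algebra_simps)
  ultimately show ?thesis by simp
qed

text \<open>For small \<open>Y\<close> this is Taylor's formula with a bounded third derivative. For
  large \<open>Y\<close> the tangent already dominates by concavity, and the cube has to absorb the
  nonpositive quadratic term. The truncation at 0 is needed because the Gaussian displacement may
  exceed \<open>r\<close>.\<close>

lemma f_taylor:
  assumes \<delta>: "0 < \<delta>" and \<eta>: "0 < \<eta>"
  obtains C where "0 \<le> C"
    "\<And>r Y. \<delta> \<le> r \<Longrightarrow> r \<le> R - \<eta> \<Longrightarrow> f (max 0 (r + Y)) \<le> f r + f1 r * Y + f2 r / 2 * Y\<^sup>2 + C * \<bar>Y\<bar> ^ 3"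
proof -
  define K where "K = \<beta> / (4 * ls)"
  define K2 where "K2 = K * R + \<gamma> / 2 * R"
  define K3 where "K3 = K * (1 + R * K2) + \<gamma> / 2"
  \<comment> \<open>Half of the smaller margin keeps every point within \<zeta> of \<open>r\<close>
    strictly between 0 and \<open>R\<close>.\<close>
  define \<zeta> where "\<zeta> = min \<delta> \<eta> / 2"
  \<comment> \<open>The summands pay, in this order, for the Taylor remainder, for the quadratic
    term when \<open>\<bar>Y\<bar>\<close> is at least \<zeta>, and for the linear term when
    \<open>r + Y\<close> is negative.\<close>
  define C where "C = K3 / 6 + K2 / (2 * \<zeta>) + 1 / \<zeta>\<^sup>2"
  have pos: "0 < \<zeta>" "0 \<le> K" "0 \<le> K2" "0 \<le> K3"
    using assms beta ls gamma_pos R by (auto simp: \<zeta>_def K_def K2_def K3_def)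
  have f2b: "\<bar>f2 s\<bar> \<le> K2" if "0 \<le> s" "s \<le> R" for s
  proof -
    have "\<bar>f2 s\<bar> = K * (s * f1 s) + \<gamma> / 2 * \<Phi> s"
      using f2_nonpos[of s] that by (simp add: f2_def K_def)
    also have "\<dots> \<le> K * (R * 1) + \<gamma> / 2 * R"
      using that f1_bounds[of s] Phi_le[of s] gamma_pos pos R q_pos
      by (intro add_mono mult_left_mono mult_mono) auto
    finally show ?thesis by (simp add: K2_def)
  qed
  have f3b: "\<bar>f3 s\<bar> \<le> K3" if "0 \<le> s" "s \<le> R" for s
  proof -
    have "\<bar>f1 s + s * f2 s\<bar> \<le> 1 + R * K2"
    proof -
      have "\<bar>s * f2 s\<bar> \<le> R * K2" unfolding abs_mult using that f2b[of s] R by (intro mult_mono) auto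
      then show ?thesis using f1_bounds[of s] that q_pos by linarith
    qed
    then have "\<bar>K * (f1 s + s * f2 s)\<bar> \<le> K * (1 + R * K2)" unfolding abs_mult using pos
      by (intro mult_mono) auto
    moreover have "\<bar>\<gamma> / 2 * \<phi> s\<bar> \<le> \<gamma> / 2 * 1" unfolding abs_mult using gamma_pos phi_pos[of s] phi_le_1[of s]
      by (intro mult_mono) auto
    moreover have "f3 s = - (K * (f1 s + s * f2 s)) - \<gamma> / 2 * \<phi> s" by (simp add: f3_def K_def)
    ultimately show ?thesis unfolding K3_def by linarith
  qed
  show ?thesis
  proof
    show "0 \<le> C" using pos by (simp add: C_def)
    fix r Y assume r: "\<delta> \<le> r" "r \<le> R - \<eta>"
    have C1: "K3 / 6 * \<bar>Y\<bar>^3 \<le> C * \<bar>Y\<bar>^3" "(K2 / (2 * \<zeta>) + 1/\<zeta>\<^sup>2) * \<bar>Y\<bar>^3 \<le> C * \<bar>Y\<bar>^3"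
      unfolding C_def using pos by (intro mult_right_mono; simp)+
    show "f (max 0 (r + Y)) \<le> f r + f1 r * Y + f2 r / 2 * Y\<^sup>2 + C * \<bar>Y\<bar> ^ 3"
    proof (cases "\<bar>Y\<bar> \<le> \<zeta>")
      case True
      define D where "D m = (if m = 0 then f else if m = Suc 0 then f1 else if m = 2 then f2 else f3)" for m :: nat
      have \<zeta>: "\<zeta> \<le> \<delta>/2" "\<zeta> \<le> \<eta>/2" by (auto simp: \<zeta>_def)
      show ?thesis
      proof (cases "Y = 0")
        case True then show ?thesis using r \<delta> by (simp add: max_absorb2)
      next
        case False
        have "\<exists>t. (if r + Y < r then r + Y < t \<and> t < r else r < t \<and> t < r + Y) \<and>
          f (r + Y) = (\<Sum>m<3. D m r / fact m * (r + Y - r) ^ m) + D 3 t / fact 3 * (r + Y - r) ^ 3"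
        proof (rule Taylor[where a="r - \<zeta>" and b="r + \<zeta>"])
          show "\<forall>m t. m < 3 \<and> r - \<zeta> \<le> t \<and> t \<le> r + \<zeta> \<longrightarrow> (D m has_real_derivative D (Suc m) t) (at t)"
          proof (intro allI impI)
            fix m :: nat and t :: real assume mt: "m < 3 \<and> r - \<zeta> \<le> t \<and> t \<le> r + \<zeta>"
            then have t: "0 < t" "t < R" using r \<zeta> \<delta> \<eta> by linarith+
            consider "m = 0" | "m = 1" | "m = 2" using mt by linarith
            then show "(D m has_real_derivative D (Suc m) t) (at t)"
              using t f_deriv[of t] has_derivative_interior_atLeast[of f "f1 t" t] f1_deriv[of t] f2_deriv[of t]
              by cases (auto simp: D_def)
          qed
        qed (use False True pos in \<open>auto simp: D_def\<close>)
        then obtain t where t: "(if r + Y < r then r + Y < t \<and> t < r else r < t \<and> t < r + Y)"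
          "f (r + Y) = (\<Sum>m<3. D m r / fact m * (r + Y - r) ^ m) + D 3 t / fact 3 * (r + Y - r) ^ 3" by blast
        then have "0 \<le> t \<and> t \<le> R" using r \<zeta> \<delta> \<eta> True by (auto split: if_splits)
        then have "f3 t / 6 * Y^3 \<le> K3 / 6 * \<bar>Y\<bar>^3"
        proof -
          have "\<bar>f3 t / 6 * Y^3\<bar> \<le> K3 / 6 * \<bar>Y\<bar>^3" unfolding abs_mult power_abs
            using f3b[of t] \<open>0 \<le> t \<and> t \<le> R\<close> by (intro mult_mono) auto
          then show ?thesis by linarith
        qed
        moreover have "f (r + Y) = f r + f1 r * Y + f2 r / 2 * Y\<^sup>2 + f3 t / 6 * Y^3"
          using t(2) by (simp add: D_def eval_nat_numeral)
        moreover have "0 \<le> r + Y" using r \<zeta> \<delta> True by linarith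
        ultimately show ?thesis using C1 by (simp add: max_absorb2)
      qed
    next
      case False
      then have Y: "\<zeta> \<le> \<bar>Y\<bar>" by simp
      have r0: "0 \<le> r" "r \<le> R" using r \<delta> \<eta> by auto
      have a: "\<bar>f2 r / 2 * Y\<^sup>2\<bar> \<le> K2 / (2 * \<zeta>) * \<bar>Y\<bar>^3"
      proof -
        have "\<bar>f2 r / 2 * Y\<^sup>2\<bar> \<le> K2 / 2 * (\<bar>Y\<bar>\<^sup>2 * (\<bar>Y\<bar> / \<zeta>))"
          unfolding abs_mult using f2b[OF r0] pos mult_left_mono[of 1 "\<bar>Y\<bar> / \<zeta>" "Y\<^sup>2"] Y
          by (intro mult_mono) auto
        then show ?thesis using pos by (simp add: power2_eq_square power3_eq_cube)
      qed
      have b: "\<bar>Y\<bar> \<le> 1 / \<zeta>\<^sup>2 * \<bar>Y\<bar>^3"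
      proof -
        have "\<bar>Y\<bar> * \<zeta>\<^sup>2 \<le> \<bar>Y\<bar> * \<bar>Y\<bar>\<^sup>2" using Y pos by (intro mult_left_mono power_mono) auto
        then show ?thesis using pos by (simp add: field_simps power2_eq_square power3_eq_cube)
      qed
      have c: "f (max 0 (r + Y)) \<le> f r + f1 r * Y + 1 / \<zeta>\<^sup>2 * \<bar>Y\<bar>^3"
      proof (cases "0 \<le> r + Y")
        case True
        have "f (r + Y) \<le> f r + f1 r * Y"
        proof (cases "0 \<le> Y")
          case True then show ?thesis using f_increment(2)[of r "r+Y"] r0 by simp
        next
          case False then show ?thesis using f_increment(1)[of "r+Y" r] \<open>0 \<le> r + Y\<close> by simp
        qed
        then show ?thesis using b True by (simp add: max_absorb2)
      next
        case False
        have "\<bar>f1 r * Y\<bar> \<le> 1 * \<bar>Y\<bar>" unfolding abs_mult using f1_bounds[OF r0(1)] q_pos by (intro mult_right_mono) auto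
        then have "- (1 / \<zeta>\<^sup>2 * \<bar>Y\<bar>^3) \<le> f1 r * Y" using b by linarith
        then show ?thesis using False f_nonneg[OF r0(1)] by (simp add: f_0)
      qed
      show ?thesis using a c C1(2) by (simp add: distrib_right)
    qed
  qed
qed

text \<open>Replacing \<open>\<Phi> s\<close> by \<open>s\<close> makes the integral elementary,
  with primitive \<open>4 * ls / \<beta> / \<phi> s\<close>. The division by \<beta> is the reason
  for the strict positivity.\<close>

lemma gamma_lower_bound:
  assumes "0 < \<beta>" shows "\<beta> * q \<le> 2 * ls * \<gamma>"
proof -
  have "G R \<le> integral {0..R} (\<lambda>s. s / \<phi> s)"
    by (rule integral_le)
       (auto intro!: integrable_continuous_interval continuous_on_subset[OF G_integrand_cont] continuous_intros phi_cont
         divide_right_mono Phi_le less_imp_le[OF phi_pos])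
  also have "((\<lambda>s. s / \<phi> s) has_integral (4 * ls / \<beta> / \<phi> R - 4 * ls / \<beta> / \<phi> 0)) {0..R}"
    using R assms ls
    by (intro fundamental_theorem_of_calculus)
       (auto intro!: derivative_eq_intros phi_deriv simp: has_real_derivative_iff_has_vector_derivative[symmetric] field_simps power2_eq_square)
  then have "integral {0..R} (\<lambda>s. s / \<phi> s) = 4 * ls / \<beta> / \<phi> R - 4 * ls / \<beta> / \<phi> 0" by (rule integral_unique)
  also have "\<dots> \<le> 4 * ls / \<beta> / \<phi> R" using ls assms phi_pos[of 0] by simp
  finally have "\<gamma> * G R \<le> \<gamma> * (4 * ls / \<beta> / \<phi> R)" using gamma_pos by (intro mult_left_mono) auto
  then have "1 \<le> \<gamma> * (4 * ls / \<beta> / \<phi> R)" by (simp only: gamma_G)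
  then show ?thesis using assms phi_pos[of R] by (simp add: q_def field_simps)
qed

end

section \<open>Borel measures on metric spaces\<close>

text \<open>Continuous functions decreasing to the indicator of a closed set. The distance to the
  empty set is 0 by convention, so that set is treated separately throughout.\<close>

definition closed_approx :: "'b::metric_space set \<Rightarrow> nat \<Rightarrow> 'b \<Rightarrow> real" where
  "closed_approx F n x = max 0 (1 - real n * infdist x F)"

lemma closed_approx_continuous: "continuous_on UNIV (closed_approx F n)"
  unfolding closed_approx_def[abs_def] by (intro continuous_intros)

lemma closed_approx_bounds: "0 \<le> closed_approx F n x" "closed_approx F n x \<le> 1"
  by (auto simp: closed_approx_def infdist_nonneg)

lemma closed_approx_tendsto:
  assumes "closed F" "F \<noteq> {}"
  shows "(\<lambda>n. closed_approx F n x) \<longlonglongrightarrow> indicator F x"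
proof (cases "x \<in> F")
  case True
  then show ?thesis by (simp add: closed_approx_def)
next
  case False
  then have pos: "0 < infdist x F"
    using in_closed_iff_infdist_zero[OF assms, of x] infdist_nonneg[of x F] by auto
  obtain N :: nat where N: "1 / infdist x F < real N" using reals_Archimedean2 by blast
  have "closed_approx F n x = 0" if "N \<le> n" for n
  proof -
    have "1 < real N * infdist x F" using N pos by (simp add: field_simps)
    also have "\<dots> \<le> real n * infdist x F" using that pos by (intro mult_right_mono) auto
    finally show ?thesis by (simp add: closed_approx_def)
  qed
  then have "eventually (\<lambda>n. closed_approx F n x = indicator F x) sequentially"
    using False by (auto simp: eventually_sequentially)
  then show ?thesis by (rule tendsto_eventually)
qed

lemma emeasure_closed_tendsto:
  fixes M :: "'b::metric_space measure"
  assumes M: "sets M = sets borel" "finite_measure M" and F: "closed F" "F \<noteq> {}"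
  shows "(\<lambda>n. \<integral>\<^sup>+x. ennreal (closed_approx F n x) \<partial>M) \<longlonglongrightarrow> emeasure M F"
proof -
  interpret finite_measure M by fact
  have "(\<lambda>n. \<integral>\<^sup>+x. ennreal (closed_approx F n x) \<partial>M) \<longlonglongrightarrow> (\<integral>\<^sup>+x. indicator F x \<partial>M)"
  proof (rule nn_integral_dominated_convergence[where w="\<lambda>_. 1"])
    show "(\<lambda>x. ennreal (closed_approx F n x)) \<in> borel_measurable M" for n
      using closed_approx_continuous[of F n]
      by (intro measurable_compose[OF _ measurable_ennreal])
         (simp add: measurable_cong_sets[OF M(1) refl] borel_measurable_continuous_onI)
    show "AE x in M. (\<lambda>n. ennreal (closed_approx F n x)) \<longlonglongrightarrow> indicator F x"
    proof (rule AE_I2)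
      fix x
      have "(\<lambda>n. ennreal (closed_approx F n x)) \<longlonglongrightarrow> ennreal (indicator F x)"
        by (intro tendsto_ennrealI closed_approx_tendsto F)
      then show "(\<lambda>n. ennreal (closed_approx F n x)) \<longlonglongrightarrow> indicator F x" by (simp add: ennreal_indicator)
    qed
    show "(indicator F :: 'b \<Rightarrow> ennreal) \<in> borel_measurable M"
      using F by (intro borel_measurable_indicator) (simp add: M)
  qed (use closed_approx_bounds(2) in \<open>auto simp: emeasure_finite top.not_eq_extremum[symmetric] ennreal_le_1\<close>)
  moreover have "F \<in> sets M" using F by (simp add: M)
  ultimately show ?thesis by simp
qed

text \<open>Closed sets are an intersection-stable generator, and their indicators are limits of the
  test functions. Equality of laws thus reduces to identities that pass to limits by dominated
  convergence.\<close>

lemma borel_measure_eqI: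
  fixes M N :: "'b::metric_space measure"
  assumes M: "sets M = sets borel" "prob_space M" and N: "sets N = sets borel" "prob_space N"
    and eq: "\<And>g. continuous_on UNIV g \<Longrightarrow> (\<And>x. 0 \<le> g x \<and> g x \<le> 1) \<Longrightarrow>
        (\<integral>\<^sup>+x. ennreal (g x) \<partial>M) = (\<integral>\<^sup>+x. ennreal (g x) \<partial>N)"
  shows "M = N"
proof -
  interpret M: prob_space M by fact
  interpret N: prob_space N by fact
  have fin: "finite_measure M" "finite_measure N" by unfold_locales
  show ?thesis
  proof (rule measure_eqI_generator_eq[where E="Collect closed" and \<Omega>=UNIV and A="\<lambda>_. UNIV"])
    show "Int_stable (Collect closed)" by (auto simp: Int_stable_def)
    show "sets M = sigma_sets UNIV (Collect closed)" "sets N = sigma_sets UNIV (Collect closed)"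
      using M(1) N(1) by (auto simp: borel_eq_closed)
    show "emeasure M F = emeasure N F" if "F \<in> Collect closed" for F
    proof (cases "F = {}")
      case False
      have "(\<lambda>n. \<integral>\<^sup>+x. ennreal (closed_approx F n x) \<partial>M) = (\<lambda>n. \<integral>\<^sup>+x. ennreal (closed_approx F n x) \<partial>N)"
        using closed_approx_continuous closed_approx_bounds by (intro ext eq) blast+
      then show ?thesis
        using emeasure_closed_tendsto[OF M(1) fin(1), of F] emeasure_closed_tendsto[OF N(1) fin(2), of F] that False
        by (auto intro: LIMSEQ_unique)
    qed simp
    have "space M = UNIV" using sets_eq_imp_space_eq[OF M(1)] by simp
    then show "emeasure M UNIV \<noteq> \<infinity>" for i :: nat by simp
  qed auto
qed

section \<open>Transition kernels of randomly chosen continuous maps\<close>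

lemma expectation_continuous_on:
  fixes \<Psi> :: "'b::metric_space \<Rightarrow> 'w \<Rightarrow> 'c::metric_space" and g :: "'c \<Rightarrow> real"
  assumes P: "prob_space P" and meas: "\<And>z. \<Psi> z \<in> borel_measurable P"
    and cont: "\<And>\<omega>. \<omega> \<in> space P \<Longrightarrow> continuous_on S (\<lambda>z. \<Psi> z \<omega>)"
    and g: "continuous_on UNIV g" "\<And>x. 0 \<le> g x \<and> g x \<le> 1"
  shows "continuous_on S (\<lambda>z. \<integral>\<omega>. g (\<Psi> z \<omega>) \<partial>P)"
  unfolding continuous_on_sequentially
proof safe
  interpret prob_space P by fact
  fix X a assume X: "a \<in> S" "\<forall>n. X n \<in> S" "X \<longlonglongrightarrow> a"
  have gm: "(\<lambda>\<omega>. g (\<Psi> z \<omega>)) \<in> borel_measurable P" for z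
    by (rule measurable_compose[OF meas borel_measurable_continuous_onI[OF g(1)]])
  show "((\<lambda>z. \<integral>\<omega>. g (\<Psi> z \<omega>) \<partial>P) \<circ> X) \<longlonglongrightarrow> (\<integral>\<omega>. g (\<Psi> a \<omega>) \<partial>P)"
    unfolding comp_def
  proof (rule integral_dominated_convergence[where w="\<lambda>_. 1"])
    show "AE \<omega> in P. (\<lambda>n. g (\<Psi> (X n) \<omega>)) \<longlonglongrightarrow> g (\<Psi> a \<omega>)"
    proof (rule AE_I2)
      fix \<omega> assume "\<omega> \<in> space P"
      then have "(\<lambda>n. \<Psi> (X n) \<omega>) \<longlonglongrightarrow> \<Psi> a \<omega>"
        using cont[of \<omega>] X unfolding continuous_on_sequentially by (auto simp: comp_def)
      then show "(\<lambda>n. g (\<Psi> (X n) \<omega>)) \<longlonglongrightarrow> g (\<Psi> a \<omega>)"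
        using continuous_on_tendsto_compose[OF g(1)] by auto
    qed
  qed (use gm g in auto)
qed

text \<open>Integrals of test functions are continuous in \<open>z\<close> on \<open>S\<close> and
  on its complement, hence Borel; closed sets follow by approximation. The two pieces are needed
  because the coupling switches the type of noise and jumps at the boundary of the switching region.
  Continuity takes the place of joint measurability of \<Psi>.\<close>

lemma kernel_measurable:
  fixes \<Psi> :: "'b::metric_space \<Rightarrow> 'w \<Rightarrow> 'c::metric_space"
  assumes P: "prob_space P" and meas: "\<And>z. \<Psi> z \<in> borel_measurable P" and S: "S \<in> sets borel"
    and cont: "\<And>\<omega>. \<omega> \<in> space P \<Longrightarrow> continuous_on S (\<lambda>z. \<Psi> z \<omega>)"
      "\<And>\<omega>. \<omega> \<in> space P \<Longrightarrow> continuous_on (- S) (\<lambda>z. \<Psi> z \<omega>)"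
  shows "(\<lambda>z. distr P borel (\<Psi> z)) \<in> borel \<rightarrow>\<^sub>M subprob_algebra borel"
proof (rule measurable_subprob_algebra_generated[where \<Omega>=UNIV and G="Collect closed"])
  interpret prob_space P by fact
  have ps: "prob_space (distr P borel (\<Psi> z))" for z by (rule prob_space_distr[OF meas])
  then show "subprob_space (distr P borel (\<Psi> z))" for z by (rule prob_space_imp_subprob_space)
  show "sets (borel :: 'c measure) = sigma_sets UNIV (Collect closed)" by (simp add: borel_eq_closed)
  show "Int_stable (Collect (closed :: 'c set \<Rightarrow> bool))" by (auto simp: Int_stable_def)
  have *: "(\<lambda>z. \<integral>\<^sup>+x. ennreal (g x) \<partial>distr P borel (\<Psi> z)) \<in> borel_measurable borel"
    if g: "continuous_on UNIV g" "\<And>x. 0 \<le> g x \<and> g x \<le> 1" for g :: "'c \<Rightarrow> real"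
  proof -
    have gm: "(\<lambda>\<omega>. g (\<Psi> z \<omega>)) \<in> borel_measurable P" for z
      by (rule measurable_compose[OF meas borel_measurable_continuous_onI[OF g(1)]])
    have "(\<integral>\<^sup>+x. ennreal (g x) \<partial>distr P borel (\<Psi> z)) = ennreal (\<integral>\<omega>. g (\<Psi> z \<omega>) \<partial>P)" for z
    proof -
      have "(\<integral>\<^sup>+x. ennreal (g x) \<partial>distr P borel (\<Psi> z)) = (\<integral>\<^sup>+\<omega>. ennreal (g (\<Psi> z \<omega>)) \<partial>P)"
        by (rule nn_integral_distr[OF meas]) (use borel_measurable_continuous_onI[OF g(1)] in auto)
      also have "\<dots> = ennreal (\<integral>\<omega>. g (\<Psi> z \<omega>) \<partial>P)"
        using gm g by (intro nn_integral_eq_integral) (auto intro!: integrable_const_bound[where B=1])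
      finally show ?thesis .
    qed
    moreover have "(\<lambda>z. if z \<in> S then \<integral>\<omega>. g (\<Psi> z \<omega>) \<partial>P else \<integral>\<omega>. g (\<Psi> z \<omega>) \<partial>P) \<in> borel_measurable borel"
      by (intro borel_measurable_continuous_on_if S expectation_continuous_on P meas cont g) auto
    ultimately show ?thesis by simp
  qed
  show "(\<lambda>z. emeasure (distr P borel (\<Psi> z)) F) \<in> borel_measurable borel" if "F \<in> Collect closed" for F
  proof (cases "F = {}")
    case False
    show ?thesis
    proof (rule borel_measurable_LIMSEQ_order)
      show "(\<lambda>z. \<integral>\<^sup>+x. ennreal (closed_approx F n x) \<partial>distr P borel (\<Psi> z)) \<in> borel_measurable borel" for n
        using closed_approx_continuous closed_approx_bounds by (intro *) blast+
      show "(\<lambda>n. \<integral>\<^sup>+x. ennreal (closed_approx F n x) \<partial>distr P borel (\<Psi> z)) \<longlonglongrightarrow> emeasure (distr P borel (\<Psi> z)) F" for z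
        using that False ps[of z] by (intro emeasure_closed_tendsto) (auto simp: prob_space_def)
    qed
  qed simp
  have "emeasure (distr P borel (\<Psi> z)) UNIV = 1" for z
    using prob_space.emeasure_space_1[OF ps[of z]] by simp
  then show "(\<lambda>z. emeasure (distr P borel (\<Psi> z)) UNIV) \<in> borel_measurable borel" by simp
qed auto

section \<open>Reflection invariance of Gaussian product measures\<close>

abbreviation gauss :: "real \<Rightarrow> real measure" where
  "gauss \<sigma> \<equiv> density lborel (\<lambda>x. ennreal (normal_density 0 \<sigma> x))"

text \<open>The matrix with rows \<open>(p, q)\<close> and \<open>(q, -p)\<close> is an orthogonal
  reflection, so it preserves the product density. The change of variables is done by two
  one-dimensional affine substitutions with Fubini in between; each has Jacobian
  \<open>\<bar>q\<bar>\<close>.\<close>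

lemma gauss_planar_reflection:
  fixes g :: "real \<Rightarrow> real \<Rightarrow> ennreal"
  assumes \<sigma>: "0 < \<sigma>" and pq: "p\<^sup>2 + q\<^sup>2 = 1" and q: "q \<noteq> 0"
    and g[measurable]: "(\<lambda>(x, y). g x y) \<in> borel_measurable (borel \<Otimes>\<^sub>M borel)"
  shows "(\<integral>\<^sup>+s. \<integral>\<^sup>+t. g (p * s + q * t) (q * s - p * t) \<partial>gauss \<sigma> \<partial>gauss \<sigma>) = (\<integral>\<^sup>+s. \<integral>\<^sup>+t. g s t \<partial>gauss \<sigma> \<partial>gauss \<sigma>)"
proof -
  define \<phi> where "\<phi> = (\<lambda>x. ennreal (normal_density 0 \<sigma> x))"
  have [measurable]: "\<phi> \<in> borel_measurable borel" by (simp add: \<phi>_def)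
  have inv: "\<phi> s * \<phi> t = \<phi> (p * s + q * t) * \<phi> (q * s - p * t)" for s t
  proof -
    have "(p * s + q * t)\<^sup>2 + (q * s - p * t)\<^sup>2 = (p\<^sup>2 + q\<^sup>2) * (s\<^sup>2 + t\<^sup>2)"
      by (simp add: power2_eq_square algebra_simps)
    then have *: "(p * s + q * t)\<^sup>2 + (q * s - p * t)\<^sup>2 = s\<^sup>2 + t\<^sup>2" using pq by simp
    have "normal_density 0 \<sigma> x * normal_density 0 \<sigma> y = 1 / (2 * pi * \<sigma>\<^sup>2) * exp (- (x\<^sup>2 + y\<^sup>2) / (2 * \<sigma>\<^sup>2))" for x y
      unfolding normal_density_def by (simp add: exp_add[symmetric] add_divide_distrib diff_divide_distrib)
    then have "normal_density 0 \<sigma> s * normal_density 0 \<sigma> t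
        = normal_density 0 \<sigma> (p * s + q * t) * normal_density 0 \<sigma> (q * s - p * t)" using * by simp
    then show ?thesis unfolding \<phi>_def by (simp add: ennreal_mult[symmetric])
  qed
  have rot: "x - p * (p * x + q * y) = q * (q * x - p * y)" for x y
  proof -
    have "x - p * (p * x + q * y) = (p\<^sup>2 + q\<^sup>2) * x - p * (p * x + q * y)" using pq by simp
    then show ?thesis by (simp add: algebra_simps power2_eq_square)
  qed
  \<comment> \<open>The integrand after substituting \<open>a = p * s + q * t\<close> for
    \<open>t\<close> with \<open>s\<close> kept. The second substitution is
    \<open>s = p * a + q * b\<close> with \<open>a\<close> kept.\<close>
  define F where "F = (\<lambda>s a. \<phi> s * \<phi> ((a - p * s) / q) * g a ((s - p * a) / q))"
  have [measurable]: "(\<lambda>(x, y). F x y) \<in> borel_measurable (borel \<Otimes>\<^sub>M borel)"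
    "\<And>x. F x \<in> borel_measurable borel" "\<And>a. (\<lambda>s. F s a) \<in> borel_measurable borel"
    unfolding F_def by measurable
  \<comment> \<open>Both sides carry the factor \<open>\<bar>q\<bar>\<close>, which is cancelled at
    the end; this avoids inverses of extended reals.\<close>
  have "ennreal \<bar>q\<bar> * (\<integral>\<^sup>+s. \<integral>\<^sup>+t. g (p * s + q * t) (q * s - p * t) \<partial>gauss \<sigma> \<partial>gauss \<sigma>)
     = ennreal \<bar>q\<bar> * (\<integral>\<^sup>+s. \<integral>\<^sup>+t. \<phi> s * (\<phi> t * g (p * s + q * t) (q * s - p * t)) \<partial>lborel \<partial>lborel)"
    unfolding \<phi>_def[symmetric] by (simp add: nn_integral_density nn_integral_cmult)
  also have "\<dots> = (\<integral>\<^sup>+s. ennreal \<bar>q\<bar> * (\<integral>\<^sup>+t. F s (p * s + q * t) \<partial>lborel) \<partial>lborel)"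
  proof (subst nn_integral_cmult[symmetric])
    show "(\<integral>\<^sup>+s. ennreal \<bar>q\<bar> * (\<integral>\<^sup>+t. \<phi> s * (\<phi> t * g (p * s + q * t) (q * s - p * t)) \<partial>lborel) \<partial>lborel)
      = (\<integral>\<^sup>+s. ennreal \<bar>q\<bar> * (\<integral>\<^sup>+t. F s (p * s + q * t) \<partial>lborel) \<partial>lborel)"
    proof (intro nn_integral_cong arg_cong2[where f="(*)"] refl)
      fix s t :: real
      have "(p * s + q * t - p * s) / q = t" using q by simp
      moreover have "s - p * (p * s + q * t) = q * (q * s - p * t)" by (rule rot)
      then have "(s - p * (p * s + q * t)) / q = q * s - p * t" using q by simp
      ultimately show "\<phi> s * (\<phi> t * g (p * s + q * t) (q * s - p * t)) = F s (p * s + q * t)"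
        unfolding F_def by (simp add: mult.assoc)
    qed
  qed measurable
  also have "\<dots> = (\<integral>\<^sup>+s. \<integral>\<^sup>+a. F s a \<partial>lborel \<partial>lborel)"
    using q by (intro nn_integral_cong nn_integral_real_affine[symmetric]) auto
  also have "\<dots> = (\<integral>\<^sup>+a. \<integral>\<^sup>+s. F s a \<partial>lborel \<partial>lborel)"
    by (rule lborel_pair.Fubini') simp
  also have "\<dots> = (\<integral>\<^sup>+a. ennreal \<bar>q\<bar> * (\<integral>\<^sup>+b. F (p * a + q * b) a \<partial>lborel) \<partial>lborel)"
    using q by (intro nn_integral_cong nn_integral_real_affine) auto
  also have "\<dots> = (\<integral>\<^sup>+a. ennreal \<bar>q\<bar> * (\<integral>\<^sup>+b. \<phi> a * (\<phi> b * g a b) \<partial>lborel) \<partial>lborel)"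
  proof (intro nn_integral_cong arg_cong2[where f="(*)"] refl)
    fix a b :: real
    have "a - p * (p * a + q * b) = q * (q * a - p * b)" by (rule rot)
    then have "(a - p * (p * a + q * b)) / q = q * a - p * b" using q by simp
    moreover have "(p * a + q * b - p * a) / q = b" using q by simp
    ultimately show "F (p * a + q * b) a = \<phi> a * (\<phi> b * g a b)"
      unfolding F_def by (simp add: mult.assoc[symmetric] inv[of a b])
  qed
  also have "\<dots> = ennreal \<bar>q\<bar> * (\<integral>\<^sup>+a. \<integral>\<^sup>+b. \<phi> a * (\<phi> b * g a b) \<partial>lborel \<partial>lborel)"
    by (rule nn_integral_cmult) measurable
  also have "\<dots> = ennreal \<bar>q\<bar> * (\<integral>\<^sup>+s. \<integral>\<^sup>+t. g s t \<partial>gauss \<sigma> \<partial>gauss \<sigma>)"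
    unfolding \<phi>_def[symmetric] by (simp add: nn_integral_density nn_integral_cmult)
  finally show ?thesis using q by (simp add: ennreal_mult_cancel_left)
qed

lemma gauss_flip:
  assumes [measurable]: "g \<in> borel_measurable borel"
  shows "(\<integral>\<^sup>+s. g (- s) \<partial>gauss \<sigma>) = (\<integral>\<^sup>+s. g s \<partial>gauss \<sigma>)"
proof -
  have "(\<integral>\<^sup>+s. g s \<partial>gauss \<sigma>) = (\<integral>\<^sup>+s. ennreal (normal_density 0 \<sigma> s) * g s \<partial>lborel)"
    by (simp add: nn_integral_density)
  also have "\<dots> = ennreal \<bar>- 1\<bar> * (\<integral>\<^sup>+s. ennreal (normal_density 0 \<sigma> (0 + - 1 * s)) * g (0 + - 1 * s) \<partial>lborel)"
    by (rule nn_integral_real_affine) auto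
  also have "\<dots> = (\<integral>\<^sup>+s. g (- s) \<partial>gauss \<sigma>)" by (simp add: nn_integral_density normal_density_def)
  finally show ?thesis by simp
qed

section \<open>Planar and Householder reflections of finite Gaussian vectors\<close>

definition planar :: "'i set \<Rightarrow> 'i \<Rightarrow> 'i \<Rightarrow> real \<Rightarrow> real \<Rightarrow> ('i \<Rightarrow> real) \<Rightarrow> 'i \<Rightarrow> real" where
  "planar I i j p q a = (\<lambda>k\<in>I. if k = i then p * a i + q * a j else if k = j then q * a i - p * a j else a k)"

definition householder :: "'i set \<Rightarrow> ('i \<Rightarrow> real) \<Rightarrow> ('i \<Rightarrow> real) \<Rightarrow> 'i \<Rightarrow> real" where
  "householder I c a = (\<lambda>k\<in>I. a k - 2 * (\<Sum>j\<in>I. c j * a j) * c k)"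

lemma measurable_planar [measurable]:
  "i \<in> I \<Longrightarrow> j \<in> I \<Longrightarrow> planar I i j p q \<in> PiM I (\<lambda>_. gauss \<sigma>) \<rightarrow>\<^sub>M PiM I (\<lambda>_. gauss \<sigma>)"
  unfolding planar_def[abs_def] by (intro measurable_restrict) auto

lemma measurable_householder [measurable]:
  "householder I c \<in> PiM I (\<lambda>_. gauss \<sigma>) \<rightarrow>\<^sub>M PiM I (\<lambda>_. gauss \<sigma>)"
  unfolding householder_def[abs_def]
  by (intro measurable_restrict) simp

lemma prob_space_gauss: "0 < \<sigma> \<Longrightarrow> prob_space (gauss \<sigma>)"
  by (rule prob_space_normal_density)

text \<open>Fubini isolates the coordinates \<open>i\<close> and \<open>j\<close>; with the others
  fixed, only the two-dimensional statement remains.\<close>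

lemma nn_integral_planar:
  assumes \<sigma>: "0 < \<sigma>" and I: "finite I" "i \<in> I" "j \<in> I" "i \<noteq> j" and pq: "p\<^sup>2 + q\<^sup>2 = 1" "q \<noteq> 0"
    and g: "g \<in> borel_measurable (PiM I (\<lambda>_. gauss \<sigma>))"
  shows "(\<integral>\<^sup>+a. g (planar I i j p q a) \<partial>PiM I (\<lambda>_. gauss \<sigma>)) = (\<integral>\<^sup>+a. g a \<partial>PiM I (\<lambda>_. gauss \<sigma>))"
proof -
  interpret N: prob_space "gauss \<sigma>" by (rule prob_space_gauss[OF \<sigma>])
  interpret product_sigma_finite "\<lambda>_. gauss \<sigma>" by unfold_locales
  define J where "J = I - {i, j}"
  have J: "finite J" "i \<notin> insert j J" "j \<notin> J" and IJ: "insert i (insert j J) = I" using I by (auto simp: J_def)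
  have split: "(\<integral>\<^sup>+a. h a \<partial>PiM I (\<lambda>_. gauss \<sigma>)) = (\<integral>\<^sup>+x. \<integral>\<^sup>+t. \<integral>\<^sup>+s. h (x(j := t, i := s)) \<partial>gauss \<sigma> \<partial>gauss \<sigma> \<partial>PiM J (\<lambda>_. gauss \<sigma>))"
    if h: "h \<in> borel_measurable (PiM I (\<lambda>_. gauss \<sigma>))" for h
  proof -
    have h': "h \<in> borel_measurable (PiM (insert i (insert j J)) (\<lambda>_. gauss \<sigma>))" using h by (simp add: IJ)
    have "(\<integral>\<^sup>+a. h a \<partial>PiM (insert i (insert j J)) (\<lambda>_. gauss \<sigma>))
       = (\<integral>\<^sup>+x. \<integral>\<^sup>+s. h (x(i := s)) \<partial>gauss \<sigma> \<partial>PiM (insert j J) (\<lambda>_. gauss \<sigma>))"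
      using J h' by (intro product_nn_integral_insert) auto
    also have "\<dots> = (\<integral>\<^sup>+x. \<integral>\<^sup>+t. \<integral>\<^sup>+s. h (x(j := t, i := s)) \<partial>gauss \<sigma> \<partial>gauss \<sigma> \<partial>PiM J (\<lambda>_. gauss \<sigma>))"
    proof (rule product_nn_integral_insert)
      have "(\<lambda>(x, s). h (x(i := s))) \<in> borel_measurable (PiM (insert j J) (\<lambda>_. gauss \<sigma>) \<Otimes>\<^sub>M gauss \<sigma>)"
        using measurable_compose[OF measurable_add_dim h'] by (simp add: case_prod_beta')
      then show "(\<lambda>x. \<integral>\<^sup>+s. h (x(i := s)) \<partial>gauss \<sigma>) \<in> borel_measurable (PiM (insert j J) (\<lambda>_. gauss \<sigma>))"
        by (rule N.borel_measurable_nn_integral)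
    qed (use J in auto)
    finally show ?thesis by (simp add: IJ)
  qed
  have gp: "(\<lambda>a. g (planar I i j p q a)) \<in> borel_measurable (PiM I (\<lambda>_. gauss \<sigma>))"
    by (rule measurable_compose[OF measurable_planar g]) (use I in auto)
  have "(\<integral>\<^sup>+t. \<integral>\<^sup>+s. g (planar I i j p q (x(j := t, i := s))) \<partial>gauss \<sigma> \<partial>gauss \<sigma>)
     = (\<integral>\<^sup>+t. \<integral>\<^sup>+s. g (x(j := t, i := s)) \<partial>gauss \<sigma> \<partial>gauss \<sigma>)"
    if x: "x \<in> space (PiM J (\<lambda>_. gauss \<sigma>))" for x
  proof -
    have "planar I i j p q (x(j := t, i := s)) = x(j := q * s - p * t, i := p * s + q * t)" for s t
      using x I by (auto simp: planar_def fun_eq_iff space_PiM PiE_def extensional_def J_def)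
    moreover have m: "(\<lambda>(t, s). g (x(j := t, i := s))) \<in> borel_measurable (gauss \<sigma> \<Otimes>\<^sub>M gauss \<sigma>)"
    proof -
      have 1: "(\<lambda>z. (x(j := fst z))) \<in> gauss \<sigma> \<Otimes>\<^sub>M gauss \<sigma> \<rightarrow>\<^sub>M PiM (insert j J) (\<lambda>_. gauss \<sigma>)"
        using x by (intro measurable_fun_upd[where J=J]) auto
      have 2: "(\<lambda>z. ((x(j := fst z))(i := snd z))) \<in> gauss \<sigma> \<Otimes>\<^sub>M gauss \<sigma> \<rightarrow>\<^sub>M PiM I (\<lambda>_. gauss \<sigma>)"
        by (rule measurable_fun_upd[where J="insert j J"]) (use IJ 1 in auto)
      show ?thesis using measurable_compose[OF 2 g] by (simp add: case_prod_beta')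
    qed
    then have m': "(\<lambda>(s, t). g (x(j := t, i := s))) \<in> borel_measurable (borel \<Otimes>\<^sub>M borel)"
      by (subst measurable_split_conv, subst measurable_pair_swap_iff)
         (simp add: case_prod_beta' measurable_cong_sets[OF sets_pair_measure_cong[of "gauss \<sigma>" borel "gauss \<sigma>" borel] refl])
    have m2: "(\<lambda>(s, t). g (x(j := q * s - p * t, i := p * s + q * t))) \<in> borel_measurable (borel \<Otimes>\<^sub>M borel)"
      using measurable_compose[OF _ m', of "\<lambda>(s, t). (p * s + q * t, q * s - p * t)" "borel \<Otimes>\<^sub>M borel"]
      by (simp add: case_prod_beta')
    interpret NN: pair_sigma_finite "gauss \<sigma>" "gauss \<sigma>" by unfold_locales
    have sw: "(\<integral>\<^sup>+t. \<integral>\<^sup>+s. k s t \<partial>gauss \<sigma> \<partial>gauss \<sigma>) = (\<integral>\<^sup>+s. \<integral>\<^sup>+t. k s t \<partial>gauss \<sigma> \<partial>gauss \<sigma>)"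
      if "(\<lambda>(s, t). k s t) \<in> borel_measurable (borel \<Otimes>\<^sub>M borel)" for k :: "real \<Rightarrow> real \<Rightarrow> ennreal"
      using that by (intro NN.Fubini')
        (simp add: case_prod_beta' measurable_cong_sets[OF sets_pair_measure_cong[of "gauss \<sigma>" borel "gauss \<sigma>" borel] refl])
    ultimately show ?thesis
      using gauss_planar_reflection[OF \<sigma> pq m'] sw[OF m'] sw[OF m2] by simp
  qed
  then show ?thesis unfolding split[OF gp] split[OF g] by (rule nn_integral_cong)
qed

lemma nn_integral_flip:
  assumes \<sigma>: "0 < \<sigma>" and I: "finite I" "i \<in> I"
    and g: "g \<in> borel_measurable (PiM I (\<lambda>_. gauss \<sigma>))"
  shows "(\<integral>\<^sup>+a. g (a(i := - a i)) \<partial>PiM I (\<lambda>_. gauss \<sigma>)) = (\<integral>\<^sup>+a. g a \<partial>PiM I (\<lambda>_. gauss \<sigma>))"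
proof -
  interpret N: prob_space "gauss \<sigma>" by (rule prob_space_gauss[OF \<sigma>])
  interpret product_sigma_finite "\<lambda>_. gauss \<sigma>" by unfold_locales
  define J where "J = I - {i}"
  have J: "finite J" "i \<notin> J" and IJ: "insert i J = I" using I by (auto simp: J_def)
  have split: "(\<integral>\<^sup>+a. h a \<partial>PiM I (\<lambda>_. gauss \<sigma>)) = (\<integral>\<^sup>+x. \<integral>\<^sup>+s. h (x(i := s)) \<partial>gauss \<sigma> \<partial>PiM J (\<lambda>_. gauss \<sigma>))"
    if h: "h \<in> borel_measurable (PiM I (\<lambda>_. gauss \<sigma>))" for h
    using product_nn_integral_insert[OF J, of h] h by (simp add: IJ)
  have fl: "(\<lambda>a. a(i := - a i)) \<in> PiM I (\<lambda>_. gauss \<sigma>) \<rightarrow>\<^sub>M PiM I (\<lambda>_. gauss \<sigma>)"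
    by (rule measurable_fun_upd[where J=I]) (use I in auto)
  have gp: "(\<lambda>a. g (a(i := - a i))) \<in> borel_measurable (PiM I (\<lambda>_. gauss \<sigma>))"
    by (rule measurable_compose[OF fl g])
  have "(\<integral>\<^sup>+s. g (x(i := - s)) \<partial>gauss \<sigma>) = (\<integral>\<^sup>+s. g (x(i := s)) \<partial>gauss \<sigma>)"
    if x: "x \<in> space (PiM J (\<lambda>_. gauss \<sigma>))" for x
  proof (rule gauss_flip)
    have "(\<lambda>s. x(i := s)) \<in> gauss \<sigma> \<rightarrow>\<^sub>M PiM I (\<lambda>_. gauss \<sigma>)"
      by (rule measurable_fun_upd[where J=J]) (use IJ x in auto)
    from measurable_compose[OF this g] show "(\<lambda>s. g (x(i := s))) \<in> borel_measurable borel" by simp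
  qed
  then show ?thesis unfolding split[OF gp] split[OF g] by (simp cong: nn_integral_cong)
qed

lemma planar_inner:
  assumes "finite I" "i \<in> I" "j \<in> I" "i \<noteq> j" "p\<^sup>2 + q\<^sup>2 = 1"
  shows "(\<Sum>k\<in>I. planar I i j p q c k * planar I i j p q a k) = (\<Sum>k\<in>I. c k * a k)"
proof -
  have I: "I = insert i (insert j (I - {i, j}))" using assms by auto
  have "(p * c i + q * c j) * (p * a i + q * a j) + (q * c i - p * c j) * (q * a i - p * a j)
      = (p\<^sup>2 + q\<^sup>2) * (c i * a i + c j * a j)" by (simp add: algebra_simps power2_eq_square)
  then have "(p * c i + q * c j) * (p * a i + q * a j) + (q * c i - p * c j) * (q * a i - p * a j) = c i * a i + c j * a j"
    using assms by simp
  moreover have "(\<Sum>k\<in>I - {i, j}. planar I i j p q c k * planar I i j p q a k) = (\<Sum>k\<in>I - {i, j}. c k * a k)"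
    by (intro sum.cong) (auto simp: planar_def)
  moreover have s: "(\<Sum>k\<in>I. h k) = h i + (h j + (\<Sum>k\<in>I - {i, j}. h k))" for h :: "'a \<Rightarrow> real"
    using assms by (subst I) (simp add: insert_commute)
  ultimately show ?thesis using assms by (simp add: s planar_def)
qed

text \<open>A planar reflection is an orthogonal involution, so conjugating by it moves the
  Householder vector \<open>c\<close> to its image.\<close>

lemma householder_conj_planar:
  assumes "finite I" "i \<in> I" "j \<in> I" "i \<noteq> j" "p\<^sup>2 + q\<^sup>2 = 1"
  shows "householder I c a = planar I i j p q (householder I (planar I i j p q c) (planar I i j p q a))"
proof
  fix k
  define m where "m = (\<Sum>k\<in>I. c k * a k)"
  have 1: "p * (p * x + q * y) + q * (q * x - p * y) = x" for x y
  proof -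
    have "p * (p * x + q * y) + q * (q * x - p * y) = (p\<^sup>2 + q\<^sup>2) * x" by (simp add: algebra_simps power2_eq_square)
    then show ?thesis using assms by simp
  qed
  have 2: "q * (p * x + q * y) - p * (q * x - p * y) = y" for x y
  proof -
    have "q * (p * x + q * y) - p * (q * x - p * y) = (p\<^sup>2 + q\<^sup>2) * y" by (simp add: algebra_simps power2_eq_square)
    then show ?thesis using assms by simp
  qed
  have 3: "p * (p * a i + q * a j - 2 * m * (p * c i + q * c j)) + q * (q * a i - p * a j - 2 * m * (q * c i - p * c j)) = a i - 2 * m * c i"
  proof -
    have "p * (p * a i + q * a j - 2 * m * (p * c i + q * c j)) + q * (q * a i - p * a j - 2 * m * (q * c i - p * c j))
      = (p * (p * a i + q * a j) + q * (q * a i - p * a j)) - 2 * m * (p * (p * c i + q * c j) + q * (q * c i - p * c j))"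
      by (simp add: algebra_simps)
    then show ?thesis unfolding 1 .
  qed
  have 4: "q * (p * a i + q * a j - 2 * m * (p * c i + q * c j)) - p * (q * a i - p * a j - 2 * m * (q * c i - p * c j)) = a j - 2 * m * c j"
  proof -
    have "q * (p * a i + q * a j - 2 * m * (p * c i + q * c j)) - p * (q * a i - p * a j - 2 * m * (q * c i - p * c j))
      = (q * (p * a i + q * a j) - p * (q * a i - p * a j)) - 2 * m * (q * (p * c i + q * c j) - p * (q * c i - p * c j))"
      by (simp add: algebra_simps)
    then show ?thesis unfolding 2 .
  qed
  have h: "householder I (planar I i j p q c) (planar I i j p q a)
      = (\<lambda>k\<in>I. planar I i j p q a k - 2 * m * planar I i j p q c k)"
    unfolding householder_def planar_inner[OF assms] m_def ..
  show "householder I c a k = planar I i j p q (householder I (planar I i j p q c) (planar I i j p q a)) k"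
    unfolding h using assms 3 4 by (auto simp: planar_def householder_def m_def[symmetric])
qed

text \<open>Induction on the support of \<open>c\<close>. If two coordinates are nonzero, a planar
  reflection annihilates one of them and conjugation reduces the support. If only one is left it
  equals 1 or -1, and the Householder reflection is the sign change of a single coordinate.\<close>

lemma nn_integral_householder:
  assumes \<sigma>: "0 < \<sigma>" and I: "finite I" and c: "(\<Sum>k\<in>I. (c k)\<^sup>2) = 1"
    and g: "g \<in> borel_measurable (PiM I (\<lambda>_. gauss \<sigma>))"
  shows "(\<integral>\<^sup>+a. g (householder I c a) \<partial>PiM I (\<lambda>_. gauss \<sigma>)) = (\<integral>\<^sup>+a. g a \<partial>PiM I (\<lambda>_. gauss \<sigma>))"
  using c g
proof (induction "card {k\<in>I. c k \<noteq> 0}" arbitrary: c g rule: less_induct)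
  case less
  have "\<exists>i\<in>I. c i \<noteq> 0"
  proof (rule ccontr)
    assume "\<not> ?thesis" then have "(\<Sum>k\<in>I. (c k)\<^sup>2) = 0" by simp
    with less.prems show False by simp
  qed
  then obtain i where i: "i \<in> I" "c i \<noteq> 0" by auto
  show ?case
  proof (cases "\<exists>j\<in>I. j \<noteq> i \<and> c j \<noteq> 0")
    case False
    have "(\<Sum>k\<in>I. (c k)\<^sup>2) = (\<Sum>k\<in>I. if k = i then (c i)\<^sup>2 else 0)" using False by (intro sum.cong) auto
    then have ci: "(c i)\<^sup>2 = 1" using less.prems i I by simp
    have s: "(\<Sum>k\<in>I. c k * a k) = c i * a i" for a
    proof -
      have "(\<Sum>k\<in>I. c k * a k) = (\<Sum>k\<in>I. if k = i then c i * a i else 0)" using False by (intro sum.cong) auto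
      then show ?thesis using i I by simp
    qed
    have "householder I c a = a(i := - a i)" if "a \<in> space (PiM I (\<lambda>_. gauss \<sigma>))" for a
    proof
      fix k
      have "c i * c i = 1" using ci by (simp add: power2_eq_square)
      then have "2 * (c i * a i) * c i = 2 * a i" by (metis mult.assoc mult.commute mult.right_neutral)
      then show "householder I c a k = (a(i := - a i)) k" using False i that
        by (auto simp: householder_def s space_PiM PiE_def extensional_def)
    qed
    then have "(\<integral>\<^sup>+a. g (householder I c a) \<partial>PiM I (\<lambda>_. gauss \<sigma>)) = (\<integral>\<^sup>+a. g (a(i := - a i)) \<partial>PiM I (\<lambda>_. gauss \<sigma>))"
      by (simp cong: nn_integral_cong)
    then show ?thesis using nn_integral_flip[OF \<sigma> I i(1) less.prems(2)] by simp
  next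
    case True
    then obtain j where j: "j \<in> I" "j \<noteq> i" "c j \<noteq> 0" by auto
    define \<rho> where "\<rho> = sqrt ((c i)\<^sup>2 + (c j)\<^sup>2)"
    have \<rho>: "0 < \<rho>" "\<rho>\<^sup>2 = (c i)\<^sup>2 + (c j)\<^sup>2" using i j by (auto simp: \<rho>_def sum_power2_gt_zero_iff)
    \<comment> \<open>With the normalised pair \<open>(c i, c j)\<close> the reflected vector has
      \<open>j\<close>-th coordinate \<open>q * c i - p * c j = 0\<close>.\<close>
    define p where "p = c i / \<rho>"
    define q where "q = c j / \<rho>"
    have pq: "p\<^sup>2 + q\<^sup>2 = 1" "q \<noteq> 0" using \<rho> j
      by (auto simp: p_def q_def power_divide add_divide_distrib[symmetric])
    let ?R = "planar I i j p q"
    have Rc: "?R c j = 0" "\<And>k. k \<in> I \<Longrightarrow> k \<noteq> i \<Longrightarrow> k \<noteq> j \<Longrightarrow> ?R c k = c k"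
      using j by (auto simp: planar_def p_def q_def)
    have "{k\<in>I. ?R c k \<noteq> 0} \<subset> {k\<in>I. c k \<noteq> 0}"
    proof
      show "{k\<in>I. ?R c k \<noteq> 0} \<subseteq> {k\<in>I. c k \<noteq> 0}"
      proof safe
        fix k assume "k \<in> I" "?R c k \<noteq> 0" "c k = 0" then show False using Rc i j by (cases "k = i"; cases "k = j") auto
      qed
      show "{k\<in>I. ?R c k \<noteq> 0} \<noteq> {k\<in>I. c k \<noteq> 0}" using Rc j by auto
    qed
    then have card: "card {k\<in>I. ?R c k \<noteq> 0} < card {k\<in>I. c k \<noteq> 0}" using I by (intro psubset_card_mono) auto
    have norm: "(\<Sum>k\<in>I. (?R c k)\<^sup>2) = 1"
      using planar_inner[OF I i(1) j(1) j(2)[symmetric] pq(1), of c c] less.prems(1) by (simp add: power2_eq_square)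
    have gR: "(\<lambda>a. g (?R a)) \<in> borel_measurable (PiM I (\<lambda>_. gauss \<sigma>))"
      by (rule measurable_compose[OF measurable_planar less.prems(2)]) (use i j in auto)
    have gH: "(\<lambda>a. g (?R (householder I (?R c) a))) \<in> borel_measurable (PiM I (\<lambda>_. gauss \<sigma>))"
      by (rule measurable_compose[OF measurable_householder gR])
    have "(\<integral>\<^sup>+a. g (householder I c a) \<partial>PiM I (\<lambda>_. gauss \<sigma>))
      = (\<integral>\<^sup>+a. g (?R (householder I (?R c) (?R a))) \<partial>PiM I (\<lambda>_. gauss \<sigma>))"
      by (subst householder_conj_planar[OF I i(1) j(1) j(2)[symmetric] pq(1)]) simp
    also have "\<dots> = (\<integral>\<^sup>+a. g (?R (householder I (?R c) a)) \<partial>PiM I (\<lambda>_. gauss \<sigma>))"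
      by (rule nn_integral_planar[OF \<sigma> I i(1) j(1) j(2)[symmetric] pq gH])
    also have "\<dots> = (\<integral>\<^sup>+a. g (?R a) \<partial>PiM I (\<lambda>_. gauss \<sigma>))"
      by (rule less.hyps[OF card norm gR])
    also have "\<dots> = (\<integral>\<^sup>+a. g a \<partial>PiM I (\<lambda>_. gauss \<sigma>))"
      by (rule nn_integral_planar[OF \<sigma> I i(1) j(1) j(2)[symmetric] pq less.prems(2)])
    finally show ?thesis .
  qed
qed

section \<open>Path space and the flow of the equation with additive noise\<close>

definition clip :: "real \<Rightarrow> real \<Rightarrow> real" where "clip h s = max 0 (min s h)"

lemma clip_mem: "0 \<le> h \<Longrightarrow> clip h s \<in> {0..h}" by (auto simp: clip_def)

lemma clip_id: "s \<in> {0..h} \<Longrightarrow> clip h s = s" by (auto simp: clip_def)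

text \<open>Paths on \<open>[0, h]\<close> are frozen outside the interval. They then live in the
  type of bounded continuous functions, a complete metric space that provides both the fixed-point
  theorem and uniform limits.\<close>

definition stop_path :: "real \<Rightarrow> (real \<Rightarrow> 'a::real_normed_vector) \<Rightarrow> real \<Rightarrow>\<^sub>C 'a" where
  "stop_path h k = Bcontfun (\<lambda>s. k (clip h s))"

lemma apply_stop_path:
  fixes k :: "real \<Rightarrow> 'a::real_normed_vector"
  assumes h: "0 \<le> h" and k: "continuous_on {0..h} k"
  shows "apply_bcontfun (stop_path h k) s = k (clip h s)"
proof -
  have "(\<lambda>s. k (clip h s)) \<in> bcontfun"
    unfolding bcontfun_def
  proof safe
    show "continuous_on UNIV (\<lambda>s. k (clip h s))"
      by (rule continuous_on_compose2[OF k]) (use clip_mem[OF h] in \<open>auto simp: clip_def[abs_def] intro!: continuous_intros\<close>)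
    have "bounded (k ` {0..h})" by (intro compact_imp_bounded compact_continuous_image k) auto
    then show "bounded (range (\<lambda>s. k (clip h s)))" by (rule bounded_subset) (use clip_mem[OF h] in auto)
  qed
  then show ?thesis by (simp add: stop_path_def Bcontfun_inverse)
qed

text \<open>The bound on \<open>(1 + L) * h\<close> makes the Picard map a contraction with factor
  \<open>1/2\<close> in the supremum distance, where \<open>1 + L\<close> is the Lipschitz constant
  of the full drift. Longer times are reached by composing short flows.\<close>

locale lipschitz_drift =
  fixes b :: "'a::banach \<Rightarrow> 'a" and L h :: real
  assumes L: "0 \<le> L" and b_lip: "\<And>x y. norm (b x - b y) \<le> L * norm (x - y)"
    and h: "0 < h" and Lh: "(1 + L) * h \<le> 1 / 2"
begin

definition D :: "'a \<Rightarrow> 'a" where "D x = - x + b x"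

lemma D_lip: "norm (D x - D y) \<le> (1 + L) * norm (x - y)"
proof -
  have "D x - D y = (y - x) + (b x - b y)" by (simp add: D_def)
  then have "norm (D x - D y) \<le> norm (y - x) + norm (b x - b y)" by (metis norm_triangle_ineq)
  then show ?thesis using b_lip[of x y] by (simp add: norm_minus_commute distrib_right)
qed

lemma b_cont: "continuous_on A b"
proof -
  have "L-lipschitz_on A b" using L b_lip by (intro lipschitz_onI) (auto simp: dist_norm)
  then show ?thesis by (rule lipschitz_on_continuous_on)
qed

lemma D_cont: "continuous_on A D"
  unfolding D_def[abs_def] by (intro continuous_intros b_cont)

lemma D_comp_integrable:
  fixes s :: real
  shows
  "continuous_on {0..s} u \<Longrightarrow> (\<lambda>r. D (u r)) integrable_on {0..s}"
  by (intro integrable_continuous_interval continuous_on_compose2[OF D_cont[of UNIV]]) auto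

definition picard :: "'a \<Rightarrow> (real \<Rightarrow>\<^sub>C 'a) \<Rightarrow> (real \<Rightarrow>\<^sub>C 'a) \<Rightarrow> real \<Rightarrow>\<^sub>C 'a" where
  "picard x w u = stop_path h (\<lambda>s. x + integral {0..s} (\<lambda>r. D (u r)) + sqrt 2 *\<^sub>R w s)"

lemma apply_picard:
  "apply_bcontfun (picard x w u) s =
     x + integral {0..clip h s} (\<lambda>r. D (u r)) + sqrt 2 *\<^sub>R w (clip h s)"
  unfolding picard_def using h
  by (intro apply_stop_path) (auto intro!: continuous_intros indefinite_integral_continuous_1 D_comp_integrable)

lemma integral_D_diff:
  fixes u v :: "real \<Rightarrow> 'a"
  assumes "0 \<le> s" "s \<le> h" "continuous_on {0..s} u" "continuous_on {0..s} v"
    "\<And>r. r \<in> {0..s} \<Longrightarrow> norm (u r - v r) \<le> B"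
  shows "norm (integral {0..s} (\<lambda>r. D (u r)) - integral {0..s} (\<lambda>r. D (v r))) \<le> 1/2 * B"
proof -
  have B: "0 \<le> B" using assms(1) assms(5)[of 0] by (smt (verit) atLeastAtMost_iff norm_ge_zero)
  have "integral {0..s} (\<lambda>r. D (u r)) - integral {0..s} (\<lambda>r. D (v r)) = integral {0..s} (\<lambda>r. D (u r) - D (v r))"
    using assms by (intro integral_diff[symmetric] D_comp_integrable)
  also have "norm \<dots> \<le> integral {0..s} (\<lambda>r. (1 + L) * B)"
  proof (rule integral_norm_bound_integral)
    show "(\<lambda>r. D (u r) - D (v r)) integrable_on {0..s}"
      using assms by (intro integrable_diff D_comp_integrable)
    show "norm (D (u r) - D (v r)) \<le> (1 + L) * B" if "r \<in> {0..s}" for r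
      using D_lip[of "u r" "v r"] assms(5)[OF that] L by (smt (verit) mult_left_mono)
  qed auto
  also have "\<dots> = (1 + L) * s * B" using assms by simp
  also have "\<dots> \<le> (1 + L) * h * B" using L B assms by (intro mult_right_mono mult_left_mono) auto
  also have "\<dots> \<le> 1/2 * B" using Lh B by (intro mult_right_mono) auto
  finally show ?thesis .
qed

text \<open>One estimate serves twice: for equal data it is the contraction property, and evaluated
  at fixed points, with the half absorbed on the left, it is Lipschitz dependence on the starting
  point and the driving path.\<close>

lemma picard_contraction:
  "dist (picard x w u) (picard y w' v) \<le> norm (x - y) + 1/2 * dist u v + sqrt 2 * dist w w'"
proof (rule dist_bound)
  fix s
  let ?c = "clip h s"
  have c: "0 \<le> ?c" "?c \<le> h" using clip_mem[of h s] h by auto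
  have uv: "norm (integral {0..?c} (\<lambda>r. D (u r)) - integral {0..?c} (\<lambda>r. D (v r))) \<le> 1/2 * dist u v"
    using c dist_bounded[of u _ v] by (intro integral_D_diff) (auto simp: dist_norm)
  have ww: "norm (sqrt 2 *\<^sub>R (w ?c - w' ?c)) \<le> sqrt 2 * dist w w'"
    using dist_bounded[of w ?c w'] by (auto simp: dist_norm)
  have eq: "picard x w u s - picard y w' v s = (x - y)
      + (integral {0..?c} (\<lambda>r. D (u r)) - integral {0..?c} (\<lambda>r. D (v r))) + sqrt 2 *\<^sub>R (w ?c - w' ?c)"
    by (simp add: apply_picard algebra_simps)
  show "dist (picard x w u s) (picard y w' v s) \<le> norm (x - y) + 1/2 * dist u v + sqrt 2 * dist w w'"
    unfolding dist_norm[of "picard x w u s"] eq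
    using uv ww norm_triangle_ineq[of "(x - y) + (integral {0..?c} (\<lambda>r. D (u r)) - integral {0..?c} (\<lambda>r. D (v r)))" "sqrt 2 *\<^sub>R (w ?c - w' ?c)"]
      norm_triangle_ineq[of "x - y" "integral {0..?c} (\<lambda>r. D (u r)) - integral {0..?c} (\<lambda>r. D (v r))"]
    by linarith
qed

lemma picard_fixpoint: "\<exists>!u. picard x w u = u"
proof (rule banach_fix_type[where c="1/2"])
  show "\<forall>u v. dist (picard x w u) (picard x w v) \<le> 1/2 * dist u v"
    using picard_contraction[of x w _ x w] by simp
qed auto

definition sol :: "'a \<Rightarrow> (real \<Rightarrow>\<^sub>C 'a) \<Rightarrow> real \<Rightarrow>\<^sub>C 'a" where
  "sol x w = (THE u. picard x w u = u)"

lemma picard_sol: "picard x w (sol x w) = sol x w"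
  unfolding sol_def by (rule theI'[OF picard_fixpoint])

lemma sol_eq:
  "s \<in> {0..h} \<Longrightarrow> sol x w s = x + integral {0..s} (\<lambda>r. D (sol x w r)) + sqrt 2 *\<^sub>R w s"
  using apply_picard[of x w "sol x w" s] by (simp add: picard_sol clip_id)

text \<open>Stopping \<open>v\<close> turns it into a fixed point of the Picard map. This is how
  trajectories of the given stochastic solution are identified with the deterministic flow along
  their noise.\<close>

lemma sol_unique:
  fixes w :: "real \<Rightarrow>\<^sub>C 'a" and v :: "real \<Rightarrow> 'a"
  assumes v: "continuous_on {0..h} v"
    and eq: "\<And>s. s \<in> {0..h} \<Longrightarrow> v s = x + integral {0..s} (\<lambda>r. D (v r)) + sqrt 2 *\<^sub>R w s"
    and s: "s \<in> {0..h}"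
  shows "v s = sol x w s"
proof -
  have app: "apply_bcontfun (stop_path h v) s = v (clip h s)" for s
    using apply_stop_path[OF _ v] h by simp
  have "picard x w (stop_path h v) = stop_path h v"
  proof (rule bcontfun_eqI)
    fix s
    have c: "clip h s \<in> {0..h}" using h by (intro clip_mem) simp
    have "integral {0..clip h s} (\<lambda>r. D (stop_path h v r)) = integral {0..clip h s} (\<lambda>r. D (v r))"
      using c by (intro Henstock_Kurzweil_Integration.integral_cong) (auto simp: app clip_id)
    then show "picard x w (stop_path h v) s = stop_path h v s"
      using eq[OF c] by (simp add: apply_picard app)
  qed
  then have "stop_path h v = sol x w" using picard_fixpoint[of x w] picard_sol[of x w] by metis
  then show ?thesis using app[of s] s by (simp add: clip_id)
qed

lemma sol_lipschitz: "dist (sol x w) (sol y w') \<le> 2 * (norm (x - y) + sqrt 2 * dist w w')"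
  using picard_contraction[of x w "sol x w" y w' "sol y w'"] by (simp add: picard_sol)

definition flow :: "'a \<Rightarrow> (real \<Rightarrow>\<^sub>C 'a) \<Rightarrow> 'a" where "flow x w = sol x w h"

lemma flow_lipschitz: "norm (flow x w - flow y w') \<le> 2 * (norm (x - y) + sqrt 2 * dist w w')"
  using sol_lipschitz[of x w y w'] dist_bounded[of "sol x w" h "sol y w'"]
  by (simp add: flow_def dist_norm)

lemma flow_tendsto:
  assumes "(x \<longlongrightarrow> x') F" "(w \<longlongrightarrow> w') F"
  shows "((\<lambda>i. flow (x i) (w i)) \<longlongrightarrow> flow x' w') F"
proof (rule metric_tendsto_imp_tendsto)
  show "((\<lambda>i. 2 * (norm (x i - x') + sqrt 2 * dist (w i) w')) \<longlongrightarrow> 0) F"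
  proof -
    have "((\<lambda>i. 2 * (norm (x i - x') + sqrt 2 * dist (w i) w')) \<longlongrightarrow> 2 * (norm (x' - x') + sqrt 2 * dist w' w')) F"
      by (intro tendsto_intros assms)
    then show ?thesis by simp
  qed
  show "\<forall>\<^sub>F i in F. dist (flow (x i) (w i)) (flow x' w') \<le> dist (2 * (norm (x i - x') + sqrt 2 * dist (w i) w')) 0"
    using flow_lipschitz by (intro always_eventually) (auto simp: dist_norm)
qed

lemma flow_continuous:
  assumes "continuous_on A x" "continuous_on A w"
  shows "continuous_on A (\<lambda>z. flow (x z) (w z))"
  using assms unfolding continuous_on_def by (auto intro: flow_tendsto)

end

section \<open>Polygonal paths and their uniform convergence\<close>

definition ramp :: "real \<Rightarrow> nat \<Rightarrow> nat \<Rightarrow> real \<Rightarrow> real" where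
  "ramp h m i s = max 0 (min 1 (real m * s / h - real i))"

text \<open>The polygonal path on \<open>[0, h]\<close> with \<open>m\<close> equal time steps and increments \<open>v 0, \<dots>, v (m - 1)\<close>.\<close>

definition polygon :: "real \<Rightarrow> nat \<Rightarrow> (nat \<Rightarrow> 'a::real_normed_vector) \<Rightarrow> real \<Rightarrow>\<^sub>C 'a" where
  "polygon h m v = Bcontfun (\<lambda>s. \<Sum>i<m. ramp h m i s *\<^sub>R v i)"

lemma ramp_bounds: "0 \<le> ramp h m i s" "ramp h m i s \<le> 1" by (auto simp: ramp_def)

lemma apply_polygon: "apply_bcontfun (polygon h m v) s = (\<Sum>i<m. ramp h m i s *\<^sub>R v i)"
proof -
  have "(\<lambda>s. \<Sum>i<m. ramp h m i s *\<^sub>R v i) \<in> bcontfun"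
  proof (rule bcontfun_normI[where b="\<Sum>i<m. norm (v i)"])
    show "continuous_on UNIV (\<lambda>s. \<Sum>i<m. ramp h m i s *\<^sub>R v i)"
      unfolding ramp_def divide_inverse by (intro continuous_intros)
    show "norm (\<Sum>i<m. ramp h m i s *\<^sub>R v i) \<le> (\<Sum>i<m. norm (v i))" for s
      using ramp_bounds by (intro sum_norm_le) (auto simp: mult_left_le_one_le)
  qed
  then show ?thesis by (simp add: polygon_def Bcontfun_inverse)
qed

lemma polygon_lipschitz: "dist (polygon h m v) (polygon h m v') \<le> (\<Sum>i<m. norm (v i - v' i))"
proof (rule dist_bound)
  fix s
  have "polygon h m v s - polygon h m v' s = (\<Sum>i<m. ramp h m i s *\<^sub>R (v i - v' i))"
    by (simp add: apply_polygon sum_subtractf scaleR_diff_right)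
  also have "norm \<dots> \<le> (\<Sum>i<m. norm (v i - v' i))"
    using ramp_bounds by (intro sum_norm_le) (auto simp: mult_left_le_one_le)
  finally show "dist (polygon h m v s) (polygon h m v' s) \<le> (\<Sum>i<m. norm (v i - v' i))" by (simp add: dist_norm)
qed

lemma polygon_tendsto:
  assumes "\<And>i. i < m \<Longrightarrow> ((\<lambda>z. v z i) \<longlongrightarrow> v' i) F"
  shows "((\<lambda>z. polygon h m (v z)) \<longlongrightarrow> polygon h m v') F"
proof (rule metric_tendsto_imp_tendsto)
  show "((\<lambda>z. \<Sum>i<m. norm (v z i - v' i)) \<longlongrightarrow> 0) F"
    using assms by (intro tendsto_null_sum) (auto intro!: tendsto_norm_zero simp: LIM_zero_iff)
  show "\<forall>\<^sub>F z in F. dist (polygon h m (v z)) (polygon h m v') \<le> dist (\<Sum>i<m. norm (v z i - v' i)) 0"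
    using polygon_lipschitz by (intro always_eventually) (auto simp: sum_nonneg)
qed

text \<open>Polygons are constant outside \<open>[0, h]\<close>, as stopped paths are, so uniform
  distances can be estimated inside the interval.\<close>

lemma ramp_clip:
  assumes "0 < h" "i < m" shows "ramp h m i (clip h s) = ramp h m i s"
proof -
  consider "s < 0" | "0 \<le> s" "s \<le> h" | "h < s" by linarith
  then show ?thesis
  proof cases
    case 1
    then have "real m * s / h \<le> 0" using assms by (simp add: divide_nonpos_pos mult_nonneg_nonpos)
    then show ?thesis using 1 assms by (simp add: ramp_def clip_def)
  next
    case 2 then show ?thesis by (simp add: clip_def)
  next
    case 3
    have "real m * h \<le> real m * s" using 3 by (intro mult_left_mono) auto
    then have "real m \<le> real m * s / h" using assms by (simp add: pos_le_divide_eq)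
    moreover have "real i + 1 \<le> real m" using assms by linarith
    ultimately show ?thesis using 3 assms by (simp add: ramp_def clip_def)
  qed
qed

text \<open>During time step \<open>j\<close> the earlier ramps have reached 1 and the later ones
  are still 0; \<theta> is the elapsed fraction of the step.\<close>

lemma polygon_eq:
  assumes h: "0 < h" and j: "j < m" and s: "real j * h / real m \<le> s" "s \<le> real (Suc j) * h / real m"
  shows "\<exists>\<theta>. 0 \<le> \<theta> \<and> \<theta> \<le> 1 \<and> polygon h m v s = (\<Sum>i<j. v i) + \<theta> *\<^sub>R v j"
proof (intro exI conjI)
  define \<theta> where "\<theta> = ramp h m j s"
  have m: "0 < real m" using j by simp
  have a: "real j \<le> real m * s / h" "real m * s / h \<le> real j + 1"
    using s h m by (auto simp: field_simps)
  have "polygon h m v s = (\<Sum>i<m. if i < Suc j then ramp h m i s *\<^sub>R v i else 0)"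
    unfolding apply_polygon
  proof (intro sum.cong refl)
    fix i
    show "ramp h m i s *\<^sub>R v i = (if i < Suc j then ramp h m i s *\<^sub>R v i else 0)"
    proof (cases "i < Suc j")
      case False
      then have "real j + 1 \<le> real i" by linarith
      then show ?thesis using a False by (simp add: ramp_def)
    qed simp
  qed
  also have "\<dots> = (\<Sum>i<Suc j. ramp h m i s *\<^sub>R v i)"
    using j by (intro sum.mono_neutral_cong_right) auto
  also have "\<dots> = (\<Sum>i<j. v i) + \<theta> *\<^sub>R v j"
  proof -
    have "ramp h m i s = 1" if "i < j" for i
    proof -
      have "real i + 1 \<le> real j" using that by linarith
      then show ?thesis using a by (simp add: ramp_def)
    qed
    then show ?thesis by (simp add: \<theta>_def)
  qed
  finally show "polygon h m v s = (\<Sum>i<j. v i) + \<theta> *\<^sub>R v j" .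
  show "0 \<le> \<theta>" "\<theta> \<le> 1" using ramp_bounds by (auto simp: \<theta>_def)
qed

lemma polygon_approx:
  fixes k :: "real \<Rightarrow> 'a::real_normed_vector"
  assumes h: "0 < h" and k: "continuous_on {0..h} k" "k 0 = 0"
  shows "(\<lambda>m. polygon h (Suc m) (\<lambda>i. k (real (Suc i) * h / real (Suc m)) - k (real i * h / real (Suc m))))
      \<longlonglongrightarrow> stop_path h k"
proof (rule metric_LIMSEQ_I)
  fix \<epsilon> :: real assume \<epsilon>: "0 < \<epsilon>"
  have "uniformly_continuous_on {0..h} k" by (intro compact_uniformly_continuous k) auto
  then obtain \<delta> where \<delta>: "0 < \<delta>" "\<And>s t. s \<in> {0..h} \<Longrightarrow> t \<in> {0..h} \<Longrightarrow> dist t s < \<delta> \<Longrightarrow> dist (k t) (k s) < \<epsilon>/4"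
    using \<epsilon> unfolding uniformly_continuous_on_def by (metis zero_less_divide_iff zero_less_numeral)
  obtain N :: nat where N: "h / \<delta> < real N" using reals_Archimedean2 by blast
  show "\<exists>no. \<forall>n\<ge>no. dist (polygon h (Suc n) (\<lambda>i. k (real (Suc i) * h / real (Suc n)) - k (real i * h / real (Suc n))))
      (stop_path h k) < \<epsilon>"
  proof (intro exI allI impI)
    fix n assume n: "N \<le> n"
    let ?v = "\<lambda>i. k (real (Suc i) * h / real (Suc n)) - k (real i * h / real (Suc n))"
    define m where "m = Suc n"
    have m0: "0 < real m" by (simp add: m_def)
    have step: "h / real m < \<delta>"
    proof -
      have "h / \<delta> < real m" using N n by (simp add: m_def)
      then show ?thesis using \<delta>(1) m0 by (simp add: field_simps)
    qed
    have "dist (polygon h m ?v) (stop_path h k) \<le> \<epsilon> / 2"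
    proof (rule dist_bound)
      fix s0
      define s where "s = clip h s0"
      have s: "0 \<le> s" "s \<le> h" using clip_mem[of h s0] h by (auto simp: s_def)
      have "polygon h m ?v s0 = polygon h m ?v s"
        unfolding apply_polygon s_def using h by (intro sum.cong) (auto simp: ramp_clip)
      \<comment> \<open>At the right end point the floor equals \<open>m\<close>, which is not a
        valid step; the minimum assigns that point to the last step.\<close>
      define j where "j = min (m - 1) (nat \<lfloor>real m * s / h\<rfloor>)"
      have j: "j < m" by (simp add: j_def m_def)
      have nn: "0 \<le> real m * s / h" using s h by simp
      have le: "real m * s / h \<le> real m" using s h m0 by (simp add: field_simps)
      have j1: "real j \<le> real m * s / h"
      proof -
        have "real j \<le> real (nat \<lfloor>real m * s / h\<rfloor>)" by (simp add: j_def)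
        also have "\<dots> \<le> real m * s / h" using nn by simp
        finally show ?thesis .
      qed
      have j2: "real m * s / h \<le> real (Suc j)"
      proof (cases "nat \<lfloor>real m * s / h\<rfloor> \<le> m - 1")
        case True
        then have "real (Suc j) = of_int \<lfloor>real m * s / h\<rfloor> + 1" using nn by (simp add: j_def)
        then show ?thesis using real_of_int_floor_add_one_ge[of "real m * s / h"] by linarith
      next
        case False
        then have "Suc j = m" by (simp add: j_def m_def)
        then show ?thesis using le by simp
      qed
      have jj: "real j * h / real m \<le> s" "s \<le> real (Suc j) * h / real m"
        using j1 j2 h m0 by (auto simp: field_simps)
      obtain \<theta> where \<theta>: "0 \<le> \<theta>" "\<theta> \<le> 1" "polygon h m ?v s = (\<Sum>i<j. ?v i) + \<theta> *\<^sub>R ?v j"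
        using polygon_eq[OF h j jj] by blast
      have tel: "(\<Sum>i<j. ?v i) = k (real j * h / real m)"
        using sum_lessThan_telescope[of "\<lambda>i. k (real i * h / real (Suc n))" j] k(2) by (simp add: m_def)
      have width: "real (Suc j) * h / real m - real j * h / real m = h / real m"
        by (simp add: distrib_right add_divide_distrib)
      have "real (Suc j) \<le> real m" using j by linarith
      then have "real (Suc j) * h \<le> real m * h" using h by (intro mult_right_mono) auto
      then have in2: "real (Suc j) * h / real m \<in> {0..h}"
        using h m0 by (auto simp: pos_divide_le_eq mult.commute)
      have in1: "real j * h / real m \<in> {0..h}" using h m0 jj s by auto
      have d1: "dist (k (real j * h / real m)) (k s) < \<epsilon>/4"
        using s in1 jj width step by (intro \<delta>) (auto simp: dist_real_def)
      have d2: "dist (k (real (Suc j) * h / real m)) (k (real j * h / real m)) < \<epsilon>/4"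
        using in1 in2 jj width step s by (intro \<delta>) (auto simp: dist_real_def)
      have "norm (\<theta> *\<^sub>R ?v j) \<le> norm (?v j)" using \<theta> by (simp add: mult_left_le_one_le)
      then have "norm (\<theta> *\<^sub>R ?v j) < \<epsilon>/4" using d2 by (simp add: dist_norm m_def)
      then have "dist (polygon h m ?v s) (k s) \<le> \<epsilon>/2"
        unfolding \<theta>(3) tel using d1 norm_triangle_ineq[of "k (real j * h / real m) - k s" "\<theta> *\<^sub>R ?v j"]
        by (simp add: dist_norm algebra_simps)
      then show "dist (polygon h m ?v s0) (stop_path h k s0) \<le> \<epsilon>/2"
        using \<open>polygon h m ?v s0 = polygon h m ?v s\<close> apply_stop_path[OF _ k(1), of s0] h by (simp add: s_def)
    qed
    then show "dist (polygon h (Suc n) ?v) (stop_path h k) < \<epsilon>" using \<epsilon> by (simp add: m_def)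
  qed
qed

text \<open>A rank-one perturbation of the identity. Two separate vectors are needed because a
  reflection in the inner product of the inverse covariance is in general oblique for the inner
  product of the space.\<close>

definition skew :: "'a::real_inner \<Rightarrow> 'a \<Rightarrow> 'a \<Rightarrow> 'a" where
  "skew a c v = v - (v \<bullet> a) *\<^sub>R c"

definition skew_path :: "'a::real_inner \<Rightarrow> 'a \<Rightarrow> (real \<Rightarrow>\<^sub>C 'a) \<Rightarrow> real \<Rightarrow>\<^sub>C 'a" where
  "skew_path a c w = Bcontfun (\<lambda>s. skew a c (w s))"

lemma apply_skew_path: "apply_bcontfun (skew_path a c w) s = skew a c (w s)"
proof -
  have "(\<lambda>s. skew a c (w s)) \<in> bcontfun"
  proof (rule bcontfun_normI[where b="norm w + norm w * norm a * norm c"])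
    show "continuous_on UNIV (\<lambda>s. skew a c (w s))" unfolding skew_def by (intro continuous_intros) auto
    fix s
    have "norm (w s) \<le> norm w" by (rule norm_bounded)
    moreover have "norm ((w s \<bullet> a) *\<^sub>R c) \<le> norm w * norm a * norm c"
      using Cauchy_Schwarz_ineq2[of "w s" a] norm_bounded[of w s]
      by (auto intro!: mult_right_mono order_trans[OF Cauchy_Schwarz_ineq2])
    ultimately show "norm (skew a c (w s)) \<le> norm w + norm w * norm a * norm c"
      unfolding skew_def by (intro order_trans[OF norm_triangle_ineq4] add_mono)
  qed
  then show ?thesis by (simp add: skew_path_def Bcontfun_inverse)
qed

text \<open>Continuity in \<open>a\<close> and \<open>c\<close>, not only in the path: the
  reflecting hyperplane depends on the pair of starting points, and the coupling kernel has to be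
  measurable in that pair.\<close>

lemma skew_path_tendsto:
  assumes a: "(a \<longlongrightarrow> a') F" and c: "(c \<longlongrightarrow> c') F" and w: "(w \<longlongrightarrow> w') F"
  shows "((\<lambda>i. skew_path (a i) (c i) (w i)) \<longlongrightarrow> skew_path a' c' w') F"
proof (rule metric_tendsto_imp_tendsto)
  let ?B = "\<lambda>i. dist (w i) w' + dist (w i) w' * norm (a i) * norm (c i)
     + norm w' * (norm (a i - a') * norm (c i) + norm a' * norm (c i - c'))"
  show "(?B \<longlongrightarrow> 0) F"
  proof -
    have "(?B \<longlongrightarrow> dist w' w' + dist w' w' * norm a' * norm c'
       + norm w' * (norm (a' - a') * norm c' + norm a' * norm (c' - c'))) F"
      by (intro tendsto_intros assms)
    then show ?thesis by simp
  qed
  have "dist (skew_path (a i) (c i) (w i)) (skew_path a' c' w') \<le> ?B i" for i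
  proof (rule dist_bound)
    fix s
    let ?v = "w i s" and ?v' = "w' s"
    have d: "norm (?v - ?v') \<le> dist (w i) w'" using dist_bounded[of "w i" s w'] by (simp add: dist_norm)
    have n: "norm ?v' \<le> norm w'" by (rule norm_bounded)
    \<comment> \<open>The path, \<open>a\<close> and \<open>c\<close> are exchanged one at a
      time.\<close>
    have "skew (a i) (c i) ?v - skew a' c' ?v'
        = (?v - ?v') - ((?v - ?v') \<bullet> a i) *\<^sub>R c i - (?v' \<bullet> (a i - a')) *\<^sub>R c i - (?v' \<bullet> a') *\<^sub>R (c i - c')"
      by (simp add: skew_def inner_diff_left inner_diff_right algebra_simps)
    also have "norm \<dots> \<le> norm (?v - ?v') + norm (((?v - ?v') \<bullet> a i) *\<^sub>R c i)
        + norm ((?v' \<bullet> (a i - a')) *\<^sub>R c i) + norm ((?v' \<bullet> a') *\<^sub>R (c i - c'))"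
      by (intro order_trans[OF norm_triangle_ineq4] add_mono order_refl)
    also have "\<dots> \<le> dist (w i) w' + dist (w i) w' * norm (a i) * norm (c i)
        + norm w' * norm (a i - a') * norm (c i) + norm w' * norm a' * norm (c i - c')"
      using d n
      by (auto intro!: add_mono mult_right_mono order_trans[OF Cauchy_Schwarz_ineq2])
    finally show "dist (skew_path (a i) (c i) (w i) s) (skew_path a' c' w' s) \<le> ?B i"
      by (simp add: dist_norm apply_skew_path algebra_simps)
  qed
  then show "\<forall>\<^sub>F i in F. dist (skew_path (a i) (c i) (w i)) (skew_path a' c' w') \<le> dist (?B i) 0"
    by (intro always_eventually) (smt (verit, best) dist_commute dist_real_def)
qed

text \<open>A linear map acts on a polygon by acting on its increments, so reflecting a path becomes
  reflecting each row of Gaussian increments.\<close>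

lemma skew_path_polygon: "skew_path a c (polygon h m v) = polygon h m (\<lambda>i. skew a c (v i))"
proof (rule bcontfun_eqI)
  fix s
  have "skew a c (\<Sum>i<m. ramp h m i s *\<^sub>R v i) = (\<Sum>i<m. ramp h m i s *\<^sub>R skew a c (v i))"
    by (simp add: skew_def inner_sum_left scaleR_diff_right sum_subtractf scaleR_sum_left)
  then show "skew_path a c (polygon h m v) s = polygon h m (\<lambda>i. skew a c (v i)) s"
    by (simp add: apply_skew_path apply_polygon)
qed

section \<open>Arrays of Brownian increments\<close>

abbreviation rows :: "(nat \<Rightarrow> real) measure" where "rows \<equiv> PiM UNIV (\<lambda>_. borel)"
abbreviation arrays :: "(nat \<Rightarrow> nat \<Rightarrow> real) measure" where "arrays \<equiv> PiM UNIV (\<lambda>_. rows)"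

text \<open>In an array the first index is time and the second is the mode. For countable products
  the product and the Borel sigma-algebra agree, so continuous functionals of the increments are
  measurable.\<close>

lemma sets_arrays: "sets arrays = sets borel"
proof -
  have "sets arrays = sets (PiM (UNIV :: nat set) (\<lambda>_. borel :: (nat \<Rightarrow> real) measure))"
    by (intro sets_PiM_cong refl) (simp add: sets_PiM_equal_borel)
  also have "\<dots> = sets borel" by (rule sets_PiM_equal_borel)
  finally show ?thesis .
qed

lemma continuous_measurable_arrays:
  "continuous_on UNIV F \<Longrightarrow> F \<in> arrays \<rightarrow>\<^sub>M borel"
  using borel_measurable_continuous_onI[of F] by (simp add: measurable_cong_sets[OF sets_arrays refl])

text \<open>The Householder reflection of the first \<open>n\<close> coordinates of an infinite
  row.\<close>

definition reflect_row :: "nat \<Rightarrow> (nat \<Rightarrow> real) \<Rightarrow> (nat \<Rightarrow> real) \<Rightarrow> nat \<Rightarrow> real" where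
  "reflect_row n c r k = (if k < n then r k - 2 * (\<Sum>j<n. c j * r j) * c k else r k)"

lemma reflect_row_measurable: "reflect_row n c \<in> rows \<rightarrow>\<^sub>M rows"
  unfolding reflect_row_def[abs_def]
  by (intro measurable_PiM_single') auto

lemma restrict_UNIV_eq: "restrict f UNIV = f" by (auto simp: restrict_def)

locale brownian_family = prob_space P for P :: "'w measure" +
  fixes B :: "nat \<Rightarrow> real \<Rightarrow> 'w \<Rightarrow> real"
  assumes BM: "indep_brownians P B"
begin

definition inc :: "real \<Rightarrow> 'w \<Rightarrow> nat \<Rightarrow> nat \<Rightarrow> real" where
  "inc \<delta> \<omega> i k = B k (real (Suc i) * \<delta>) \<omega> - B k (real i * \<delta>) \<omega>"

lemma std_bm: "std_brownian P (B k)" using BM by (simp add: indep_brownians_def)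

lemma B_measurable: "0 \<le> t \<Longrightarrow> B k t \<in> borel_measurable P"
  using std_bm by (simp add: std_brownian_def)

lemma paths_indep:
  "indep_vars (\<lambda>_. \<Pi>\<^sub>M t\<in>{0::real..}. (borel :: real measure)) (\<lambda>k \<omega>. restrict (\<lambda>t. B k t \<omega>) {0..}) UNIV"
  using BM by (simp add: indep_brownians_def)

lemma B_distributed:
  assumes "0 \<le> s" "s < t"
  shows "distributed P lborel (\<lambda>\<omega>. B k t \<omega> - B k s \<omega>) (\<lambda>x. ennreal (normal_density 0 (sqrt (t - s)) x))"
  using std_bm[of k] assms by (simp add: std_brownian_def)

section \<open>Brownian increments over a time grid of mesh \<delta>\<close>

context
  fixes \<delta> :: real
  assumes \<delta>: "0 < \<delta>"
begin

lemma inc_entry_measurable [measurable]: "(\<lambda>\<omega>. inc \<delta> \<omega> i k) \<in> borel_measurable P"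
  unfolding inc_def using \<delta> by (intro borel_measurable_diff B_measurable) auto

lemma inc_row_measurable: "(\<lambda>\<omega>. inc \<delta> \<omega> i) \<in> P \<rightarrow>\<^sub>M rows"
  by (rule measurable_PiM_single') auto

lemma inc_measurable: "inc \<delta> \<in> P \<rightarrow>\<^sub>M arrays"
  by (rule measurable_PiM_single') (use inc_row_measurable in \<open>auto simp: space_PiM\<close>)

lemma inc_column_indep: "indep_vars (\<lambda>_. rows) (\<lambda>k \<omega> i. inc \<delta> \<omega> i k) UNIV"
proof -
  let ?Y = "\<lambda>k (f :: real \<Rightarrow> real) (i :: nat). f (real (Suc i) * \<delta>) - f (real i * \<delta>)"
  have "indep_vars (\<lambda>_. rows) (\<lambda>k \<omega>. ?Y k (restrict (\<lambda>t. B k t \<omega>) {0..})) UNIV"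
  proof (rule indep_vars_compose2[OF paths_indep])
    fix k :: nat
    show "?Y k \<in> (\<Pi>\<^sub>M t\<in>{0::real..}. (borel :: real measure)) \<rightarrow>\<^sub>M rows"
      using \<delta> by (intro measurable_PiM_single' borel_measurable_diff measurable_component_singleton) auto
  qed
  moreover have "(\<lambda>k \<omega>. ?Y k (restrict (\<lambda>t. B k t \<omega>) {0..})) = (\<lambda>k \<omega> i. inc \<delta> \<omega> i k)"
    using \<delta> by (intro ext) (simp add: inc_def)
  ultimately show ?thesis by simp
qed

lemma inc_row_entries_indep: "indep_vars (\<lambda>_. borel) (\<lambda>k \<omega>. inc \<delta> \<omega> i k) UNIV"
  using indep_vars_compose2[OF inc_column_indep, of "\<lambda>k f. f i" "\<lambda>_. borel"] by simp

lemma inc_column_entries_indep: "indep_vars (\<lambda>_. borel) (\<lambda>i \<omega>. inc \<delta> \<omega> i k) {..<m}"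
proof -
  have "\<forall>(m::nat) (ts::nat \<Rightarrow> real). 0 \<le> ts 0 \<longrightarrow> mono ts \<longrightarrow>
        indep_vars (\<lambda>_. borel) (\<lambda>i \<omega>. B k (ts (Suc i)) \<omega> - B k (ts i) \<omega>) {..<m}"
    using std_bm[of k] by (simp add: std_brownian_def)
  moreover have "mono (\<lambda>i. real i * \<delta>)" using \<delta> by (auto intro!: monoI mult_right_mono)
  ultimately show ?thesis unfolding inc_def by (auto dest!: spec[of _ m] spec[of _ "\<lambda>i. real i * \<delta>"])
qed

text \<open>Two kinds of independence are combined: between modes, from the joint law of the
  Brownian paths, and between time steps of one mode, from independence of its increments. The
  probability factorises first over columns and then inside each column.\<close>

lemma inc_indep: "indep_vars (\<lambda>_. borel) (\<lambda>j \<omega>. inc \<delta> \<omega> (snd j) (fst j)) UNIV"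
  unfolding indep_vars_def2
proof (intro conjI ballI indep_setsI)
  show "random_variable borel (\<lambda>\<omega>. inc \<delta> \<omega> (snd j) (fst j))" for j by simp
  then show "{(\<lambda>\<omega>. inc \<delta> \<omega> (snd j) (fst j)) -` A \<inter> space P |A. A \<in> sets borel} \<subseteq> events" for j
    by (auto intro: measurable_sets)
  fix A J assume J: "J \<noteq> {}" "finite J"
    and A: "\<forall>j\<in>J. A j \<in> {(\<lambda>\<omega>. inc \<delta> \<omega> (snd j) (fst j)) -` A \<inter> space P |A. A \<in> sets borel}"
  from A have "\<forall>j\<in>J. \<exists>E. E \<in> sets borel \<and> A j = (\<lambda>\<omega>. inc \<delta> \<omega> (snd j) (fst j)) -` E \<inter> space P" by blast
  then obtain E where E: "\<And>j. j \<in> J \<Longrightarrow> E j \<in> sets borel \<and> A j = (\<lambda>\<omega>. inc \<delta> \<omega> (snd j) (fst j)) -` E j \<inter> space P"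
    by metis
  \<comment> \<open>Filling up with the whole line extends the finite index set to a
    rectangle.\<close>
  define E' where "E' k i = (if (k, i) \<in> J then E (k, i) else UNIV)" for k i
  have E': "E' k i \<in> sets borel" for k i using E by (auto simp: E'_def)
  \<comment> \<open>The successor puts all time indices of \<open>J\<close> below \<open>m\<close>
    and makes \<open>{..<m}\<close> nonempty.\<close>
  define m where "m = Suc (Max (snd ` J))"
  define Ks where "Ks = fst ` J"
  have JK: "J \<subseteq> Ks \<times> {..<m}"
  proof
    fix j assume j: "j \<in> J"
    then have "snd j \<le> Max (snd ` J)" using J by simp
    then have "snd j < m" by (simp add: m_def)
    moreover have "fst j \<in> Ks" using j by (simp add: Ks_def)
    ultimately show "j \<in> Ks \<times> {..<m}" by (metis SigmaI lessThan_iff prod.collapse)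
  qed
  have K: "finite Ks" "Ks \<noteq> {}" using J by (auto simp: Ks_def)
  define F where "F k = {f \<in> space rows. \<forall>i\<in>{..<m}. f i \<in> E' k i}" for k
  have F: "F k \<in> sets rows" for k
    unfolding F_def using E' by measurable
  have "(\<Inter>j\<in>J. A j) = (\<Inter>k\<in>Ks. (\<lambda>\<omega> i. inc \<delta> \<omega> i k) -` F k \<inter> space P)"
  proof (intro set_eqI iffI)
    fix \<omega> assume \<omega>: "\<omega> \<in> (\<Inter>j\<in>J. A j)"
    then have 1: "\<omega> \<in> space P" using J E by blast
    have "inc \<delta> \<omega> i k \<in> E' k i" for k i
    proof (cases "(k, i) \<in> J")
      case True
      then have "\<omega> \<in> A (k, i)" using \<omega> by blast
      then show ?thesis using True E[OF True] by (simp add: E'_def)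
    qed (simp add: E'_def)
    then show "\<omega> \<in> (\<Inter>k\<in>Ks. (\<lambda>\<omega> i. inc \<delta> \<omega> i k) -` F k \<inter> space P)" using 1 by (auto simp: F_def space_PiM)
  next
    fix \<omega> assume \<omega>: "\<omega> \<in> (\<Inter>k\<in>Ks. (\<lambda>\<omega> i. inc \<delta> \<omega> i k) -` F k \<inter> space P)"
    show "\<omega> \<in> (\<Inter>j\<in>J. A j)"
    proof
      fix j assume j: "j \<in> J"
      then have "fst j \<in> Ks" "snd j < m" using JK by auto
      then have "\<omega> \<in> (\<lambda>\<omega> i. inc \<delta> \<omega> i (fst j)) -` F (fst j) \<inter> space P" using \<omega> by blast
      then have "inc \<delta> \<omega> (snd j) (fst j) \<in> E' (fst j) (snd j)" "\<omega> \<in> space P"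
        using \<open>snd j < m\<close> by (auto simp: F_def)
      then show "\<omega> \<in> A j" using E[OF j] j by (simp add: E'_def)
    qed
  qed
  then have "prob (\<Inter>j\<in>J. A j) = (\<Prod>k\<in>Ks. prob ((\<lambda>\<omega> i. inc \<delta> \<omega> i k) -` F k \<inter> space P))"
    using indep_varsD[OF inc_column_indep K(2,1), of F] F by simp
  also have "\<dots> = (\<Prod>k\<in>Ks. \<Prod>i<m. prob ((\<lambda>\<omega>. inc \<delta> \<omega> i k) -` E' k i \<inter> space P))"
  proof (rule prod.cong[OF refl])
    fix k
    have "(\<lambda>\<omega> i. inc \<delta> \<omega> i k) -` F k \<inter> space P = (\<Inter>i\<in>{..<m}. (\<lambda>\<omega>. inc \<delta> \<omega> i k) -` E' k i \<inter> space P)"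
      by (auto simp: F_def space_PiM m_def)
    then show "prob ((\<lambda>\<omega> i. inc \<delta> \<omega> i k) -` F k \<inter> space P) = (\<Prod>i<m. prob ((\<lambda>\<omega>. inc \<delta> \<omega> i k) -` E' k i \<inter> space P))"
      using indep_varsD_finite[OF inc_column_entries_indep[of k m], of "E' k"] E' by (auto simp: m_def)
  qed
  also have "\<dots> = (\<Prod>j\<in>Ks \<times> {..<m}. prob ((\<lambda>\<omega>. inc \<delta> \<omega> (snd j) (fst j)) -` E' (fst j) (snd j) \<inter> space P))"
    by (simp add: prod.cartesian_product case_prod_beta')
  \<comment> \<open>Entries that were filled in contribute the factor 1.\<close>
  also have "\<dots> = (\<Prod>j\<in>J. prob ((\<lambda>\<omega>. inc \<delta> \<omega> (snd j) (fst j)) -` E' (fst j) (snd j) \<inter> space P))"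
    using JK K by (intro prod.mono_neutral_right) (auto simp: E'_def prob_space)
  also have "\<dots> = (\<Prod>j\<in>J. prob (A j))" using E by (intro prod.cong) (auto simp: E'_def)
  finally show "prob (\<Inter>j\<in>J. A j) = (\<Prod>j\<in>J. prob (A j))" .
qed

lemma inc_rows_indep: "indep_vars (\<lambda>_. rows) (\<lambda>i \<omega>. inc \<delta> \<omega> i) UNIV"
proof -
  have "indep_vars (\<lambda>i. PiM (UNIV \<times> {i}) (\<lambda>_. borel))
      (\<lambda>i \<omega>. restrict (\<lambda>j. inc \<delta> \<omega> (snd j) (fst j)) (UNIV \<times> {i})) UNIV"
    by (rule indep_vars_restrict[OF inc_indep]) (auto simp: disjoint_family_on_def)
  then have "indep_vars (\<lambda>_. rows) (\<lambda>i \<omega>. (\<lambda>f k. f (k, i)) (restrict (\<lambda>j. inc \<delta> \<omega> (snd j) (fst j)) (UNIV \<times> {i}))) UNIV"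
    by (rule indep_vars_compose2) (auto intro!: measurable_PiM_single' measurable_component_singleton)
  then show ?thesis by simp
qed

lemma inc_row_law: "distr P rows (\<lambda>\<omega>. inc \<delta> \<omega> i) = PiM UNIV (\<lambda>_. gauss (sqrt \<delta>))"
proof -
  have "distr P (PiM UNIV (\<lambda>_. borel)) (\<lambda>\<omega>. \<lambda>k\<in>UNIV. inc \<delta> \<omega> i k) = PiM UNIV (\<lambda>k. distr P borel (\<lambda>\<omega>. inc \<delta> \<omega> i k))"
    using indep_vars_iff_distr_eq_PiM[where I=UNIV and M'="\<lambda>_. borel" and X="\<lambda>k \<omega>. inc \<delta> \<omega> i k"] inc_row_entries_indep[of i] by simp
  moreover have "distr P borel (\<lambda>\<omega>. inc \<delta> \<omega> i k) = gauss (sqrt \<delta>)" for k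
  proof -
    have "real (Suc i) * \<delta> - real i * \<delta> = \<delta>" by (simp add: algebra_simps)
    then have "distributed P lborel (\<lambda>\<omega>. inc \<delta> \<omega> i k) (\<lambda>x. ennreal (normal_density 0 (sqrt \<delta>) x))"
      using B_distributed[of "real i * \<delta>" "real (Suc i) * \<delta>" k] \<delta> by (simp add: inc_def)
    then have "distr P lborel (\<lambda>\<omega>. inc \<delta> \<omega> i k) = gauss (sqrt \<delta>)" by (rule distributed_distr_eq_density)
    moreover have "distr P borel (\<lambda>\<omega>. inc \<delta> \<omega> i k) = distr P lborel (\<lambda>\<omega>. inc \<delta> \<omega> i k)"
      by (rule distr_cong) auto
    ultimately show ?thesis by simp
  qed
  ultimately show ?thesis by (simp add: restrict_UNIV_eq)
qed

lemma inc_law: "distr P arrays (inc \<delta>) = PiM UNIV (\<lambda>_. distr P rows (\<lambda>\<omega>. inc \<delta> \<omega> 0))"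
proof -
  have "distr P arrays (\<lambda>\<omega>. \<lambda>i\<in>UNIV. inc \<delta> \<omega> i) = PiM UNIV (\<lambda>i. distr P rows (\<lambda>\<omega>. inc \<delta> \<omega> i))"
    using indep_vars_iff_distr_eq_PiM[where I=UNIV and M'="\<lambda>_. rows" and X="\<lambda>i \<omega>. inc \<delta> \<omega> i"] inc_rows_indep inc_row_measurable by simp
  moreover have "(\<lambda>\<omega>. \<lambda>i\<in>UNIV. inc \<delta> \<omega> i) = inc \<delta>" by (simp add: restrict_UNIV_eq)
  ultimately show ?thesis by (simp add: inc_row_law)
qed

text \<open>Stationarity and independence: the array may be cut at time index \<open>i\<close> and continued by an independent copy.\<close>

lemma nn_integral_inc_cut:
  assumes F: "F \<in> borel_measurable arrays"
  shows "(\<integral>\<^sup>+\<omega>. F (inc \<delta> \<omega>) \<partial>P) = (\<integral>\<^sup>+\<omega>. \<integral>\<^sup>+\<omega>'. F (comb_seq i (inc \<delta> \<omega>) (inc \<delta> \<omega>')) \<partial>P \<partial>P)"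
proof -
  let ?\<rho> = "distr P rows (\<lambda>\<omega>. inc \<delta> \<omega> 0)"
  interpret \<rho>: prob_space ?\<rho> by (rule prob_space_distr[OF inc_row_measurable])
  interpret sequence_space ?\<rho> ..
  have setsS: "sets S = sets arrays" by (intro sets_PiM_cong) auto
  have FS: "F \<in> borel_measurable S" using F by (simp add: measurable_cong_sets[OF setsS refl])
  have S: "S = distr P S (inc \<delta>)"
    using inc_law distr_cong[OF refl setsS refl, of P "inc \<delta>"] by simp
  have mS: "inc \<delta> \<in> P \<rightarrow>\<^sub>M S" using inc_measurable by (simp add: measurable_cong_sets[OF refl setsS])
  have transfer: "(\<integral>\<^sup>+a. G a \<partial>S) = (\<integral>\<^sup>+\<omega>. G (inc \<delta> \<omega>) \<partial>P)" if "G \<in> borel_measurable S" for G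
    using nn_integral_distr[OF mS, of G] that S by simp
  have Fc: "(\<lambda>(a, a'). F (comb_seq i a a')) \<in> borel_measurable (S \<Otimes>\<^sub>M S)"
    using measurable_compose[OF measurable_comb_seq FS] by (simp add: case_prod_beta')
  have "(\<integral>\<^sup>+\<omega>. F (inc \<delta> \<omega>) \<partial>P) = (\<integral>\<^sup>+a. F a \<partial>S)" by (rule transfer[OF FS, symmetric])
  also have "\<dots> = (\<integral>\<^sup>+a. F a \<partial>distr (S \<Otimes>\<^sub>M S) S (\<lambda>(\<omega>, \<omega>'). comb_seq i \<omega> \<omega>'))" by (simp only: PiM_comb_seq)
  also have "\<dots> = (\<integral>\<^sup>+z. F (case z of (a, a') \<Rightarrow> comb_seq i a a') \<partial>(S \<Otimes>\<^sub>M S))"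
    by (rule nn_integral_distr[OF measurable_comb_seq]) (use FS in simp)
  also have "\<dots> = (\<integral>\<^sup>+a. \<integral>\<^sup>+a'. F (comb_seq i a a') \<partial>S \<partial>S)"
    using P.nn_integral_fst[OF Fc] by (simp add: case_prod_beta')
  also have "\<dots> = (\<integral>\<^sup>+\<omega>. \<integral>\<^sup>+a'. F (comb_seq i (inc \<delta> \<omega>) a') \<partial>S \<partial>P)"
    by (rule transfer) (rule P.borel_measurable_nn_integral[OF Fc])
  also have "\<dots> = (\<integral>\<^sup>+\<omega>. \<integral>\<^sup>+\<omega>'. F (comb_seq i (inc \<delta> \<omega>) (inc \<delta> \<omega>')) \<partial>P \<partial>P)"
  proof (intro nn_integral_cong transfer)
    fix \<omega> assume "\<omega> \<in> space P"
    then have "inc \<delta> \<omega> \<in> space S" by (rule measurable_space[OF mS])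
    from measurable_compose[OF measurable_Pair1'[OF this] Fc]
    show "(\<lambda>a'. F (comb_seq i (inc \<delta> \<omega>) a')) \<in> borel_measurable S" by simp
  qed
  finally show ?thesis .
qed

text \<open>The sequence is split at index \<open>n\<close>. Only the finite initial block moves,
  and it moves by a Householder reflection.\<close>

lemma reflect_row_law:
  assumes c: "(\<Sum>k<n. (c k)\<^sup>2) = 1"
  shows "distr (PiM UNIV (\<lambda>_. gauss (sqrt \<delta>))) rows (reflect_row n c) = PiM UNIV (\<lambda>_. gauss (sqrt \<delta>))"
proof -
  interpret g: prob_space "gauss (sqrt \<delta>)" using \<delta> by (intro prob_space_gauss) simp
  interpret sequence_space "gauss (sqrt \<delta>)" ..
  let ?N = "PiM {..<n} (\<lambda>_. gauss (sqrt \<delta>))"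
  have setsS: "sets S = sets rows" by (intro sets_PiM_cong) auto
  have rm: "reflect_row n c \<in> S \<rightarrow>\<^sub>M S"
    using reflect_row_measurable[of n c] by (simp add: measurable_cong_sets[OF setsS setsS])
  have key: "(\<integral>\<^sup>+r. F (reflect_row n c r) \<partial>S) = (\<integral>\<^sup>+r. F r \<partial>S)" if F: "F \<in> borel_measurable S" for F
  proof -
    \<comment> \<open>The tail \<open>r'\<close> becomes the outer variable, so the initial block
      can be reflected while the tail is held fixed.\<close>
    have cut: "(\<integral>\<^sup>+r. H r \<partial>S) = (\<integral>\<^sup>+r'. \<integral>\<^sup>+r. H (comb_seq n r r') \<partial>S \<partial>S)" if H: "H \<in> borel_measurable S" for H
    proof -
      have Hc: "(\<lambda>(a, a'). H (comb_seq n a a')) \<in> borel_measurable (S \<Otimes>\<^sub>M S)"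
        using measurable_compose[OF measurable_comb_seq H] by (simp add: case_prod_beta')
      interpret SS: pair_sigma_finite S S by unfold_locales
      have "(\<integral>\<^sup>+r. H r \<partial>S) = (\<integral>\<^sup>+r. H r \<partial>distr (S \<Otimes>\<^sub>M S) S (\<lambda>(\<omega>, \<omega>'). comb_seq n \<omega> \<omega>'))" by (simp only: PiM_comb_seq)
      also have "\<dots> = (\<integral>\<^sup>+z. H (case z of (a, a') \<Rightarrow> comb_seq n a a') \<partial>(S \<Otimes>\<^sub>M S))"
        by (rule nn_integral_distr[OF measurable_comb_seq]) (use H in simp)
      also have "\<dots> = (\<integral>\<^sup>+r. \<integral>\<^sup>+r'. H (comb_seq n r r') \<partial>S \<partial>S)"
        using P.nn_integral_fst[OF Hc] by (simp add: case_prod_beta')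
      also have "\<dots> = (\<integral>\<^sup>+r'. \<integral>\<^sup>+r. H (comb_seq n r r') \<partial>S \<partial>S)"
        by (rule SS.Fubini'[symmetric]) (use Hc in simp)
      finally show ?thesis .
    qed
    have "(\<integral>\<^sup>+r. F (reflect_row n c (comb_seq n r r')) \<partial>S) = (\<integral>\<^sup>+r. F (comb_seq n r r') \<partial>S)"
      if r': "r' \<in> space S" for r'
    proof -
      define G where "G a = F (comb_seq n a r')" for a
      have G: "G \<in> borel_measurable ?N"
      proof -
        have "(\<lambda>a. comb_seq n a r') \<in> ?N \<rightarrow>\<^sub>M S"
        proof (rule measurable_PiM_single')
          fix k :: nat
          show "(\<lambda>a. comb_seq n a r' k) \<in> ?N \<rightarrow>\<^sub>M gauss (sqrt \<delta>)"
            by (cases "k < n") (auto simp: comb_seq_def intro: measurable_component_singleton)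
        qed (auto simp: space_PiM)
        from measurable_compose[OF this F] show ?thesis by (simp add: G_def[abs_def])
      qed
      have N: "?N = distr S ?N (\<lambda>r. restrict r {..<n})"
        by (rule distr_PiM_restrict_finite[symmetric]) auto
      have rs: "(\<lambda>r. restrict r {..<n}) \<in> S \<rightarrow>\<^sub>M ?N" by (rule measurable_restrict_subset) auto
      have tr: "(\<integral>\<^sup>+r. H (restrict r {..<n}) \<partial>S) = (\<integral>\<^sup>+a. H a \<partial>?N)" if "H \<in> borel_measurable ?N" for H
        using nn_integral_distr[OF rs, of H] that N by simp
      have "F (comb_seq n r r') = G (restrict r {..<n})" for r
        unfolding G_def by (rule arg_cong[of _ _ F]) (auto simp: comb_seq_def)
      moreover have "F (reflect_row n c (comb_seq n r r')) = G (householder {..<n} c (restrict r {..<n}))" for r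
        unfolding G_def by (rule arg_cong[of _ _ F])
          (auto simp: comb_seq_def reflect_row_def householder_def fun_eq_iff intro!: sum.cong)
      moreover have "(\<integral>\<^sup>+r. G (householder {..<n} c (restrict r {..<n})) \<partial>S) = (\<integral>\<^sup>+a. G (householder {..<n} c a) \<partial>?N)"
        by (rule tr) (rule measurable_compose[OF measurable_householder G])
      moreover have "\<dots> = (\<integral>\<^sup>+a. G a \<partial>?N)" using \<delta> c G by (intro nn_integral_householder) auto
      ultimately show ?thesis using tr[OF G] by simp
    qed
    then show ?thesis
      unfolding cut[OF F] cut[OF measurable_compose[OF rm F]] by (rule nn_integral_cong)
  qed
  have "distr S S (reflect_row n c) = S"
  proof (rule measure_eqI)
    fix A assume "A \<in> sets (distr S S (reflect_row n c))"
    then have A: "A \<in> sets S" by simp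
    have "emeasure (distr S S (reflect_row n c)) A = (\<integral>\<^sup>+r. indicator A (reflect_row n c r) \<partial>S)"
      using nn_integral_distr[OF rm, of "indicator A"] A by simp
    also have "\<dots> = emeasure S A" using key[of "indicator A"] A by simp
    finally show "emeasure (distr S S (reflect_row n c)) A = emeasure S A" .
  qed simp
  moreover have "distr S rows (reflect_row n c) = distr S S (reflect_row n c)"
    by (rule distr_cong) (auto simp: setsS)
  ultimately show ?thesis by simp
qed

text \<open>One vector \<open>c\<close> serves all rows, because the hyperplane is frozen during the
  step. The rows stay independent and each keeps its law, hence so does the array.\<close>

lemma nn_integral_inc_reflect:
  assumes F: "F \<in> borel_measurable arrays" and c: "(\<Sum>k<n. (c k)\<^sup>2) = 1"
  shows "(\<integral>\<^sup>+\<omega>. F (\<lambda>i. reflect_row n c (inc \<delta> \<omega> i)) \<partial>P) = (\<integral>\<^sup>+\<omega>. F (inc \<delta> \<omega>) \<partial>P)"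
proof -
  let ?Y = "\<lambda>i \<omega>. reflect_row n c (inc \<delta> \<omega> i)"
  have ind: "indep_vars (\<lambda>_. rows) ?Y UNIV"
    by (rule indep_vars_compose2[OF inc_rows_indep reflect_row_measurable])
  have rm: "?Y i \<in> P \<rightarrow>\<^sub>M rows" for i by (rule measurable_compose[OF inc_row_measurable reflect_row_measurable])
  have am: "(\<lambda>\<omega> i. ?Y i \<omega>) \<in> P \<rightarrow>\<^sub>M arrays"
    by (rule measurable_PiM_single') (use rm in \<open>auto simp: space_PiM\<close>)
  have law: "distr P rows (?Y i) = PiM UNIV (\<lambda>_. gauss (sqrt \<delta>))" for i
    using distr_distr[OF reflect_row_measurable[of n c] inc_row_measurable[of i]] reflect_row_law[OF c] inc_row_law[of i]
    by (simp add: comp_def)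
  have "distr P arrays (\<lambda>\<omega>. \<lambda>i\<in>UNIV. ?Y i \<omega>) = PiM UNIV (\<lambda>i. distr P rows (?Y i))"
    using indep_vars_iff_distr_eq_PiM[where I=UNIV and M'="\<lambda>_. rows" and X="?Y"] ind rm by simp
  then have "distr P arrays (\<lambda>\<omega> i. ?Y i \<omega>) = distr P arrays (inc \<delta>)"
    by (simp add: law inc_law inc_row_law restrict_UNIV_eq)
  then have "(\<integral>\<^sup>+a. F a \<partial>distr P arrays (\<lambda>\<omega> i. ?Y i \<omega>)) = (\<integral>\<^sup>+a. F a \<partial>distr P arrays (inc \<delta>))" by simp
  then show ?thesis
    using nn_integral_distr[OF am, of F] nn_integral_distr[OF inc_measurable, of F] F by simp
qed

end

end

section \<open>The Markov property\<close>

locale sde_setting = lipschitz_drift b L h + brownian_family P B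
  for b :: "'a::{real_inner,banach} \<Rightarrow> 'a" and L h :: real and P :: "'w measure" and B +
  fixes e :: "nat \<Rightarrow> 'a" and lam :: "nat \<Rightarrow> real" and X :: "'a \<Rightarrow> real \<Rightarrow> 'w \<Rightarrow> 'a"
  assumes X_solution: "\<And>x. sde_solution P e lam B b x (X x)"
begin

definition noise :: "real \<Rightarrow> 'w \<Rightarrow> 'a" where
  "noise t \<omega> = suminf (\<lambda>k. (sqrt (lam k) * B k t \<omega>) *\<^sub>R e k)"

text \<open>The event on which the equation from \<open>x\<close> holds at all times. Its driving
  path is named \<open>noise\<close>, so that solutions from different starting points visibly share
  it.\<close>

definition solves :: "'a \<Rightarrow> 'w \<Rightarrow> bool" where
  "solves x \<omega> \<longleftrightarrow> (\<forall>k. B k 0 \<omega> = 0) \<and> continuous_on {0..} (\<lambda>t. X x t \<omega>) \<and>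
     (\<forall>t\<ge>0. (\<lambda>k. (sqrt (lam k) * B k t \<omega>) *\<^sub>R e k) sums noise t \<omega> \<and>
        X x t \<omega> = x + integral {0..t} (\<lambda>s. D (X x s \<omega>)) + sqrt 2 *\<^sub>R noise t \<omega>)"

lemma AE_solves: "AE \<omega> in P. solves x \<omega>"
proof -
  have "AE \<omega> in P. \<forall>k. B k 0 \<omega> = 0"
    using std_bm by (auto simp: AE_all_countable std_brownian_def)
  moreover have "AE \<omega> in P. continuous_on {0..} (\<lambda>t. X x t \<omega>) \<and>
        (\<forall>t\<ge>0. \<exists>w. (\<lambda>k. (sqrt (lam k) * B k t \<omega>) *\<^sub>R e k) sums w \<and>
            X x t \<omega> = x + integral {0..t} (\<lambda>s. - X x s \<omega> + b (X x s \<omega>)) + sqrt 2 *\<^sub>R w)"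
    using X_solution[of x] by (simp add: sde_solution_def)
  ultimately show ?thesis
  proof eventually_elim
    case (elim \<omega>)
    have "(\<lambda>k. (sqrt (lam k) * B k t \<omega>) *\<^sub>R e k) sums noise t \<omega> \<and>
        X x t \<omega> = x + integral {0..t} (\<lambda>s. D (X x s \<omega>)) + sqrt 2 *\<^sub>R noise t \<omega>" if "0 \<le> t" for t
    proof -
      obtain w where w: "(\<lambda>k. (sqrt (lam k) * B k t \<omega>) *\<^sub>R e k) sums w"
        "X x t \<omega> = x + integral {0..t} (\<lambda>s. D (X x s \<omega>)) + sqrt 2 *\<^sub>R w"
        using conjunct2[OF elim(2), rule_format, OF \<open>0 \<le> t\<close>] unfolding D_def by auto
      moreover have "noise t \<omega> = w" unfolding noise_def by (rule sums_unique[OF w(1), symmetric])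
      ultimately show ?thesis by simp
    qed
    with elim show ?case by (simp add: solves_def)
  qed
qed

lemma X_measurable: "0 \<le> t \<Longrightarrow> X x t \<in> borel_measurable P"
  using X_solution[of x] by (simp add: sde_solution_def)

text \<open>One measurable set of full measure, the same for all starting points, on which the noise
  behaves well. It is extracted from the solution started at 0; measurability matters because maps
  are redefined off this set.\<close>

definition good :: "'w set" where
  "good = (SOME G. G \<in> sets P \<and> (AE \<omega> in P. \<omega> \<in> G) \<and> (\<forall>\<omega>\<in>G. solves 0 \<omega>))"

lemma good: "good \<in> sets P" "AE \<omega> in P. \<omega> \<in> good" "\<And>\<omega>. \<omega> \<in> good \<Longrightarrow> solves 0 \<omega>"
proof -
  obtain N where N: "\<And>\<omega>. \<omega> \<in> space P - N \<Longrightarrow> solves 0 \<omega>" "N \<in> null_sets P"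
    by (rule AE_E3[OF AE_solves[of 0]]) blast
  have "AE \<omega> in P. \<omega> \<in> space P - N" using AE_not_in[OF N(2)] by (auto elim: eventually_mono)
  then have "\<exists>G. G \<in> sets P \<and> (AE \<omega> in P. \<omega> \<in> G) \<and> (\<forall>\<omega>\<in>G. solves 0 \<omega>)"
    using N by (intro exI[of _ "space P - N"]) auto
  from someI_ex[OF this] show "good \<in> sets P" "AE \<omega> in P. \<omega> \<in> good" "\<And>\<omega>. \<omega> \<in> good \<Longrightarrow> solves 0 \<omega>"
    by (auto simp: good_def[symmetric])
qed

lemma noise_sums:
  "\<omega> \<in> good \<Longrightarrow> 0 \<le> t \<Longrightarrow> (\<lambda>k. (sqrt (lam k) * B k t \<omega>) *\<^sub>R e k) sums noise t \<omega>"
  using good(3)[of \<omega>] by (simp add: solves_def)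

lemma noise_0: "\<omega> \<in> good \<Longrightarrow> noise 0 \<omega> = 0"
  using good(3)[of \<omega>] by (simp add: solves_def noise_def)

text \<open>The noise is known only as a pointwise limit of a series at each time. Its continuity in
  time is read off the equation, in which all other terms are continuous.\<close>

lemma noise_continuous: assumes "\<omega> \<in> good" shows "continuous_on {0..T} (\<lambda>t. noise t \<omega>)"
proof -
  have s: "solves 0 \<omega>" by (rule good(3)[OF assms])
  then have c: "continuous_on {0..T} (\<lambda>t. X 0 t \<omega>)" unfolding solves_def by (auto intro: continuous_on_subset)
  have "continuous_on {0..T} (\<lambda>t. (1 / sqrt 2) *\<^sub>R (X 0 t \<omega> - integral {0..t} (\<lambda>s. D (X 0 s \<omega>))))"
    by (intro continuous_intros c indefinite_integral_continuous_1 D_comp_integrable)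
  moreover have "noise t \<omega> = (1 / sqrt 2) *\<^sub>R (X 0 t \<omega> - integral {0..t} (\<lambda>s. D (X 0 s \<omega>)))" if "t \<in> {0..T}" for t
    using s that by (simp add: solves_def)
  ultimately show ?thesis by (metis (no_types, lifting) continuous_on_cong)
qed

definition path :: "nat \<Rightarrow> 'w \<Rightarrow> real \<Rightarrow>\<^sub>C 'a" where
  "path j \<omega> = (if \<omega> \<in> good then stop_path h (\<lambda>s. noise (real j * h + s) \<omega> - noise (real j * h) \<omega>) else 0)"

lemma shifted_noise_continuous:
  assumes "\<omega> \<in> good" shows "continuous_on {0..h} (\<lambda>s. noise (real j * h + s) \<omega> - noise (real j * h) \<omega>)"
  using h by (intro continuous_intros continuous_on_compose2[OF noise_continuous[OF assms, of "real j * h + h"]]) auto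

lemma apply_path:
  "\<omega> \<in> good \<Longrightarrow> s \<in> {0..h} \<Longrightarrow> path j \<omega> s = noise (real j * h + s) \<omega> - noise (real j * h) \<omega>"
  using apply_stop_path[OF less_imp_le[OF h] shifted_noise_continuous[of \<omega> j], of s]
  by (simp add: path_def clip_id)

lemma integral_shift_left:
  fixes k :: "real \<Rightarrow> 'a"
  assumes "continuous_on {a..a+s} k" "0 \<le> s"
  shows "integral {a..a+s} k = integral {0..s} (\<lambda>r. k (a + r))"
proof -
  have "(k has_integral integral {a..a+s} k) (cbox a (a+s))"
    using assms by (auto intro!: integrable_integral integrable_continuous_interval)
  from has_integral_affinity'[OF this, of 1 a]
  have "((\<lambda>r. k (r + a)) has_integral integral {a..a+s} k) {0..s}" by simp
  then show ?thesis by (auto dest!: integral_unique simp: add.commute)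
qed

text \<open>The integral equation is restarted at time \<open>j * h\<close>; by uniqueness the
  trajectory on the next interval is the flow along the shifted noise.\<close>

lemma X_step:
  assumes s: "solves x \<omega>" and g: "\<omega> \<in> good"
  shows "X x (real (Suc j) * h) \<omega> = flow (X x (real j * h) \<omega>) (path j \<omega>)"
proof -
  let ?a = "real j * h"
  have a: "0 \<le> ?a" using h by simp
  have c: "continuous_on {0..T} (\<lambda>t. X x t \<omega>)" for T using s unfolding solves_def by (auto intro: continuous_on_subset)
  have eq: "X x t \<omega> = x + integral {0..t} (\<lambda>s. D (X x s \<omega>)) + sqrt 2 *\<^sub>R noise t \<omega>" if "0 \<le> t" for t
    using s that by (simp add: solves_def)
  have "X x (?a + h) \<omega> = sol (X x ?a \<omega>) (path j \<omega>) h"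
  proof (rule sol_unique[where v="\<lambda>s. X x (?a + s) \<omega>" and s=h])
    show "continuous_on {0..h} (\<lambda>s. X x (?a + s) \<omega>)"
      using a by (intro continuous_on_compose2[OF c[of "?a + h"]] continuous_intros) auto
    fix r assume r: "r \<in> {0..h}"
    have "integral {0..?a + r} (\<lambda>s. D (X x s \<omega>)) = integral {0..?a} (\<lambda>s. D (X x s \<omega>)) + integral {?a..?a + r} (\<lambda>s. D (X x s \<omega>))"
      using a r by (intro Henstock_Kurzweil_Integration.integral_combine[symmetric] D_comp_integrable c) auto
    also have "integral {?a..?a + r} (\<lambda>s. D (X x s \<omega>)) = integral {0..r} (\<lambda>s. D (X x (?a + s) \<omega>))"
      using r a by (intro integral_shift_left continuous_on_compose2[OF D_cont[of UNIV]] continuous_on_subset[OF c[of "?a + r"]]) auto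
    finally show "X x (?a + r) \<omega> = X x ?a \<omega> + integral {0..r} (\<lambda>s. D (X x (?a + s) \<omega>)) + sqrt 2 *\<^sub>R path j \<omega> r"
      using eq[of "?a + r"] eq[of ?a] a r g by (simp add: apply_path scaleR_diff_right)
  qed (use h in auto)
  then show ?thesis by (simp add: flow_def algebra_simps)
qed

lemma X_0: "solves x \<omega> \<Longrightarrow> X x 0 \<omega> = x"
  by (auto simp: solves_def noise_def)

section \<open>Approximation of the trajectory by functions of finitely many increments\<close>

definition vec :: "nat \<Rightarrow> (nat \<Rightarrow> real) \<Rightarrow> 'a" where
  "vec K r = (\<Sum>k<K. (sqrt (lam k) * r k) *\<^sub>R e k)"

text \<open>The series defining the noise is only known to converge for each fixed time, so below the number \<open>K\<close>
  of modes tends to infinity before the number \<open>m\<close> of time steps does. The path space is not separable;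
  measurability of path-valued maps is therefore obtained from this double limit.\<close>

definition poly :: "nat \<Rightarrow> nat \<Rightarrow> (nat \<Rightarrow> nat \<Rightarrow> real) \<Rightarrow> real \<Rightarrow>\<^sub>C 'a" where
  "poly K m a = polygon h m (\<lambda>i. vec K (a i))"

text \<open>The limit of \<open>poly\<close> when all modes are included. Index
  \<open>j * m + i\<close> is the \<open>i\<close>-th of the \<open>m\<close> small steps inside the
  \<open>j\<close>-th interval of length \<open>h\<close>.\<close>

definition npoly :: "nat \<Rightarrow> nat \<Rightarrow> 'w \<Rightarrow> real \<Rightarrow>\<^sub>C 'a" where
  "npoly m j \<omega> = polygon h m (\<lambda>i. noise (real (Suc (j * m + i)) * (h / real m)) \<omega> - noise (real (j * m + i) * (h / real m)) \<omega>)"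

lemma poly_tendsto:
  assumes "\<omega> \<in> good"
  shows "(\<lambda>K. poly K m (\<lambda>i. inc (h / real m) \<omega> (j * m + i))) \<longlonglongrightarrow> npoly m j \<omega>"
  unfolding poly_def npoly_def
proof (rule polygon_tendsto)
  fix i
  let ?s = "real (j * m + i) * (h / real m)" and ?t = "real (Suc (j * m + i)) * (h / real m)"
  have "(\<lambda>k. (sqrt (lam k) * B k ?t \<omega>) *\<^sub>R e k - (sqrt (lam k) * B k ?s \<omega>) *\<^sub>R e k) sums (noise ?t \<omega> - noise ?s \<omega>)"
    using h assms by (intro sums_diff noise_sums) auto
  then show "(\<lambda>K. vec K (inc (h / real m) \<omega> (j * m + i))) \<longlonglongrightarrow> noise ?t \<omega> - noise ?s \<omega>"
    by (simp add: sums_def vec_def inc_def algebra_simps)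
qed

lemma npoly_tendsto:
  assumes "\<omega> \<in> good" shows "(\<lambda>m. npoly (Suc m) j \<omega>) \<longlonglongrightarrow> path j \<omega>"
proof -
  have "(\<lambda>m. polygon h (Suc m) (\<lambda>i. (noise (real j * h + real (Suc i) * h / real (Suc m)) \<omega> - noise (real j * h) \<omega>)
       - (noise (real j * h + real i * h / real (Suc m)) \<omega> - noise (real j * h) \<omega>))) \<longlonglongrightarrow> path j \<omega>"
    using polygon_approx[OF h shifted_noise_continuous[OF assms, of j]] assms by (simp add: path_def)
  moreover have t: "real (j * Suc m + i) * (h / real (Suc m)) = real j * h + real i * h / real (Suc m)" for m i
  proof -
    have "real (j * Suc m + i) * (h / real (Suc m)) = (real j * real (Suc m) * h + real i * h) / real (Suc m)"
      by (simp only: of_nat_add of_nat_mult) (simp add: distrib_right)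
    also have "\<dots> = real j * h + real i * h / real (Suc m)" by (simp only: add_divide_distrib) simp
    finally show ?thesis .
  qed
  have "npoly (Suc m) j \<omega> = polygon h (Suc m) (\<lambda>i. (noise (real j * h + real (Suc i) * h / real (Suc m)) \<omega> - noise (real j * h) \<omega>)
       - (noise (real j * h + real i * h / real (Suc m)) \<omega> - noise (real j * h) \<omega>))" for m
    unfolding npoly_def using t[of m] t[of m "Suc _"] by (simp only: add_Suc_right[symmetric]) simp
  ultimately show ?thesis by simp
qed

lemma vec_continuous: "continuous_on UNIV (vec K)"
  unfolding vec_def[abs_def] by (intro continuous_intros continuous_on_product_coordinates)

lemma poly_continuous:
  assumes "\<And>i. continuous_on A (\<lambda>z. a z i)"
  shows "continuous_on A (\<lambda>z. poly K m (a z))"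
  unfolding poly_def continuous_on_def
proof (intro ballI polygon_tendsto)
  fix z i assume "z \<in> A"
  moreover have "continuous_on A (\<lambda>z. vec K (a z i))"
    by (rule continuous_on_compose2[OF vec_continuous assms]) auto
  ultimately show "((\<lambda>z. vec K (a z i)) \<longlongrightarrow> vec K (a z i)) (at z within A)" by (simp add: continuous_on_def)
qed

text \<open>After \<open>j\<close> intervals only rows below \<open>j * m\<close> have been read.
  Cutting the array at that row therefore separates past and future exactly, which is the Markov
  property at the discrete level.\<close>

primrec chain :: "nat \<Rightarrow> nat \<Rightarrow> 'a \<Rightarrow> nat \<Rightarrow> (nat \<Rightarrow> nat \<Rightarrow> real) \<Rightarrow> 'a" where
  "chain K m x 0 a = x"
| "chain K m x (Suc j) a = flow (chain K m x j a) (poly K m (\<lambda>i. a (j * m + i)))"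

primrec nchain :: "nat \<Rightarrow> 'a \<Rightarrow> nat \<Rightarrow> 'w \<Rightarrow> 'a" where
  "nchain m x 0 \<omega> = x"
| "nchain m x (Suc j) \<omega> = flow (nchain m x j \<omega>) (npoly m j \<omega>)"

lemma chain_continuous: "continuous_on UNIV (chain K m x j)"
proof (induction j)
  case (Suc j)
  then show ?case
    by (auto intro!: flow_continuous poly_continuous continuous_on_product_coordinates)
qed auto

lemma chain_tendsto:
  "\<omega> \<in> good \<Longrightarrow> (\<lambda>K. chain K m x j (inc (h / real m) \<omega>)) \<longlonglongrightarrow> nchain m x j \<omega>"
  by (induction j) (auto intro!: flow_tendsto poly_tendsto)

lemma nchain_tendsto:
  "\<omega> \<in> good \<Longrightarrow> solves x \<omega> \<Longrightarrow> (\<lambda>m. nchain (Suc m) x j \<omega>) \<longlonglongrightarrow> X x (real j * h) \<omega>"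
proof (induction j)
  case 0 then show ?case by (simp add: X_0)
next
  case (Suc j)
  then show ?case unfolding nchain.simps X_step[OF Suc.prems(2,1)] by (intro flow_tendsto npoly_tendsto)
qed

lemma chain_cut: "j' \<le> j \<Longrightarrow> chain K m x j' (comb_seq (j * m) a a') = chain K m x j' a"
proof (induction j')
  case (Suc j')
  have "comb_seq (j * m) a a' (j' * m + i) = a (j' * m + i)" if "i < m" for i
  proof -
    have "j' * m + i < Suc j' * m" using that by simp
    also have "\<dots> \<le> j * m" using Suc.prems by (rule mult_le_mono1)
    finally show ?thesis by (rule comb_seq_less)
  qed
  then have "poly K m (\<lambda>i. comb_seq (j * m) a a' (j' * m + i)) = poly K m (\<lambda>i. a (j' * m + i))"
    unfolding poly_def polygon_def by (intro arg_cong[of _ _ Bcontfun] ext sum.cong) auto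
  then show ?case using Suc by simp
qed simp

lemma chain_Suc_cut: "chain K m x (Suc j) (comb_seq (j * m) a a') = flow (chain K m x j a) (poly K m a')"
  by (simp add: chain_cut comb_seq_def)

lemma measurable_good_limit:
  fixes f :: "nat \<Rightarrow> 'w \<Rightarrow> 'c::metric_space"
  assumes "\<And>i. f i \<in> borel_measurable P" "\<And>\<omega>. \<omega> \<in> good \<Longrightarrow> (\<lambda>i. f i \<omega>) \<longlonglongrightarrow> F \<omega>"
  shows "(\<lambda>\<omega>. if \<omega> \<in> good then F \<omega> else c) \<in> borel_measurable P"
proof (rule borel_measurable_LIMSEQ_metric)
  show "(\<lambda>\<omega>. if \<omega> \<in> good then f i \<omega> else c) \<in> borel_measurable P" for i
    using assms good by (intro measurable_If_set) auto
  show "(\<lambda>i. if \<omega> \<in> good then f i \<omega> else c) \<longlonglongrightarrow> (if \<omega> \<in> good then F \<omega> else c)" for \<omega>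
    using assms(2) by simp
qed

lemma chain_measurable: "0 < m \<Longrightarrow> (\<lambda>\<omega>. chain K m x j (inc (h / real m) \<omega>)) \<in> borel_measurable P"
  using h by (intro measurable_compose[OF inc_measurable continuous_measurable_arrays[OF chain_continuous]]) auto

lemma poly_array_measurable: "poly K m \<in> arrays \<rightarrow>\<^sub>M borel"
  using poly_continuous[of UNIV "\<lambda>a. a" K m]
  by (intro continuous_measurable_arrays) (auto intro: continuous_on_product_coordinates)

lemma poly_measurable: "0 < m \<Longrightarrow> (\<lambda>\<omega>. poly K m (\<lambda>i. inc (h / real m) \<omega> (j * m + i))) \<in> borel_measurable P"
proof -
  assume m: "0 < m"
  have "continuous_on UNIV (\<lambda>a. poly K m (\<lambda>i. a (j * m + i)))"
    by (intro poly_continuous continuous_on_product_coordinates)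
  from measurable_compose[OF inc_measurable continuous_measurable_arrays[OF this]] show ?thesis using h m by simp
qed

definition gnpoly :: "nat \<Rightarrow> nat \<Rightarrow> 'w \<Rightarrow> real \<Rightarrow>\<^sub>C 'a" where
  "gnpoly m j \<omega> = (if \<omega> \<in> good then npoly m j \<omega> else 0)"
definition gnchain :: "nat \<Rightarrow> 'a \<Rightarrow> nat \<Rightarrow> 'w \<Rightarrow> 'a" where
  "gnchain m x j \<omega> = (if \<omega> \<in> good then nchain m x j \<omega> else x)"

lemma gnpoly_measurable: "0 < m \<Longrightarrow> gnpoly m j \<in> borel_measurable P"
  unfolding gnpoly_def[abs_def] by (rule measurable_good_limit[OF poly_measurable poly_tendsto])

lemma gnchain_measurable: "0 < m \<Longrightarrow> gnchain m x j \<in> borel_measurable P"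
  unfolding gnchain_def[abs_def] by (rule measurable_good_limit[OF chain_measurable chain_tendsto])

lemma path_measurable: "path j \<in> borel_measurable P"
proof -
  have "(\<lambda>\<omega>. if \<omega> \<in> good then path j \<omega> else 0) \<in> borel_measurable P"
  proof (rule measurable_good_limit[where f="\<lambda>m. gnpoly (Suc m) j" and F="path j"])
    show "gnpoly (Suc m) j \<in> borel_measurable P" for m by (rule gnpoly_measurable) simp
    show "(\<lambda>m. gnpoly (Suc m) j \<omega>) \<longlonglongrightarrow> path j \<omega>" if "\<omega> \<in> good" for \<omega>
      using npoly_tendsto[OF that, of j] that by (simp add: gnpoly_def)
  qed
  moreover have "(\<lambda>\<omega>. if \<omega> \<in> good then path j \<omega> else 0) = path j" by (auto simp: path_def)
  ultimately show ?thesis by simp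
qed

section \<open>Limits of test integrals and the one-step Markov identity\<close>

lemma nn_integral_test_tendsto:
  fixes V :: "nat \<Rightarrow> 'w \<Rightarrow> 'c::metric_space" and g :: "'c \<Rightarrow> real"
  assumes V: "\<And>i. V i \<in> borel_measurable P" "V' \<in> borel_measurable P"
    and lim: "AE \<omega> in P. (\<lambda>i. V i \<omega>) \<longlonglongrightarrow> V' \<omega>"
    and g: "continuous_on UNIV g" "\<And>x. 0 \<le> g x \<and> g x \<le> 1"
  shows "(\<lambda>i. \<integral>\<^sup>+\<omega>. ennreal (g (V i \<omega>)) \<partial>P) \<longlonglongrightarrow> (\<integral>\<^sup>+\<omega>. ennreal (g (V' \<omega>)) \<partial>P)"
proof (rule nn_integral_dominated_convergence[where w="\<lambda>_. 1"])
  have gm: "(\<lambda>x. ennreal (g x)) \<in> borel_measurable borel"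
    using borel_measurable_continuous_onI[OF g(1)] by simp
  show "(\<lambda>\<omega>. ennreal (g (V i \<omega>))) \<in> borel_measurable P" for i by (rule measurable_compose[OF V(1) gm])
  show "(\<lambda>\<omega>. ennreal (g (V' \<omega>))) \<in> borel_measurable P" by (rule measurable_compose[OF V(2) gm])
  show "AE \<omega> in P. (\<lambda>i. ennreal (g (V i \<omega>))) \<longlonglongrightarrow> ennreal (g (V' \<omega>))"
    using lim by eventually_elim (auto intro!: tendsto_ennrealI continuous_on_tendsto_compose[OF g(1)])
qed (use g in \<open>auto simp: emeasure_space_1\<close>)

lemma flow_measurable: "Y \<in> borel_measurable P \<Longrightarrow> (\<lambda>\<omega>. flow v (Y \<omega>)) \<in> borel_measurable P"
  by (rule measurable_compose[where N=borel]) (auto intro!: borel_measurable_continuous_onI flow_continuous)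

text \<open>The driving path \<open>Y\<close> is a parameter, so that original and reflected noise
  give kernels of the same shape.\<close>

definition kern :: "('w \<Rightarrow> real \<Rightarrow>\<^sub>C 'a) \<Rightarrow> 'a \<Rightarrow> 'a measure" where
  "kern Y v = distr P borel (\<lambda>\<omega>. flow v (Y \<omega>))"

lemma kern_measurable: "Y \<in> borel_measurable P \<Longrightarrow> kern Y \<in> borel \<rightarrow>\<^sub>M subprob_algebra borel"
  unfolding kern_def[abs_def]
  by (rule kernel_measurable[where S=UNIV]) (auto intro!: flow_measurable flow_continuous prob_space_axioms)

lemma nn_integral_kern:
  assumes "Y \<in> borel_measurable P" "g \<in> borel_measurable borel"
  shows "(\<integral>\<^sup>+y. g y \<partial>kern Y v) = (\<integral>\<^sup>+\<omega>. g (flow v (Y \<omega>)) \<partial>P)"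
  unfolding kern_def using assms by (intro nn_integral_distr flow_measurable) auto

lemma nn_integral_flow_measurable:
  assumes "Y \<in> borel_measurable P" "g \<in> borel_measurable borel"
  shows "(\<lambda>v. \<integral>\<^sup>+\<omega>. g (flow v (Y \<omega>)) \<partial>P) \<in> borel_measurable borel"
  using measurable_compose[OF kern_measurable[OF assms(1)] nn_integral_measurable_subprob_algebra[OF assms(2)]]
  by (simp add: nn_integral_kern assms)

text \<open>The current state and the next driving path live on independent copies of the
  probability space. Dominated convergence is applied to the inner integral for almost every outer
  point and then to the outer one.\<close>

lemma nn_integral_test2_tendsto:
  fixes V :: "nat \<Rightarrow> 'w \<Rightarrow> 'a" and g :: "'a \<Rightarrow> real"
  assumes V: "\<And>i. V i \<in> borel_measurable P" "V' \<in> borel_measurable P" "AE \<omega> in P. (\<lambda>i. V i \<omega>) \<longlonglongrightarrow> V' \<omega>"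
    and Y: "\<And>i. Y i \<in> borel_measurable P" "Y' \<in> borel_measurable P" "AE \<omega> in P. (\<lambda>i. Y i \<omega>) \<longlonglongrightarrow> Y' \<omega>"
    and g: "continuous_on UNIV g" "\<And>x. 0 \<le> g x \<and> g x \<le> 1"
  shows "(\<lambda>i. \<integral>\<^sup>+\<omega>. \<integral>\<^sup>+\<omega>'. ennreal (g (flow (V i \<omega>) (Y i \<omega>'))) \<partial>P \<partial>P)
     \<longlonglongrightarrow> (\<integral>\<^sup>+\<omega>. \<integral>\<^sup>+\<omega>'. ennreal (g (flow (V' \<omega>) (Y' \<omega>'))) \<partial>P \<partial>P)"
proof (rule nn_integral_dominated_convergence[where w="\<lambda>_. 1"])
  have gm: "(\<lambda>x. ennreal (g x)) \<in> borel_measurable borel"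
    using borel_measurable_continuous_onI[OF g(1)] by simp
  show "(\<lambda>\<omega>. \<integral>\<^sup>+\<omega>'. ennreal (g (flow (V i \<omega>) (Y i \<omega>'))) \<partial>P) \<in> borel_measurable P" for i
    by (rule measurable_compose[OF V(1) nn_integral_flow_measurable[OF Y(1) gm]])
  show "(\<lambda>\<omega>. \<integral>\<^sup>+\<omega>'. ennreal (g (flow (V' \<omega>) (Y' \<omega>'))) \<partial>P) \<in> borel_measurable P"
    by (rule measurable_compose[OF V(2) nn_integral_flow_measurable[OF Y(2) gm]])
  show "AE \<omega> in P. (\<integral>\<^sup>+\<omega>'. ennreal (g (flow (V i \<omega>) (Y i \<omega>'))) \<partial>P) \<le> 1" for i
  proof (rule AE_I2)
    fix \<omega>
    have "(\<integral>\<^sup>+\<omega>'. ennreal (g (flow (V i \<omega>) (Y i \<omega>'))) \<partial>P) \<le> (\<integral>\<^sup>+\<omega>'. 1 \<partial>P)"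
      using g by (intro nn_integral_mono) auto
    then show "(\<integral>\<^sup>+\<omega>'. ennreal (g (flow (V i \<omega>) (Y i \<omega>'))) \<partial>P) \<le> 1" by (simp add: emeasure_space_1)
  qed
  show "AE \<omega> in P. (\<lambda>i. \<integral>\<^sup>+\<omega>'. ennreal (g (flow (V i \<omega>) (Y i \<omega>'))) \<partial>P)
      \<longlonglongrightarrow> (\<integral>\<^sup>+\<omega>'. ennreal (g (flow (V' \<omega>) (Y' \<omega>'))) \<partial>P)"
    using V(3)
  proof eventually_elim
    case (elim \<omega>)
    show ?case
    proof (rule nn_integral_test_tendsto[OF _ _ _ g])
      show "AE \<omega>' in P. (\<lambda>i. flow (V i \<omega>) (Y i \<omega>')) \<longlonglongrightarrow> flow (V' \<omega>) (Y' \<omega>')"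
        using Y(3) by eventually_elim (intro flow_tendsto elim)
    qed (auto intro: flow_measurable Y)
  qed
qed (auto simp: emeasure_space_1)

text \<open>For finitely many modes and time steps the identity is exact, by cutting the array. The
  number of modes tends to infinity first, in \<open>mid\<close>, and the number of time steps
  afterwards.\<close>

lemma markov_test:
  fixes g :: "'a \<Rightarrow> real"
  assumes g: "continuous_on UNIV g" "\<And>x. 0 \<le> g x \<and> g x \<le> 1"
  shows "(\<integral>\<^sup>+\<omega>. ennreal (g (X x (real (Suc j) * h) \<omega>)) \<partial>P)
    = (\<integral>\<^sup>+\<omega>. \<integral>\<^sup>+\<omega>'. ennreal (g (flow (X x (real j * h) \<omega>) (path 0 \<omega>'))) \<partial>P \<partial>P)"
proof -
  have gm: "(\<lambda>x. ennreal (g x)) \<in> borel_measurable borel"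
    using borel_measurable_continuous_onI[OF g(1)] by simp
  have lvl: "(\<integral>\<^sup>+\<omega>. ennreal (g (chain K m x (Suc j) (inc (h / real m) \<omega>))) \<partial>P)
    = (\<integral>\<^sup>+\<omega>. \<integral>\<^sup>+\<omega>'. ennreal (g (flow (chain K m x j (inc (h / real m) \<omega>)) (poly K m (inc (h / real m) \<omega>')))) \<partial>P \<partial>P)"
    if m: "0 < m" for K m
  proof -
    have F: "(\<lambda>a. ennreal (g (chain K m x (Suc j) a))) \<in> borel_measurable arrays"
      by (rule measurable_compose[OF continuous_measurable_arrays[OF chain_continuous] gm])
    show ?thesis
      using nn_integral_inc_cut[OF _ F, of "h / real m" "j * m"] h m by (simp only: chain_Suc_cut) simp
  qed
  have mid: "(\<integral>\<^sup>+\<omega>. ennreal (g (gnchain m x (Suc j) \<omega>)) \<partial>P)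
    = (\<integral>\<^sup>+\<omega>. \<integral>\<^sup>+\<omega>'. ennreal (g (flow (gnchain m x j \<omega>) (gnpoly m 0 \<omega>'))) \<partial>P \<partial>P)" if m: "0 < m" for m
  proof (rule LIMSEQ_unique)
    show "(\<lambda>K. \<integral>\<^sup>+\<omega>. ennreal (g (chain K m x (Suc j) (inc (h / real m) \<omega>))) \<partial>P)
       \<longlonglongrightarrow> (\<integral>\<^sup>+\<omega>. ennreal (g (gnchain m x (Suc j) \<omega>)) \<partial>P)"
    proof (rule nn_integral_test_tendsto[OF chain_measurable[OF m] gnchain_measurable[OF m] _ g])
      show "AE \<omega> in P. (\<lambda>K. chain K m x (Suc j) (inc (h / real m) \<omega>)) \<longlonglongrightarrow> gnchain m x (Suc j) \<omega>"
        using good(2) by eventually_elim (simp add: gnchain_def chain_tendsto del: chain.simps nchain.simps)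
    qed
    show "(\<lambda>K. \<integral>\<^sup>+\<omega>. ennreal (g (chain K m x (Suc j) (inc (h / real m) \<omega>))) \<partial>P)
      \<longlonglongrightarrow> (\<integral>\<^sup>+\<omega>. \<integral>\<^sup>+\<omega>'. ennreal (g (flow (gnchain m x j \<omega>) (gnpoly m 0 \<omega>'))) \<partial>P \<partial>P)"
      unfolding lvl[OF m]
    proof (rule nn_integral_test2_tendsto[OF chain_measurable[OF m] gnchain_measurable[OF m] _ _ gnpoly_measurable[OF m] _ g])
      show "AE \<omega> in P. (\<lambda>K. chain K m x j (inc (h / real m) \<omega>)) \<longlonglongrightarrow> gnchain m x j \<omega>"
        using good(2) by eventually_elim (simp add: gnchain_def chain_tendsto)
      show "AE \<omega> in P. (\<lambda>K. poly K m (inc (h / real m) \<omega>)) \<longlonglongrightarrow> gnpoly m 0 \<omega>"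
        using good(2)
      proof eventually_elim
        case (elim \<omega>) then show ?case using poly_tendsto[OF elim, of m 0] by (simp add: gnpoly_def)
      qed
      show "(\<lambda>\<omega>. poly K m (inc (h / real m) \<omega>)) \<in> borel_measurable P" for K
        using poly_measurable[OF m, of K 0] by simp
    qed
  qed
  show ?thesis
  proof (rule LIMSEQ_unique)
    show "(\<lambda>m. \<integral>\<^sup>+\<omega>. ennreal (g (gnchain (Suc m) x (Suc j) \<omega>)) \<partial>P) \<longlonglongrightarrow> (\<integral>\<^sup>+\<omega>. ennreal (g (X x (real (Suc j) * h) \<omega>)) \<partial>P)"
    proof (rule nn_integral_test_tendsto[OF gnchain_measurable X_measurable _ g])
      show "AE \<omega> in P. (\<lambda>m. gnchain (Suc m) x (Suc j) \<omega>) \<longlonglongrightarrow> X x (real (Suc j) * h) \<omega>"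
        using good(2) AE_solves[of x]
        by eventually_elim (simp add: gnchain_def nchain_tendsto del: nchain.simps of_nat_Suc)
    qed (use h in auto)
    show "(\<lambda>m. \<integral>\<^sup>+\<omega>. ennreal (g (gnchain (Suc m) x (Suc j) \<omega>)) \<partial>P)
       \<longlonglongrightarrow> (\<integral>\<^sup>+\<omega>. \<integral>\<^sup>+\<omega>'. ennreal (g (flow (X x (real j * h) \<omega>) (path 0 \<omega>'))) \<partial>P \<partial>P)"
      unfolding mid[OF zero_less_Suc]
    proof (rule nn_integral_test2_tendsto[OF gnchain_measurable X_measurable _ gnpoly_measurable path_measurable _ g])
      show "AE \<omega> in P. (\<lambda>m. gnchain (Suc m) x j \<omega>) \<longlonglongrightarrow> X x (real j * h) \<omega>"
        using good(2) AE_solves[of x] by eventually_elim (simp add: gnchain_def nchain_tendsto)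
      show "AE \<omega> in P. (\<lambda>m. gnpoly (Suc m) 0 \<omega>) \<longlonglongrightarrow> path 0 \<omega>"
        using good(2) by eventually_elim (simp add: gnpoly_def npoly_tendsto)
    qed (use h in auto)
  qed
qed

lemma prob_space_kern: "Y \<in> borel_measurable P \<Longrightarrow> prob_space (kern Y v)"
  unfolding kern_def by (intro prob_space_distr flow_measurable)

lemma markov:
  "distr P borel (X x (real (Suc j) * h)) = distr P borel (X x (real j * h)) \<bind> kern (path 0)"
proof (rule borel_measure_eqI)
  let ?M = "distr P borel (X x (real j * h))"
  have Xm: "X x (real j * h) \<in> borel_measurable P" for j using h by (intro X_measurable) simp
  have ps: "prob_space (distr P borel (X x (real j * h)))" for j by (rule prob_space_distr[OF Xm])
  show "prob_space (distr P borel (X x (real (Suc j) * h)))" by (rule ps)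
  have km: "kern (path 0) \<in> ?M \<rightarrow>\<^sub>M subprob_algebra borel" using kern_measurable[OF path_measurable, of 0] by simp
  have "kern (path 0) \<in> borel \<rightarrow>\<^sub>M prob_algebra borel"
    using kern_measurable[OF path_measurable, of 0] prob_space_kern[OF path_measurable, of 0]
    by (intro measurable_prob_algebraI) auto
  moreover have "?M \<in> space (prob_algebra borel)" using ps[of j] by (simp add: space_prob_algebra)
  ultimately show "prob_space (?M \<bind> kern (path 0))" "sets (?M \<bind> kern (path 0)) = sets borel"
    using prob_space_bind' sets_bind' by blast+
  fix g :: "'a \<Rightarrow> real" assume g: "continuous_on UNIV g" "\<And>x. 0 \<le> g x \<and> g x \<le> 1"
  have gm: "(\<lambda>x. ennreal (g x)) \<in> borel_measurable borel"
    using borel_measurable_continuous_onI[OF g(1)] by simp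
  have "(\<integral>\<^sup>+y. ennreal (g y) \<partial>(?M \<bind> kern (path 0))) = (\<integral>\<^sup>+y. \<integral>\<^sup>+\<omega>. ennreal (g (flow y (path 0 \<omega>))) \<partial>P \<partial>?M)"
    by (simp add: nn_integral_bind[OF gm km] nn_integral_kern[OF path_measurable gm])
  also have "\<dots> = (\<integral>\<^sup>+\<omega>. \<integral>\<^sup>+\<omega>'. ennreal (g (flow (X x (real j * h) \<omega>) (path 0 \<omega>'))) \<partial>P \<partial>P)"
    using nn_integral_flow_measurable[OF path_measurable gm, of 0] by (intro nn_integral_distr[OF Xm]) auto
  also have "\<dots> = (\<integral>\<^sup>+\<omega>. ennreal (g (X x (real (Suc j) * h) \<omega>)) \<partial>P)" by (rule markov_test[OF g, symmetric])
  also have "\<dots> = (\<integral>\<^sup>+y. ennreal (g y) \<partial>distr P borel (X x (real (Suc j) * h)))"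
    using gm by (intro nn_integral_distr[OF Xm, symmetric]) auto
  finally show "(\<integral>\<^sup>+y. ennreal (g y) \<partial>distr P borel (X x (real (Suc j) * h))) = (\<integral>\<^sup>+y. ennreal (g y) \<partial>(?M \<bind> kern (path 0)))" ..
qed simp

lemma X_0_law: "distr P borel (X x 0) = return borel x"
proof -
  have "distr P borel (X x 0) = distr P borel (\<lambda>_. x)"
    using AE_solves[of x] by (intro distr_cong_AE) (auto intro: X_measurable elim!: eventually_mono simp: X_0)
  then show ?thesis by simp
qed

end

section \<open>Reflected noise and its moments\<close>

lemma eval_continuous: "continuous_on UNIV (\<lambda>w :: real \<Rightarrow>\<^sub>C 'a::real_normed_vector. apply_bcontfun w s)"
proof -
  have "1-lipschitz_on UNIV (\<lambda>w :: real \<Rightarrow>\<^sub>C 'a. apply_bcontfun w s)"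
    by (rule lipschitz_onI) (auto simp: dist_bounded)
  then show ?thesis by (rule lipschitz_on_continuous_on)
qed

text \<open>Continuity in time allows rounding the time down to a grid with countably many values.
  Joint measurability is what Fubini needs for the time integral of the noise.\<close>

lemma evaluation_measurable:
  fixes Y :: "'w \<Rightarrow> real \<Rightarrow>\<^sub>C 'a::real_inner"
  assumes Y: "Y \<in> borel_measurable P"
  shows "(\<lambda>z. apply_bcontfun (Y (snd z)) (fst z) \<bullet> a) \<in> borel_measurable (lborel \<Otimes>\<^sub>M P)"
proof (rule borel_measurable_LIMSEQ_real)
  let ?f = "\<lambda>m z. apply_bcontfun (Y (snd z)) (of_int \<lfloor>real (Suc m) * fst z\<rfloor> / real (Suc m)) \<bullet> a"
  show "?f m \<in> borel_measurable (lborel \<Otimes>\<^sub>M P)" for m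
  proof (rule measurable_compose_countable[where f="\<lambda>i z. apply_bcontfun (Y (snd z)) (of_int i / real (Suc m)) \<bullet> a"
        and g="\<lambda>z. \<lfloor>real (Suc m) * fst z\<rfloor>"])
    fix i :: int
    have "continuous_on UNIV (\<lambda>w :: real \<Rightarrow>\<^sub>C 'a. apply_bcontfun w (of_int i / real (Suc m)) \<bullet> a)"
      by (intro continuous_intros eval_continuous)
    from measurable_compose[OF Y borel_measurable_continuous_onI[OF this]]
    show "(\<lambda>z. apply_bcontfun (Y (snd z)) (of_int i / real (Suc m)) \<bullet> a) \<in> borel_measurable (lborel \<Otimes>\<^sub>M P)"
      by (rule measurable_compose[OF measurable_snd])
  qed measurable
  fix z :: "real \<times> 'w"
  let ?s = "fst z"
  have "(\<lambda>m. of_int \<lfloor>real (Suc m) * ?s\<rfloor> / real (Suc m)) \<longlonglongrightarrow> ?s"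
  proof (rule tendsto_sandwich)
    show "\<forall>\<^sub>F m in sequentially. ?s - 1 / real (Suc m) \<le> of_int \<lfloor>real (Suc m) * ?s\<rfloor> / real (Suc m)"
    proof (intro always_eventually allI)
      fix m
      have "real (Suc m) * ?s - 1 \<le> of_int \<lfloor>real (Suc m) * ?s\<rfloor>" by linarith
      then have "(real (Suc m) * ?s - 1) / real (Suc m) \<le> of_int \<lfloor>real (Suc m) * ?s\<rfloor> / real (Suc m)"
        by (intro divide_right_mono) auto
      then show "?s - 1 / real (Suc m) \<le> of_int \<lfloor>real (Suc m) * ?s\<rfloor> / real (Suc m)" by (simp add: diff_divide_distrib)
    qed
    show "\<forall>\<^sub>F m in sequentially. of_int \<lfloor>real (Suc m) * ?s\<rfloor> / real (Suc m) \<le> ?s"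
    proof (intro always_eventually allI)
      fix m
      have "of_int \<lfloor>real (Suc m) * ?s\<rfloor> / real (Suc m) \<le> real (Suc m) * ?s / real (Suc m)"
        by (intro divide_right_mono) auto
      then show "of_int \<lfloor>real (Suc m) * ?s\<rfloor> / real (Suc m) \<le> ?s" by simp
    qed
    have "(\<lambda>m. ?s - 1 / real (Suc m)) \<longlonglongrightarrow> ?s - 0" by (intro tendsto_intros LIMSEQ_Suc[OF lim_1_over_n])
    then show "(\<lambda>m. ?s - 1 / real (Suc m)) \<longlonglongrightarrow> ?s" by simp
  qed auto
  then show "(\<lambda>m. ?f m z) \<longlonglongrightarrow> apply_bcontfun (Y (snd z)) (fst z) \<bullet> a"
    using continuous_on_tendsto_compose[OF continuous_on_apply_bcontfun[of UNIV "Y (snd z)"]]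
    by (intro tendsto_intros) auto
qed

lemma (in prob_space) normal_moments:
  assumes N: "distributed M lborel N (\<lambda>x. ennreal (normal_density 0 \<sigma> x))" and \<sigma>: "0 < \<sigma>"
  shows "integrable M N" "(\<integral>x. N x \<partial>M) = 0" "integrable M (\<lambda>x. (N x)\<^sup>2)" "(\<integral>x. (N x)\<^sup>2 \<partial>M) = \<sigma>\<^sup>2"
    "integrable M (\<lambda>x. \<bar>N x\<bar>)" "(\<integral>x. \<bar>N x\<bar> \<partial>M) \<le> \<sigma>"
    "integrable M (\<lambda>x. \<bar>N x\<bar> ^ 3)" "(\<integral>x. \<bar>N x\<bar> ^ 3 \<partial>M) \<le> 2 * \<sigma> ^ 3"
proof -
  have tr: "integrable M (\<lambda>x. g (N x)) \<and> (\<integral>x. g (N x) \<partial>M) = c"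
    if "has_bochner_integral lborel (\<lambda>x. normal_density 0 \<sigma> x * g x) c" "g \<in> borel_measurable borel" for g c
    using distributed_integrable[OF N, of g] distributed_integral[OF N, of g] that
    by (auto simp: has_bochner_integral_iff)
  have sp: "sqrt (2 / pi) \<le> 1" using pi_gt3 by simp
  have 1: "integrable M N \<and> (\<integral>x. N x \<partial>M) = 0"
    using tr[of "\<lambda>x. x" 0] normal_moment_odd[OF \<sigma>, of 0 0] by simp
  have 2: "integrable M (\<lambda>x. (N x)\<^sup>2) \<and> (\<integral>x. (N x)\<^sup>2 \<partial>M) = \<sigma>\<^sup>2"
    using tr[of "\<lambda>x. x\<^sup>2" "\<sigma>\<^sup>2"] normal_moment_even[OF \<sigma>, of 0 1] by (simp add: fact_numeral)
  have 3: "integrable M (\<lambda>x. \<bar>N x\<bar>) \<and> (\<integral>x. \<bar>N x\<bar> \<partial>M) = \<sigma> * sqrt (2 / pi)"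
    using tr[of "\<lambda>x. \<bar>x\<bar>"] normal_moment_abs_odd[OF \<sigma>, of 0 0] by simp
  have 4: "integrable M (\<lambda>x. \<bar>N x\<bar> ^ 3) \<and> (\<integral>x. \<bar>N x\<bar> ^ 3 \<partial>M) = 2 * \<sigma> ^ 3 * sqrt (2 / pi)"
    using tr[of "\<lambda>x. \<bar>x\<bar> ^ 3"] normal_moment_abs_odd[OF \<sigma>, of 0 1] by (simp add: numeral_3_eq_3)
  show "integrable M N" "(\<integral>x. N x \<partial>M) = 0" "integrable M (\<lambda>x. (N x)\<^sup>2)" "(\<integral>x. (N x)\<^sup>2 \<partial>M) = \<sigma>\<^sup>2"
    "integrable M (\<lambda>x. \<bar>N x\<bar>)" "integrable M (\<lambda>x. \<bar>N x\<bar> ^ 3)" using 1 2 3 4 by auto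
  show "(\<integral>x. \<bar>N x\<bar> \<partial>M) \<le> \<sigma>" using 3 sp \<sigma> mult_left_mono[OF sp, of \<sigma>] by simp
  show "(\<integral>x. \<bar>N x\<bar> ^ 3 \<partial>M) \<le> 2 * \<sigma> ^ 3" using 4 sp \<sigma> mult_left_mono[OF sp, of "2 * \<sigma> ^ 3"] by simp
qed

locale reflection_setting = sde_setting b L h P B e lam X
  for b :: "'a::{real_inner,banach} \<Rightarrow> 'a" and L h :: real and P :: "'w measure" and B e lam X +
  fixes n :: nat
  assumes orthonormal: "\<And>i j. e i \<bullet> e j = (if i = j then 1 else 0)"
    and lam_pos: "\<And>k. k < n \<Longrightarrow> 0 < lam k"
begin

text \<open>The squared norm of the low part of \<open>z\<close> for the inverse covariance. Its
  ratio to the ordinary squared norm governs the variance produced by the reflection.\<close>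

definition cov_form :: "'a \<Rightarrow> real" where
  "cov_form z = (\<Sum>k<n. (z \<bullet> e k)\<^sup>2 / lam k)"

definition cov_inv :: "'a \<Rightarrow> 'a" where
  "cov_inv z = (\<Sum>k<n. ((z \<bullet> e k) / lam k) *\<^sub>R e k)"

lemma inner_basis_sum: "(\<Sum>k<K. c k *\<^sub>R e k) \<bullet> e j = (if j < K then c j else 0)"
proof -
  have "(\<Sum>k<K. c k *\<^sub>R e k) \<bullet> e j = (\<Sum>k<K. if k = j then c k else 0)"
    by (simp add: inner_sum_left orthonormal if_distrib cong: if_cong)
  then show ?thesis by simp
qed

lemma inner_vec: "vec K r \<bullet> e j = (if j < K then sqrt (lam j) * r j else 0)"
  unfolding vec_def by (rule inner_basis_sum)

lemma inner_cov_inv: "v \<bullet> cov_inv z = (\<Sum>k<n. (z \<bullet> e k) / lam k * (v \<bullet> e k))"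
  by (simp add: cov_inv_def inner_sum_right)

text \<open>The reflection of the low modes at the hyperplane orthogonal to \<open>z\<close> in the inner product given by the
  inverse covariance: a path and its reflection differ by a multiple of the low part of \<open>z\<close>.\<close>

definition refl_path :: "'a \<Rightarrow> (real \<Rightarrow>\<^sub>C 'a) \<Rightarrow> real \<Rightarrow>\<^sub>C 'a" where
  "refl_path z = skew_path ((2 / cov_form z) *\<^sub>R cov_inv z) (low_proj e n z)"

text \<open>Dividing each low coordinate by \<open>sqrt (lam k)\<close> makes the noise standard. In
  these coordinates the oblique reflection is the Householder reflection at the normalised image
  \<open>c\<close> of \<open>z\<close>. The condition \<open>n \<le> K\<close> keeps all reflected
  modes in the truncation.\<close>

lemma skew_vec:
  assumes z: "0 < cov_form z" and K: "n \<le> K"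
  defines "c \<equiv> \<lambda>k. (z \<bullet> e k) / (sqrt (lam k) * sqrt (cov_form z))"
  shows "skew ((2 / cov_form z) *\<^sub>R cov_inv z) (low_proj e n z) (vec K r) = vec K (reflect_row n c r)"
    and "(\<Sum>k<n. (c k)\<^sup>2) = 1"
proof -
  let ?q = "cov_form z"
  have sl: "sqrt (lam k) * sqrt (lam k) = lam k" "0 < sqrt (lam k)" if "k < n" for k using lam_pos[OF that] by auto
  have sq: "sqrt ?q * sqrt ?q = ?q" using z by simp
  have "(\<Sum>k<n. (c k)\<^sup>2) = (\<Sum>k<n. (z \<bullet> e k)\<^sup>2 / lam k / ?q)"
  proof (intro sum.cong refl)
    fix k assume "k \<in> {..<n}"
    then have "(sqrt (lam k) * sqrt ?q)\<^sup>2 = lam k * ?q" using less_imp_le[OF lam_pos, of k] z by (simp add: power_mult_distrib)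
    then show "(c k)\<^sup>2 = (z \<bullet> e k)\<^sup>2 / lam k / ?q" by (simp add: c_def power_divide)
  qed
  also have "\<dots> = 1" unfolding sum_divide_distrib[symmetric] cov_form_def[symmetric] using z by simp
  finally show "(\<Sum>k<n. (c k)\<^sup>2) = 1" .
  define \<beta> where "\<beta> = (\<Sum>k<n. c k * r k)"
  have "vec K r \<bullet> cov_inv z = (\<Sum>k<n. (z \<bullet> e k) / lam k * (sqrt (lam k) * r k))"
    unfolding inner_cov_inv using K by (intro sum.cong) (auto simp: inner_vec)
  also have "\<dots> = (\<Sum>k<n. sqrt ?q * (c k * r k))"
  proof (intro sum.cong refl)
    fix k assume "k \<in> {..<n}"
    then have k: "k < n" by simp
    have "(z \<bullet> e k) / lam k * (sqrt (lam k) * r k) = (z \<bullet> e k) / sqrt (lam k) * r k"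
      using sl[OF k] by (simp add: field_simps)
    also have "\<dots> = sqrt ?q * (c k * r k)" using z by (simp add: c_def)
    finally show "(z \<bullet> e k) / lam k * (sqrt (lam k) * r k) = sqrt ?q * (c k * r k)" .
  qed
  finally have in1: "vec K r \<bullet> cov_inv z = sqrt ?q * \<beta>" by (simp add: \<beta>_def sum_distrib_left)
  have "vec K r \<bullet> ((2 / ?q) *\<^sub>R cov_inv z) = 2 * \<beta> / sqrt ?q"
    using z sq by (simp add: in1 field_simps)
  moreover have "(2 * \<beta> / sqrt ?q) *\<^sub>R low_proj e n z = (\<Sum>k<n. (sqrt (lam k) * (2 * \<beta> * c k)) *\<^sub>R e k)"
    unfolding low_proj_def scaleR_sum_right
  proof (intro sum.cong refl)
    fix k assume "k \<in> {..<n}"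
    then have "2 * \<beta> / sqrt ?q * (z \<bullet> e k) = sqrt (lam k) * (2 * \<beta> * c k)"
      using sl[of k] by (simp add: c_def)
    then show "(2 * \<beta> / sqrt ?q) *\<^sub>R (z \<bullet> e k) *\<^sub>R e k = (sqrt (lam k) * (2 * \<beta> * c k)) *\<^sub>R e k" by simp
  qed
  moreover have "vec K (reflect_row n c r) = vec K r - (\<Sum>k<n. (sqrt (lam k) * (2 * \<beta> * c k)) *\<^sub>R e k)"
  proof -
    have "(\<Sum>k<n. (sqrt (lam k) * (2 * \<beta> * c k)) *\<^sub>R e k) = (\<Sum>k<K. if k < n then (sqrt (lam k) * (2 * \<beta> * c k)) *\<^sub>R e k else 0)"
      using K by (intro sum.mono_neutral_cong_left) auto
    moreover have "vec K r - vec K (reflect_row n c r) = (\<Sum>k<K. if k < n then (sqrt (lam k) * (2 * \<beta> * c k)) *\<^sub>R e k else 0)"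
      unfolding vec_def sum_subtractf[symmetric]
      by (intro sum.cong) (auto simp: reflect_row_def \<beta>_def algebra_simps)
    ultimately have "vec K r - vec K (reflect_row n c r) = (\<Sum>k<n. (sqrt (lam k) * (2 * \<beta> * c k)) *\<^sub>R e k)" by simp
    then show ?thesis by (simp add: diff_eq_eq add.commute eq_diff_eq)
  qed
  ultimately show "skew ((2 / ?q) *\<^sub>R cov_inv z) (low_proj e n z) (vec K r) = vec K (reflect_row n c r)"
    by (simp add: skew_def)
qed

text \<open>Transfers an identity from truncated polygonal noise to the true noise, for functionals
  that are continuous on path space.\<close>

lemma path_test_eq:
  fixes \<Psi> \<Xi> :: "(real \<Rightarrow>\<^sub>C 'a) \<Rightarrow> 'c::metric_space" and g :: "'c \<Rightarrow> real"
  assumes \<Psi>\<Xi>: "continuous_on UNIV \<Psi>" "continuous_on UNIV \<Xi>"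
    and g: "continuous_on UNIV g" "\<And>x. 0 \<le> g x \<and> g x \<le> 1"
    and eq: "\<And>K m. 0 < m \<Longrightarrow> n \<le> K \<Longrightarrow> (\<integral>\<^sup>+\<omega>. ennreal (g (\<Psi> (poly K m (inc (h / real m) \<omega>)))) \<partial>P)
        = (\<integral>\<^sup>+\<omega>. ennreal (g (\<Xi> (poly K m (inc (h / real m) \<omega>)))) \<partial>P)"
  shows "(\<integral>\<^sup>+\<omega>. ennreal (g (\<Psi> (path 0 \<omega>))) \<partial>P) = (\<integral>\<^sup>+\<omega>. ennreal (g (\<Xi> (path 0 \<omega>))) \<partial>P)"
proof -
  have meas: "(\<lambda>\<omega>. \<Psi> (Y \<omega>)) \<in> borel_measurable P" if "continuous_on UNIV \<Psi>" "Y \<in> borel_measurable P"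
    for \<Psi> :: "(real \<Rightarrow>\<^sub>C 'a) \<Rightarrow> 'c" and Y
    by (rule measurable_compose[OF that(2) borel_measurable_continuous_onI[OF that(1)]])
  \<comment> \<open>The shift by \<open>n\<close> stays in the range of truncations for which the
    identity is available.\<close>
  have lim1: "(\<lambda>K. \<integral>\<^sup>+\<omega>. ennreal (g (\<Psi> (poly (K + n) m (inc (h / real m) \<omega>)))) \<partial>P) \<longlonglongrightarrow> (\<integral>\<^sup>+\<omega>. ennreal (g (\<Psi> (gnpoly m 0 \<omega>))) \<partial>P)"
    if \<Psi>: "continuous_on UNIV \<Psi>" and m: "0 < m" for \<Psi> :: "(real \<Rightarrow>\<^sub>C 'a) \<Rightarrow> 'c" and m
  proof (rule nn_integral_test_tendsto[OF _ _ _ g])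
    show "(\<lambda>\<omega>. \<Psi> (poly (K + n) m (inc (h / real m) \<omega>))) \<in> borel_measurable P" for K
      using poly_measurable[OF m, of "K + n" 0] by (intro meas \<Psi>) simp
    show "(\<lambda>\<omega>. \<Psi> (gnpoly m 0 \<omega>)) \<in> borel_measurable P" by (intro meas \<Psi> gnpoly_measurable m)
    show "AE \<omega> in P. (\<lambda>K. \<Psi> (poly (K + n) m (inc (h / real m) \<omega>))) \<longlonglongrightarrow> \<Psi> (gnpoly m 0 \<omega>)"
      using good(2)
    proof eventually_elim
      case (elim \<omega>)
      then have "(\<lambda>K. poly K m (inc (h / real m) \<omega>)) \<longlonglongrightarrow> gnpoly m 0 \<omega>"
        using poly_tendsto[OF elim, of m 0] by (simp add: gnpoly_def)
      then have "(\<lambda>K. poly (K + n) m (inc (h / real m) \<omega>)) \<longlonglongrightarrow> gnpoly m 0 \<omega>" by (rule LIMSEQ_ignore_initial_segment)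
      then show ?case using continuous_on_tendsto_compose[OF \<Psi>] by auto
    qed
  qed
  have lim2: "(\<lambda>m. \<integral>\<^sup>+\<omega>. ennreal (g (\<Psi> (gnpoly (Suc m) 0 \<omega>))) \<partial>P) \<longlonglongrightarrow> (\<integral>\<^sup>+\<omega>. ennreal (g (\<Psi> (path 0 \<omega>))) \<partial>P)"
    if \<Psi>: "continuous_on UNIV \<Psi>" for \<Psi> :: "(real \<Rightarrow>\<^sub>C 'a) \<Rightarrow> 'c"
  proof (rule nn_integral_test_tendsto[OF _ _ _ g])
    show "(\<lambda>\<omega>. \<Psi> (gnpoly (Suc m) 0 \<omega>)) \<in> borel_measurable P" for m by (intro meas \<Psi> gnpoly_measurable) simp
    show "(\<lambda>\<omega>. \<Psi> (path 0 \<omega>)) \<in> borel_measurable P" by (intro meas \<Psi> path_measurable)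
    show "AE \<omega> in P. (\<lambda>m. \<Psi> (gnpoly (Suc m) 0 \<omega>)) \<longlonglongrightarrow> \<Psi> (path 0 \<omega>)"
      using good(2)
    proof eventually_elim
      case (elim \<omega>)
      then have "(\<lambda>m. gnpoly (Suc m) 0 \<omega>) \<longlonglongrightarrow> path 0 \<omega>" by (simp add: gnpoly_def npoly_tendsto)
      then show ?case using continuous_on_tendsto_compose[OF \<Psi>] by auto
    qed
  qed
  have "(\<integral>\<^sup>+\<omega>. ennreal (g (\<Psi> (gnpoly m 0 \<omega>))) \<partial>P) = (\<integral>\<^sup>+\<omega>. ennreal (g (\<Xi> (gnpoly m 0 \<omega>))) \<partial>P)" if m: "0 < m" for m
    using lim1[OF \<Psi>\<Xi>(1) m] lim1[OF \<Psi>\<Xi>(2) m] eq[OF m] by (simp add: LIMSEQ_unique)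
  then show ?thesis using lim2[OF \<Psi>\<Xi>(1)] lim2[OF \<Psi>\<Xi>(2)] by (simp add: LIMSEQ_unique)
qed

lemma refl_path_continuous: "continuous_on UNIV (refl_path z)"
  unfolding continuous_on_def refl_path_def by (auto intro!: skew_path_tendsto)

lemma refl_path_measurable: "(\<lambda>\<omega>. refl_path z (path 0 \<omega>)) \<in> borel_measurable P"
  by (rule measurable_compose[OF path_measurable borel_measurable_continuous_onI[OF refl_path_continuous]])

text \<open>This is what makes the reflected pair a coupling: with \<open>z\<close> frozen,
  reflected and original noise have the same law, so both marginals follow the transition
  kernel.\<close>

lemma kern_reflect:
  assumes z: "0 < cov_form z"
  shows "kern (\<lambda>\<omega>. refl_path z (path 0 \<omega>)) v = kern (path 0) v"
proof (rule borel_measure_eqI)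
  show "prob_space (kern (\<lambda>\<omega>. refl_path z (path 0 \<omega>)) v)" "prob_space (kern (path 0) v)"
    by (intro prob_space_kern path_measurable refl_path_measurable)+
  fix g :: "'a \<Rightarrow> real" assume g: "continuous_on UNIV g" "\<And>x. 0 \<le> g x \<and> g x \<le> 1"
  have gm: "(\<lambda>x. ennreal (g x)) \<in> borel_measurable borel"
    using borel_measurable_continuous_onI[OF g(1)] by simp
  have fc: "continuous_on UNIV (flow v)" by (intro flow_continuous continuous_intros)
  have "(\<integral>\<^sup>+\<omega>. ennreal (g (flow v (refl_path z (path 0 \<omega>)))) \<partial>P) = (\<integral>\<^sup>+\<omega>. ennreal (g (flow v (path 0 \<omega>))) \<partial>P)"
  proof (rule path_test_eq[where \<Psi>="\<lambda>w. flow v (refl_path z w)" and \<Xi>="flow v", OF _ fc g])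
    show "continuous_on UNIV (\<lambda>w. flow v (refl_path z w))"
      by (intro flow_continuous refl_path_continuous continuous_intros)
    fix K m :: nat assume m: "0 < m" and K: "n \<le> K"
    let ?c = "\<lambda>k. (z \<bullet> e k) / (sqrt (lam k) * sqrt (cov_form z))"
    have F: "(\<lambda>a. ennreal (g (flow v (poly K m a)))) \<in> borel_measurable arrays"
      by (rule measurable_compose[OF poly_array_measurable])
         (rule measurable_compose[OF borel_measurable_continuous_onI[OF fc] gm])
    have "refl_path z (poly K m a) = poly K m (\<lambda>i. reflect_row n ?c (a i))" for a
      unfolding poly_def refl_path_def skew_path_polygon skew_vec(1)[OF z K] ..
    then show "(\<integral>\<^sup>+\<omega>. ennreal (g (flow v (refl_path z (poly K m (inc (h / real m) \<omega>))))) \<partial>P)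
        = (\<integral>\<^sup>+\<omega>. ennreal (g (flow v (poly K m (inc (h / real m) \<omega>)))) \<partial>P)"
      using nn_integral_inc_reflect[OF _ F skew_vec(2)[OF z K], of "h / real m"] h m by simp
  qed
  then show "(\<integral>\<^sup>+y. ennreal (g y) \<partial>kern (\<lambda>\<omega>. refl_path z (path 0 \<omega>)) v) = (\<integral>\<^sup>+y. ennreal (g y) \<partial>kern (path 0) v)"
    by (simp add: nn_integral_kern[OF refl_path_measurable gm] nn_integral_kern[OF path_measurable gm])
qed (auto simp: kern_def)

text \<open>Orthonormality extracts the individual Brownian motions from the series, and the inner
  product becomes a finite sum of independent centred Gaussians. Their variances
  \<open>s * (z \<bullet> e k)\<^sup>2 / lam k\<close> add up to
  \<open>s * cov_form z\<close>.\<close>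

lemma path_inner_distributed:
  assumes z: "0 < cov_form z" and s: "0 < s" "s \<le> h"
  shows "distributed P lborel (\<lambda>\<omega>. path 0 \<omega> s \<bullet> cov_inv z)
     (\<lambda>x. ennreal (normal_density 0 (sqrt (s * cov_form z)) x))"
proof -
  \<comment> \<open>Modes with coefficient zero are discarded because a degenerate Gaussian has no
    density; positivity of \<open>cov_form z\<close> keeps \<open>I\<close> nonempty.\<close>
  define I where "I = {k\<in>{..<n}. z \<bullet> e k \<noteq> 0}"
  define c where "c k = (z \<bullet> e k) / sqrt (lam k)" for k
  define Z where "Z k \<omega> = 0 + c k * (B k s \<omega> - B k 0 \<omega>)" for k \<omega>
  have I: "finite I" "I \<noteq> {}"
  proof -
    show "I \<noteq> {}"
    proof
      assume "I = {}"
      then have "cov_form z = 0" by (auto simp: cov_form_def I_def)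
      with z show False by simp
    qed
  qed (simp add: I_def)
  have c: "c k \<noteq> 0" if "k \<in> I" for k using that lam_pos[of k] by (auto simp: I_def c_def)
  have ind0: "indep_vars (\<lambda>_. borel) (\<lambda>k \<omega>. B k s \<omega> - B k 0 \<omega>) UNIV"
  proof -
    have "indep_vars (\<lambda>_. borel) (\<lambda>k \<omega>. (\<lambda>f. f s - f 0) (restrict (\<lambda>t. B k t \<omega>) {0..})) UNIV"
      by (rule indep_vars_compose2[OF paths_indep])
         (use s in \<open>auto intro!: borel_measurable_diff measurable_component_singleton\<close>)
    then show ?thesis using s by simp
  qed
  have indep: "indep_vars (\<lambda>_. borel) Z I"
    unfolding Z_def by (rule indep_vars_subset[OF indep_vars_compose2[OF ind0]]) auto
  have dZ: "distributed P lborel (Z k) (normal_density 0 (\<bar>c k\<bar> * sqrt s))" if k: "k \<in> I" for k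
  proof -
    have "distributed P lborel (\<lambda>\<omega>. B k s \<omega> - B k 0 \<omega>) (normal_density 0 (sqrt s))"
      using B_distributed[of 0 s k] s by simp
    from normal_density_affine[OF this, of "c k" 0] show ?thesis
      using c[OF k] s by (simp add: Z_def[abs_def])
  qed
  have "distributed P lborel (\<lambda>\<omega>. \<Sum>k\<in>I. Z k \<omega>) (normal_density (\<Sum>k\<in>I. 0) (sqrt (\<Sum>k\<in>I. (\<bar>c k\<bar> * sqrt s)\<^sup>2)))"
    using c s by (intro sum_indep_normal I indep dZ) auto
  moreover have "(\<Sum>k\<in>I. (\<bar>c k\<bar> * sqrt s)\<^sup>2) = s * cov_form z"
  proof -
    have "(\<Sum>k\<in>I. (\<bar>c k\<bar> * sqrt s)\<^sup>2) = (\<Sum>k\<in>I. s * ((z \<bullet> e k)\<^sup>2 / lam k))"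
      using s less_imp_le[OF lam_pos] by (intro sum.cong) (auto simp: c_def I_def power_mult_distrib power_divide)
    also have "\<dots> = (\<Sum>k<n. s * ((z \<bullet> e k)\<^sup>2 / lam k))" by (intro sum.mono_neutral_left) (auto simp: I_def)
    finally show ?thesis by (simp add: cov_form_def sum_distrib_left)
  qed
  ultimately have d: "distributed P lborel (\<lambda>\<omega>. \<Sum>k\<in>I. Z k \<omega>) (\<lambda>x. ennreal (normal_density 0 (sqrt (s * cov_form z)) x))" by simp
  have "AE \<omega> in P. path 0 \<omega> s \<bullet> cov_inv z = (\<Sum>k\<in>I. Z k \<omega>)"
    using good(2)
  proof eventually_elim
    case (elim \<omega>)
    have B0: "B k 0 \<omega> = 0" for k using good(3)[OF elim] by (simp add: solves_def)
    have ni: "noise s \<omega> \<bullet> e j = sqrt (lam j) * B j s \<omega>" for j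
    proof -
      have "(\<lambda>k. ((sqrt (lam k) * B k s \<omega>) *\<^sub>R e k) \<bullet> e j) sums (noise s \<omega> \<bullet> e j)"
        using noise_sums[OF elim, of s] s by (intro bounded_linear.sums[OF bounded_linear_inner_left]) auto
      moreover have "(\<lambda>k. ((sqrt (lam k) * B k s \<omega>) *\<^sub>R e k) \<bullet> e j) = (\<lambda>k. if k = j then sqrt (lam j) * B j s \<omega> else 0)"
        by (auto simp: orthonormal)
      ultimately show ?thesis using sums_single[of j "\<lambda>_. sqrt (lam j) * B j s \<omega>"] by (simp add: sums_unique2)
    qed
    have "path 0 \<omega> s \<bullet> cov_inv z = (\<Sum>k<n. (z \<bullet> e k) / lam k * (sqrt (lam k) * B k s \<omega>))"
      using apply_path[OF elim, of s 0] s by (simp add: noise_0[OF elim] inner_cov_inv ni)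
    also have "\<dots> = (\<Sum>k<n. c k * B k s \<omega>)"
    proof (intro sum.cong refl)
      fix k assume "k \<in> {..<n}"
      then have "0 < lam k" by (simp add: lam_pos)
      then have "sqrt (lam k) * sqrt (lam k) = lam k" "0 < sqrt (lam k)" by auto
      then show "(z \<bullet> e k) / lam k * (sqrt (lam k) * B k s \<omega>) = c k * B k s \<omega>" by (simp add: c_def field_simps)
    qed
    also have "\<dots> = (\<Sum>k\<in>I. c k * B k s \<omega>)" by (intro sum.mono_neutral_right) (auto simp: I_def c_def)
    finally show ?case by (simp add: Z_def B0)
  qed
  moreover have m: "(\<lambda>\<omega>. path 0 \<omega> s \<bullet> cov_inv z) \<in> borel_measurable P"
    by (rule measurable_compose[OF path_measurable borel_measurable_continuous_onI]) (intro continuous_intros eval_continuous)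
  moreover have m2: "(\<lambda>\<omega>. \<Sum>k\<in>I. Z k \<omega>) \<in> borel_measurable P" using distributed_measurable[OF d] by simp
  ultimately have "distr P lborel (\<lambda>\<omega>. path 0 \<omega> s \<bullet> cov_inv z) = distr P lborel (\<lambda>\<omega>. \<Sum>k\<in>I. Z k \<omega>)"
    by (intro distr_cong_AE) auto
  then show ?thesis using d m unfolding distributed_def by simp
qed

text \<open>At each time the mean absolute value is at most the standard deviation. Integrating over
  the step gives order \<open>h * sqrt h\<close>, so the noise inside the drift is of higher order
  than the drift itself.\<close>

lemma path_time_integral:
  assumes z: "0 < cov_form z"
  shows "(\<integral>\<^sup>+\<omega>. ennreal (integral {0..h} (\<lambda>s. \<bar>path 0 \<omega> s \<bullet> cov_inv z\<bar>)) \<partial>P) \<le> ennreal (h * sqrt (h * cov_form z))"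
    and "(\<lambda>\<omega>. integral {0..h} (\<lambda>s. \<bar>path 0 \<omega> s \<bullet> cov_inv z\<bar>)) \<in> borel_measurable P"
proof -
  let ?f = "\<lambda>s \<omega>. ennreal \<bar>path 0 \<omega> s \<bullet> cov_inv z\<bar> * indicator {0..h} s"
  have eq: "ennreal (integral {0..h} (\<lambda>s. \<bar>path 0 \<omega> s \<bullet> cov_inv z\<bar>)) = (\<integral>\<^sup>+s. ?f s \<omega> \<partial>lborel)" for \<omega>
  proof -
    have c: "continuous_on {0..h} (\<lambda>s. \<bar>path 0 \<omega> s \<bullet> cov_inv z\<bar>)" by (intro continuous_intros) auto
    then have "((\<lambda>s. \<bar>path 0 \<omega> s \<bullet> cov_inv z\<bar>) has_integral integral {0..h} (\<lambda>s. \<bar>path 0 \<omega> s \<bullet> cov_inv z\<bar>)) {0..h}"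
      by (intro integrable_integral integrable_continuous_interval)
    then have "((\<lambda>s. indicator {0..h} s *\<^sub>R \<bar>path 0 \<omega> s \<bullet> cov_inv z\<bar>) has_integral integral {0..h} (\<lambda>s. \<bar>path 0 \<omega> s \<bullet> cov_inv z\<bar>)) UNIV"
    proof -
      assume *: "((\<lambda>s. \<bar>path 0 \<omega> s \<bullet> cov_inv z\<bar>) has_integral integral {0..h} (\<lambda>s. \<bar>path 0 \<omega> s \<bullet> cov_inv z\<bar>)) {0..h}"
      have "(\<lambda>s. indicator {0..h} s *\<^sub>R \<bar>path 0 \<omega> s \<bullet> cov_inv z\<bar>) = (\<lambda>s. if s \<in> {0..h} then \<bar>path 0 \<omega> s \<bullet> cov_inv z\<bar> else 0)"
        by auto
      then show ?thesis using * by (simp only: has_integral_restrict_UNIV)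
    qed
    moreover have [measurable]: "(\<lambda>s. \<bar>path 0 \<omega> s \<bullet> cov_inv z\<bar>) \<in> borel_measurable borel"
      by (intro borel_measurable_continuous_onI continuous_intros) auto
    have "(\<lambda>s. indicator {0..h} s *\<^sub>R \<bar>path 0 \<omega> s \<bullet> cov_inv z\<bar>) \<in> borel_measurable borel" by measurable
    ultimately have "(\<integral>\<^sup>+s. ennreal (indicator {0..h} s *\<^sub>R \<bar>path 0 \<omega> s \<bullet> cov_inv z\<bar>) \<partial>lborel) = ennreal (integral {0..h} (\<lambda>s. \<bar>path 0 \<omega> s \<bullet> cov_inv z\<bar>))"
      by (intro nn_integral_has_integral_lborel) auto
    moreover have "ennreal (indicator {0..h} s *\<^sub>R \<bar>path 0 \<omega> s \<bullet> cov_inv z\<bar>) = ?f s \<omega>" for s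
      by (cases "s \<in> {0..h}") auto
    ultimately show ?thesis by simp
  qed
  have m: "(\<lambda>(s, \<omega>). ?f s \<omega>) \<in> borel_measurable (lborel \<Otimes>\<^sub>M P)"
  proof -
    have [measurable]: "(\<lambda>y. ennreal \<bar>path 0 (snd y) (fst y) \<bullet> cov_inv z\<bar>) \<in> borel_measurable (lborel \<Otimes>\<^sub>M P)"
      by (rule measurable_compose[OF borel_measurable_abs[OF evaluation_measurable[OF path_measurable]] measurable_ennreal])
    have [measurable]: "(\<lambda>y. indicator {0..h} (fst y) :: ennreal) \<in> borel_measurable (lborel \<Otimes>\<^sub>M P)" by measurable
    show ?thesis unfolding case_prod_beta' by measurable
  qed
  interpret LP: pair_sigma_finite lborel P by unfold_locales
  have "(\<integral>\<^sup>+\<omega>. ennreal (integral {0..h} (\<lambda>s. \<bar>path 0 \<omega> s \<bullet> cov_inv z\<bar>)) \<partial>P) = (\<integral>\<^sup>+s. \<integral>\<^sup>+\<omega>. ?f s \<omega> \<partial>P \<partial>lborel)"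
    unfolding eq by (rule LP.Fubini'[OF m])
  also have "\<dots> \<le> (\<integral>\<^sup>+s. ennreal (sqrt (h * cov_form z)) * indicator {0..h} s \<partial>lborel)"
  proof (rule nn_integral_mono)
    fix s :: real
    show "(\<integral>\<^sup>+\<omega>. ?f s \<omega> \<partial>P) \<le> ennreal (sqrt (h * cov_form z)) * indicator {0..h} s"
    proof (cases "s \<in> {0..h}")
      case True
      show ?thesis
      \<comment> \<open>The Gaussian density degenerates at time 0, where the path vanishes.\<close>
      proof (cases "s = 0")
        case True
        have "path 0 \<omega> 0 = 0" for \<omega>
          using apply_path[of \<omega> 0 0] h by (cases "\<omega> \<in> good") (auto simp: path_def)
        then show ?thesis using True by simp
      next
        case False
        then have s: "0 < s" "s \<le> h" using True by auto
        have \<sigma>: "0 < sqrt (s * cov_form z)" using s z by simp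
        note mom = normal_moments[OF path_inner_distributed[OF z s] \<sigma>]
        have "(\<integral>\<^sup>+\<omega>. ennreal \<bar>path 0 \<omega> s \<bullet> cov_inv z\<bar> \<partial>P) = ennreal (\<integral>\<omega>. \<bar>path 0 \<omega> s \<bullet> cov_inv z\<bar> \<partial>P)"
          using mom(5) by (intro nn_integral_eq_integral) auto
        also have "\<dots> \<le> ennreal (sqrt (h * cov_form z))"
          using mom(6) s z by (intro ennreal_leI order_trans[OF mom(6)]) auto
        finally show ?thesis using True by simp
      qed
    qed simp
  qed
  also have "\<dots> = ennreal (sqrt (h * cov_form z)) * ennreal h"
    using h by (simp add: nn_integral_cmult_indicator)
  also have "\<dots> = ennreal (h * sqrt (h * cov_form z))" using h z by (simp add: ennreal_mult[symmetric] mult.commute)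
  finally show "(\<integral>\<^sup>+\<omega>. ennreal (integral {0..h} (\<lambda>s. \<bar>path 0 \<omega> s \<bullet> cov_inv z\<bar>)) \<partial>P) \<le> ennreal (h * sqrt (h * cov_form z))" .
  have "(\<lambda>\<omega>. \<integral>\<^sup>+s. ?f s \<omega> \<partial>lborel) \<in> borel_measurable P"
    using lborel.borel_measurable_nn_integral[of "\<lambda>\<omega> s. ?f s \<omega>" P] m
    by (simp add: measurable_pair_swap_iff[of _ lborel P] case_prod_beta')
  then have "(\<lambda>\<omega>. enn2real (ennreal (integral {0..h} (\<lambda>s. \<bar>path 0 \<omega> s \<bullet> cov_inv z\<bar>)))) \<in> borel_measurable P"
    unfolding eq by simp
  moreover have "0 \<le> integral {0..h} (\<lambda>s. \<bar>path 0 \<omega> s \<bullet> cov_inv z\<bar>)" for \<omega>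
    by (intro Henstock_Kurzweil_Integration.integral_nonneg integrable_continuous_interval continuous_intros) auto
  ultimately show "(\<lambda>\<omega>. integral {0..h} (\<lambda>s. \<bar>path 0 \<omega> s \<bullet> cov_inv z\<bar>)) \<in> borel_measurable P" by simp
qed

end

section \<open>Pathwise estimates\<close>

locale low_modes =
  fixes e :: "nat \<Rightarrow> 'a::real_inner" and n :: nat
  assumes orthonormal_basis_vectors: "\<And>i j. e i \<bullet> e j = (if i = j then 1 else 0)"
begin

abbreviation "low \<equiv> low_proj e n"
abbreviation "high \<equiv> high_proj e n"

lemma low_add: "low (x + y) = low x + low y"
  by (simp add: low_proj_def inner_add_left scaleR_add_left sum.distrib)

lemma low_scaleR: "low (c *\<^sub>R x) = c *\<^sub>R low x"
  by (simp add: low_proj_def scaleR_sum_right)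

lemma low_inner: "low x \<bullet> e k = (if k < n then x \<bullet> e k else 0)"
proof -
  have "low x \<bullet> e k = (\<Sum>j<n. if j = k then x \<bullet> e j else 0)"
    by (simp add: low_proj_def inner_sum_left orthonormal_basis_vectors if_distrib cong: if_cong)
  then show ?thesis by simp
qed

lemma low_norm2: "(norm (low x))\<^sup>2 = (\<Sum>k<n. (x \<bullet> e k)\<^sup>2)"
proof -
  have "(norm (low x))\<^sup>2 = low x \<bullet> low x" by (simp add: power2_norm_eq_inner)
  also have "\<dots> = (\<Sum>k<n. (x \<bullet> e k) * (low x \<bullet> e k))" by (subst (2) low_proj_def) (simp add: inner_sum_right)
  also have "\<dots> = (\<Sum>k<n. (x \<bullet> e k)\<^sup>2)" by (intro sum.cong) (auto simp: low_inner power2_eq_square)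
  finally show ?thesis .
qed

lemma norm_split: "(norm x)\<^sup>2 = (norm (low x))\<^sup>2 + (norm (high x))\<^sup>2"
proof -
  have "low x \<bullet> x = (\<Sum>k<n. (x \<bullet> e k)\<^sup>2)"
    by (simp add: low_proj_def inner_sum_left power2_eq_square inner_commute[of "e _" x])
  then have "low x \<bullet> high x = 0"
    by (simp add: high_proj_def inner_diff_right low_norm2[symmetric] power2_norm_eq_inner)
  then have "low x \<bullet> high x = 0" "high x \<bullet> low x = 0" by (simp_all add: inner_commute)
  moreover have "x = low x + high x" by (simp add: high_proj_def)
  ultimately show ?thesis
    by (metis (no_types, lifting) add.commute add.right_neutral inner_add_left inner_add_right power2_norm_eq_inner)
qed

lemma low_norm_le: "norm (low x) \<le> norm x"
proof (rule power2_le_imp_le)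
  show "(norm (low x))\<^sup>2 \<le> (norm x)\<^sup>2" using norm_split[of x] by simp
qed simp

lemma high_norm_le: "norm (high x) \<le> norm x"
proof (rule power2_le_imp_le)
  show "(norm (high x))\<^sup>2 \<le> (norm x)\<^sup>2" using norm_split[of x] by simp
qed simp

lemma bounded_linear_low: "bounded_linear low"
  by (rule bounded_linear_intro[where K=1]) (auto simp: low_add low_scaleR low_norm_le)

lemma bounded_linear_high: "bounded_linear high"
  unfolding high_proj_def[abs_def] by (intro bounded_linear_sub bounded_linear_ident bounded_linear_low)

lemmas low_diff = linear_diff[OF bounded_linear.linear[OF bounded_linear_low]]
lemmas high_diff = linear_diff[OF bounded_linear.linear[OF bounded_linear_high]]
lemmas high_add = linear_add[OF bounded_linear.linear[OF bounded_linear_high]]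
lemmas high_scaleR = linear_scale[OF bounded_linear.linear[OF bounded_linear_high]]

lemma low_low: "low (low x) = low x"
  by (subst (1 3) low_proj_def) (simp add: low_inner)

lemma high_low: "high (low x) = 0" by (simp add: high_proj_def low_low)

end

section \<open>The weighted norm\<close>

locale alpha_normed = low_modes e n for e :: "nat \<Rightarrow> 'a::real_inner" and n +
  fixes \<alpha> :: real
  assumes alpha: "1 \<le> \<alpha>"
begin

abbreviation "an \<equiv> alpha_norm e n \<alpha>"

lemma an_nonneg: "0 \<le> an x" using alpha by (simp add: alpha_norm_def)

lemma an_triangle: "an (x + y) \<le> an x + an y"
proof -
  have "\<alpha> * norm (high x + high y) \<le> \<alpha> * (norm (high x) + norm (high y))"
    using alpha by (intro mult_left_mono norm_triangle_ineq) auto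
  then show ?thesis unfolding alpha_norm_def low_add high_add
    using norm_triangle_ineq[of "low x" "low y"] by (simp add: distrib_left)
qed

lemma an_scaleR: "an (c *\<^sub>R x) = \<bar>c\<bar> * an x"
  by (simp add: alpha_norm_def low_scaleR high_scaleR algebra_simps)

lemma an_minus: "an (- x) = an x" using an_scaleR[of "-1" x] by simp

lemma an_commute: "an (x - y) = an (y - x)" using an_minus[of "x - y"] by simp

lemma norm_le_an: "norm x \<le> an x"
proof -
  have "norm x \<le> norm (low x) + norm (high x)"
    using norm_triangle_ineq[of "low x" "high x"] by (simp add: high_proj_def)
  moreover have "norm (high x) \<le> \<alpha> * norm (high x)" using alpha by (simp add: mult_le_cancel_right1)
  ultimately show ?thesis by (simp add: alpha_norm_def)
qed

lemma an_le_norm: "an x \<le> (1 + \<alpha>) * norm x"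
proof -
  have "\<alpha> * norm (high x) \<le> \<alpha> * norm x" using alpha high_norm_le[of x] by (intro mult_left_mono) auto
  then show ?thesis using low_norm_le[of x] by (simp add: alpha_norm_def distrib_right)
qed

lemma an_0: "an 0 = 0" using an_scaleR[of 0 0] by simp

lemma an_eq_0: "an x = 0 \<longleftrightarrow> x = 0"
  using norm_le_an[of x] an_0 by auto

lemma an_continuous: "continuous_on A an"
  unfolding alpha_norm_def[abs_def]
  by (intro continuous_intros linear_continuous_on bounded_linear_low bounded_linear_high)

lemma an_diff_le: "an x \<le> an y + (1 + \<alpha>) * norm (x - y)"
  using an_triangle[of y "x - y"] an_le_norm[of "x - y"] by simp

end

locale coupling_setting =
  reflection_setting b L h P B e lam X n + alpha_normed e n \<alpha> + contraction_profile \<beta> ls R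
  for b :: "'a::{real_inner,banach} \<Rightarrow> 'a" and L h :: real and P :: "'w measure" and B e lam X n \<alpha> \<beta> ls R +
  fixes Ll Lh Hl Hh Mc lmax :: real
  assumes cpos: "0 \<le> Hh" "0 \<le> Ll" "0 \<le> Lh" "0 \<le> Hl" "0 \<le> Mc" "Mc < 1"
    and alpha_eq: "Lh + \<alpha> * Hh = \<alpha> - 1" and beta_eq: "Ll + \<alpha> * Hl = \<beta> + 1"
    and A1_high: "\<And>x y. norm (high_proj e n (b x) - high_proj e n (b y))
                    \<le> Hl * norm (low_proj e n x - low_proj e n y) + Hh * norm (high_proj e n x - high_proj e n y)"
    and A1_low: "\<And>x y. norm (low_proj e n (b x) - low_proj e n (b y))
                    \<le> Ll * norm (low_proj e n x - low_proj e n y) + Lh * norm (high_proj e n x - high_proj e n y)"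
    and A3: "\<And>x y. R \<le> alpha_norm e n \<alpha> (x - y) \<Longrightarrow>
                    alpha_norm e n \<alpha> (b x - b y) \<le> Mc * alpha_norm e n \<alpha> (x - y)"
    and ls_le: "\<And>k. k < n \<Longrightarrow> ls \<le> lam k" and lam_le: "\<And>k. k < n \<Longrightarrow> lam k \<le> lmax"
begin

text \<open>Here the choice of \<alpha> acts. Together with the linear term of the drift, the low
  part contributes at most \<beta> times its norm to the growth of the weighted distance, and the
  high part contributes -1 times its norm.\<close>

lemma b_an_le:
  "an (b x - b y) \<le> (\<beta> + 1) * norm (low (x - y)) + (\<alpha> - 1) * norm (high (x - y))"
proof -
  have "an (b x - b y) \<le> (Ll * norm (low (x - y)) + Lh * norm (high (x - y)))
      + \<alpha> * (Hl * norm (low (x - y)) + Hh * norm (high (x - y)))"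
    unfolding alpha_norm_def low_diff high_diff using A1_low[of x y] A1_high[of x y] alpha
    by (intro add_mono mult_left_mono) auto
  also have "\<dots> = (Ll + \<alpha> * Hl) * norm (low (x - y)) + (Lh + \<alpha> * Hh) * norm (high (x - y))"
    by (simp add: algebra_simps)
  finally show ?thesis by (simp add: alpha_eq beta_eq)
qed

text \<open>By Lipschitz continuity the contraction at large distances persists, up to an error, slightly below distance \<open>R\<close>.\<close>

lemma b_an_large:
  "an (b x - b y) \<le> Mc * an (x - y) + (Mc + (1 + \<alpha>) * L) * max 0 (R - an (x - y))"
proof -
  let ?r = "an (x - y)"
  consider "R \<le> ?r" | "?r = 0" | "0 < ?r" "?r < R" using an_nonneg[of "x - y"] by linarith
  then show ?thesis
  proof cases
    case 1 then show ?thesis using A3[of x y] by simp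
  next
    case 2
    then have "x = y" using an_eq_0[of "x - y"] by simp
    then show ?thesis using cpos alpha L R by (simp add: an_0)
  next
    case 3
    \<comment> \<open>The point at distance exactly \<open>R\<close> from \<open>x\<close> on the
      ray through \<open>y\<close>: (A3) applies to the pair \<open>x, y'\<close>, and the Lipschitz
      bound to the remaining segment of length \<open>R - ?r\<close>.\<close>
    define y' where "y' = x - (R / ?r) *\<^sub>R (x - y)"
    have "an (x - y') = R" using 3 R by (simp add: y'_def an_scaleR)
    then have 1: "an (b x - b y') \<le> Mc * R" using A3[of x y'] by simp
    have "y - y' = (R / ?r - 1) *\<^sub>R (x - y)" by (simp add: y'_def algebra_simps)
    then have "an (y - y') = \<bar>R / ?r - 1\<bar> * ?r" by (simp add: an_scaleR)
    also have "\<dots> = R - ?r" using 3 by (simp add: field_simps)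
    finally have "norm (y' - y) \<le> R - ?r" using norm_le_an[of "y - y'"] by (simp add: norm_minus_commute)
    then have "norm (b y' - b y) \<le> L * (R - ?r)" using b_lip[of y' y] L mult_left_mono by (metis order_trans)
    then have "(1 + \<alpha>) * norm (b y' - b y) \<le> (1 + \<alpha>) * (L * (R - ?r))" using alpha by (intro mult_left_mono) auto
    then have "an (b y' - b y) \<le> (1 + \<alpha>) * L * (R - ?r)" using an_le_norm[of "b y' - b y"] by simp
    moreover have "an (b x - b y) \<le> an (b x - b y') + an (b y' - b y)" using an_triangle[of "b x - b y'" "b y' - b y"] by simp
    ultimately show ?thesis using 1 3 by (simp add: algebra_simps)
  qed
qed

section \<open>Two solutions whose noises differ by a multiple of the low part of the initial
  difference\<close>

context
  fixes x y :: 'a and w w' :: "real \<Rightarrow>\<^sub>C 'a" and \<nu> :: "real \<Rightarrow> real"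
  assumes \<nu>: "continuous_on {0..h} \<nu>"
    and ww: "\<And>s. s \<in> {0..h} \<Longrightarrow> sqrt 2 *\<^sub>R (w s - w' s) = \<nu> s *\<^sub>R low (x - y)"
begin

definition Z :: "real \<Rightarrow> 'a" where "Z s = sol x w s - sol y w' s"
text \<open>The time-integrated deviation of the difference process from its initial value. It
  collects all errors of freezing that difference in the drift during the step.\<close>

definition J :: real where "J = integral {0..h} (\<lambda>s. norm (Z s - (x - y)))"

lemma Z_cont: "continuous_on A Z" unfolding Z_def[abs_def] by (intro continuous_intros) auto

lemma Z_eq:
  assumes "s \<in> {0..h}"
  shows "Z s = (x - y) + integral {0..s} (\<lambda>r. D (sol x w r) - D (sol y w' r)) + \<nu> s *\<^sub>R low (x - y)"
proof -
  have "integral {0..s} (\<lambda>r. D (sol x w r) - D (sol y w' r)) = integral {0..s} (\<lambda>r. D (sol x w r)) - integral {0..s} (\<lambda>r. D (sol y w' r))"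
    by (intro integral_diff D_comp_integrable) auto
  then show ?thesis
    unfolding Z_def using sol_eq[OF assms, of x w] sol_eq[OF assms, of y w'] ww[OF assms]
    by (simp add: scaleR_diff_right)
qed

lemma V_integrable: "(\<lambda>s. norm (Z s - (x - y))) integrable_on {0..s}"
  by (intro integrable_continuous_interval continuous_intros Z_cont)

lemma J_nonneg: "0 \<le> J"
  unfolding J_def by (intro Henstock_Kurzweil_Integration.integral_nonneg V_integrable) auto

text \<open>A Gronwall argument in integrated form: \<open>J\<close> reappears on the right with the
  factor \<open>(1 + L) * h\<close>, at most \<open>1/2\<close>, and is absorbed on the
  left.\<close>

lemma J_bound: "J \<le> 2 * (1 + L) * h\<^sup>2 * norm (x - y) + 2 * norm (low (x - y)) * integral {0..h} (\<lambda>s. \<bar>\<nu> s\<bar>)"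
proof -
  let ?z = "x - y"
  have V: "norm (Z s - ?z) \<le> (1 + L) * (h * norm ?z + J) + \<bar>\<nu> s\<bar> * norm (low ?z)" if s: "s \<in> {0..h}" for s
  proof -
    have "norm (integral {0..s} (\<lambda>r. D (sol x w r) - D (sol y w' r))) \<le> integral {0..s} (\<lambda>r. (1 + L) * (norm ?z + norm (Z r - ?z)))"
    proof (rule integral_norm_bound_integral)
      show "(\<lambda>r. D (sol x w r) - D (sol y w' r)) integrable_on {0..s}" by (intro integrable_diff D_comp_integrable) auto
      show "(\<lambda>r. (1 + L) * (norm ?z + norm (Z r - ?z))) integrable_on {0..s}"
        by (intro integrable_continuous_interval continuous_intros Z_cont)
      fix r assume "r \<in> {0..s}"
      have "norm (Z r) \<le> norm ?z + norm (Z r - ?z)" using norm_triangle_ineq[of ?z "Z r - ?z"] by simp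
      then show "norm (D (sol x w r) - D (sol y w' r)) \<le> (1 + L) * (norm ?z + norm (Z r - ?z))"
        using D_lip[of "sol x w r" "sol y w' r"] L by (smt (verit) Z_def mult_left_mono)
    qed
    also have "\<dots> \<le> integral {0..h} (\<lambda>r. (1 + L) * (norm ?z + norm (Z r - ?z)))"
      using s L by (intro integral_subset_le integrable_continuous_interval continuous_intros Z_cont) auto
    also have "\<dots> = (1 + L) * (h * norm ?z + J)"
    proof -
      have "integral {0..h} (\<lambda>r. norm ?z + norm (Z r - ?z)) = integral {0..h} (\<lambda>r. norm ?z) + J"
        unfolding J_def by (intro Henstock_Kurzweil_Integration.integral_add V_integrable) auto
      then show ?thesis using h by simp
    qed
    finally have "norm (integral {0..s} (\<lambda>r. D (sol x w r) - D (sol y w' r))) \<le> (1 + L) * (h * norm ?z + J)" .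
    moreover have "Z s - ?z = integral {0..s} (\<lambda>r. D (sol x w r) - D (sol y w' r)) + \<nu> s *\<^sub>R low ?z"
      using Z_eq[OF s] by simp
    ultimately show ?thesis
      using norm_triangle_ineq[of "integral {0..s} (\<lambda>r. D (sol x w r) - D (sol y w' r))" "\<nu> s *\<^sub>R low ?z"] by simp
  qed
  have "J \<le> integral {0..h} (\<lambda>s. (1 + L) * (h * norm ?z + J) + \<bar>\<nu> s\<bar> * norm (low ?z))"
    unfolding J_def
  proof (rule integral_le[OF V_integrable])
    show "(\<lambda>s. (1 + L) * (h * norm ?z + integral {0..h} (\<lambda>s. norm (Z s - ?z))) + \<bar>\<nu> s\<bar> * norm (low ?z)) integrable_on {0..h}"
      by (intro integrable_continuous_interval continuous_intros \<nu>)
  qed (use V in \<open>simp add: J_def\<close>)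
  also have "\<dots> = h * ((1 + L) * (h * norm ?z + J)) + norm (low ?z) * integral {0..h} (\<lambda>s. \<bar>\<nu> s\<bar>)"
  proof -
    have "integral {0..h} (\<lambda>s. (1 + L) * (h * norm ?z + J) + \<bar>\<nu> s\<bar> * norm (low ?z))
      = integral {0..h} (\<lambda>s. (1 + L) * (h * norm ?z + J)) + integral {0..h} (\<lambda>s. \<bar>\<nu> s\<bar> * norm (low ?z))"
      by (intro Henstock_Kurzweil_Integration.integral_add integrable_continuous_interval continuous_intros \<nu>)
    then show ?thesis using h by (simp add: mult.commute)
  qed
  also have "h * ((1 + L) * (h * norm ?z + J)) = (1 + L) * h\<^sup>2 * norm ?z + ((1 + L) * h) * J"
    by (simp add: algebra_simps power2_eq_square)
  also have "((1 + L) * h) * J \<le> 1/2 * J" using Lh J_nonneg by (intro mult_right_mono) auto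
  finally have "J \<le> (1 + L) * h\<^sup>2 * norm ?z + 1/2 * J + norm (low ?z) * integral {0..h} (\<lambda>s. \<bar>\<nu> s\<bar>)" by simp
  moreover have "2 * (1 + L) * h\<^sup>2 * norm ?z = 2 * ((1 + L) * h\<^sup>2 * norm ?z)"
    "2 * norm (low ?z) * integral {0..h} (\<lambda>s. \<bar>\<nu> s\<bar>) = 2 * (norm (low ?z) * integral {0..h} (\<lambda>s. \<bar>\<nu> s\<bar>))"
    by simp_all
  ultimately show ?thesis by linarith
qed

text \<open>The linear part of the drift and the noise act exactly: the low part of the initial
  difference is multiplied by \<open>1 - h + \<nu> h\<close> and the high part by
  \<open>1 - h\<close>. Only the nonlinear drift is estimated, with its leading bound
  \<open>A\<close> at the initial difference and a multiple of \<open>J\<close> as error.\<close>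

lemma end_bound:
  assumes A: "\<And>s. s \<in> {0..h} \<Longrightarrow> an (b (sol x w s) - b (sol y w' s)) \<le> A + C * norm (Z s - (x - y))" and h1: "h \<le> 1"
  shows "an (flow x w - flow y w') \<le> \<bar>1 - h + \<nu> h\<bar> * norm (low (x - y)) + \<alpha> * (1 - h) * norm (high (x - y))
     + h * A + (1 + \<alpha> + C) * J"
proof -
  let ?z = "x - y"
  let ?b = "\<lambda>s. b (sol x w s) - b (sol y w' s)"
  let ?I = "integral {0..h} (\<lambda>s. Z s - ?z)" and ?Ib = "integral {0..h} ?b"
  have bint: "?b integrable_on {0..h}"
    by (intro integrable_continuous_interval continuous_intros continuous_on_compose2[OF b_cont[of UNIV]]) auto
  have bc: "continuous_on {0..h} ?b" by (intro continuous_intros continuous_on_compose2[OF b_cont[of UNIV]]) auto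
  \<comment> \<open>The difference process is split into its initial value, which yields the factor
    \<open>1 - h\<close>, and the deviation measured by \<open>J\<close>.\<close>
  have "integral {0..h} (\<lambda>r. D (sol x w r) - D (sol y w' r)) = integral {0..h} (\<lambda>r. ?b r - (Z r - ?z) - ?z)"
    by (intro Henstock_Kurzweil_Integration.integral_cong) (simp add: D_def Z_def)
  also have "\<dots> = integral {0..h} (\<lambda>r. ?b r - (Z r - ?z)) - integral {0..h} (\<lambda>r. ?z)"
    by (intro integral_diff integrable_diff bint integrable_continuous_interval continuous_intros Z_cont)
  also have "integral {0..h} (\<lambda>r. ?b r - (Z r - ?z)) = ?Ib - ?I"
    by (intro integral_diff bint integrable_continuous_interval continuous_intros Z_cont)
  finally have "integral {0..h} (\<lambda>r. D (sol x w r) - D (sol y w' r)) = ?Ib - ?I - h *\<^sub>R ?z" using h by simp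
  then have "Z h = ?z - h *\<^sub>R ?z + \<nu> h *\<^sub>R low ?z + (?Ib - ?I)"
    using Z_eq[of h] h by simp
  then have Zh: "Z h = (1 - h) *\<^sub>R ?z + \<nu> h *\<^sub>R low ?z + (?Ib - ?I)" by (simp add: scaleR_diff_left)
  have nI: "norm ?I \<le> J"
    unfolding J_def by (intro integral_norm_bound_integral V_integrable integrable_continuous_interval continuous_intros Z_cont) auto
  have lc: "continuous_on {0..h} (\<lambda>s. low (?b s))" and hc: "continuous_on {0..h} (\<lambda>s. high (?b s))"
    by (rule continuous_on_compose2[OF linear_continuous_on[OF bounded_linear_low, of UNIV] bc], simp)
       (rule continuous_on_compose2[OF linear_continuous_on[OF bounded_linear_high, of UNIV] bc], simp)
  note ci = integrable_continuous_interval[OF continuous_on_norm[OF lc]] integrable_continuous_interval[OF continuous_on_norm[OF hc]]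
  have lb: "norm (low ?Ib) \<le> integral {0..h} (\<lambda>s. norm (low (?b s)))"
    using integral_linear[OF bint bounded_linear_low]
      integral_norm_bound_integral[OF integrable_continuous_interval[OF lc] ci(1)] by (simp add: comp_def)
  have hb: "norm (high ?Ib) \<le> integral {0..h} (\<lambda>s. norm (high (?b s)))"
    using integral_linear[OF bint bounded_linear_high]
      integral_norm_bound_integral[OF integrable_continuous_interval[OF hc] ci(2)] by (simp add: comp_def)
  have "an ?Ib \<le> integral {0..h} (\<lambda>s. norm (low (?b s))) + \<alpha> * integral {0..h} (\<lambda>s. norm (high (?b s)))"
    unfolding alpha_norm_def using lb hb alpha by (intro add_mono mult_left_mono) auto
  also have "\<dots> = integral {0..h} (\<lambda>s. an (?b s))"
    unfolding alpha_norm_def integral_mult_right[symmetric]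
    by (intro Henstock_Kurzweil_Integration.integral_add[symmetric] integrable_continuous_interval
        continuous_on_mult_left continuous_on_norm lc hc)
  also have "\<dots> \<le> integral {0..h} (\<lambda>s. A + C * norm (Z s - ?z))"
    using A by (intro integral_le integrable_continuous_interval continuous_on_compose2[OF an_continuous[of UNIV] bc] continuous_intros Z_cont) auto
  also have "\<dots> = integral {0..h} (\<lambda>s. A) + C * J"
    unfolding J_def integral_mult_right[symmetric]
    by (intro Henstock_Kurzweil_Integration.integral_add integrable_continuous_interval continuous_intros Z_cont)
  also have "integral {0..h} (\<lambda>s. A) = h * A" using h by simp
  finally have anb: "an ?Ib \<le> h * A + C * J" .
  have anI: "an ?I \<le> (1 + \<alpha>) * J" using an_le_norm[of ?I] nI alpha by (meson add_nonneg_nonneg le_numeral_extra(1) mult_left_mono order_trans zero_le_one)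
  let ?a = "(1 - h) *\<^sub>R ?z + \<nu> h *\<^sub>R low ?z"
  have "low ?a = (1 - h + \<nu> h) *\<^sub>R low ?z" by (simp add: low_add low_scaleR low_low scaleR_add_left)
  moreover have "high ?a = (1 - h) *\<^sub>R high ?z" by (simp add: high_add high_scaleR high_low)
  ultimately have ana: "an ?a = \<bar>1 - h + \<nu> h\<bar> * norm (low ?z) + \<alpha> * (1 - h) * norm (high ?z)"
    using h1 by (simp add: alpha_norm_def)
  have "an (Z h) \<le> an ?a + an (?Ib - ?I)" unfolding Zh by (rule an_triangle)
  also have "an (?Ib - ?I) \<le> an ?Ib + an ?I" using an_triangle[of ?Ib "- ?I"] by (simp add: an_minus)
  finally have "an (Z h) \<le> an ?a + (an ?Ib + an ?I)" by simp
  then have "an (Z h) \<le> an ?a + (h * A + C * J) + (1 + \<alpha>) * J" using anb anI by linarith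
  then show ?thesis unfolding ana by (simp add: Z_def flow_def distrib_right)
qed

lemma end_bound_A1:
  assumes h1: "h \<le> 1"
  shows "an (flow x w - flow y w') \<le> \<bar>1 - h + \<nu> h\<bar> * norm (low (x - y)) + \<alpha> * (1 - h) * norm (high (x - y))
     + h * ((\<beta> + 1) * norm (low (x - y)) + (\<alpha> - 1) * norm (high (x - y))) + (1 + 2 * \<alpha> + \<beta>) * J"
proof -
  have "an (b (sol x w s) - b (sol y w' s)) \<le> ((\<beta> + 1) * norm (low (x - y)) + (\<alpha> - 1) * norm (high (x - y)))
      + (\<alpha> + \<beta>) * norm (Z s - (x - y))" for s
  proof -
    let ?v = "norm (Z s - (x - y))"
    have "low (Z s) = low (x - y) + low (Z s - (x - y))" "high (Z s) = high (x - y) + high (Z s - (x - y))"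
      by (simp_all add: low_add[symmetric] high_add[symmetric])
    then have "norm (low (Z s)) \<le> norm (low (x - y)) + ?v" "norm (high (Z s)) \<le> norm (high (x - y)) + ?v"
      using norm_triangle_ineq[of "low (x - y)" "low (Z s - (x - y))"] low_norm_le[of "Z s - (x - y)"]
        norm_triangle_ineq[of "high (x - y)" "high (Z s - (x - y))"] high_norm_le[of "Z s - (x - y)"] by auto
    then have "(\<beta> + 1) * norm (low (Z s)) + (\<alpha> - 1) * norm (high (Z s))
       \<le> (\<beta> + 1) * (norm (low (x - y)) + ?v) + (\<alpha> - 1) * (norm (high (x - y)) + ?v)"
      using alpha beta by (intro add_mono mult_left_mono) auto
    then show ?thesis using b_an_le[of "sol x w s" "sol y w' s"] by (simp add: Z_def algebra_simps)
  qed
  from end_bound[OF this h1] show ?thesis by (simp add: algebra_simps)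
qed

text \<open>The difference may dip below \<open>R\<close> during the step. The near-\<open>R\<close>
  version of (A3) then costs a multiple of the gap, which \<eta> and the deviation control.\<close>

lemma end_bound_A3:
  assumes h1: "h \<le> 1" and r: "R - \<eta> \<le> an (x - y)" "0 \<le> \<eta>"
  defines "C \<equiv> Mc + (1 + \<alpha>) * L"
  shows "an (flow x w - flow y w') \<le> \<bar>1 - h + \<nu> h\<bar> * norm (low (x - y)) + \<alpha> * (1 - h) * norm (high (x - y))
     + h * (Mc * an (x - y) + C * \<eta>) + (1 + \<alpha> + (1 + \<alpha>) * (Mc + C)) * J"
proof -
  have C: "0 \<le> C" using cpos alpha L by (simp add: C_def)
  have "an (b (sol x w s) - b (sol y w' s)) \<le> (Mc * an (x - y) + C * \<eta>)
      + (1 + \<alpha>) * (Mc + C) * norm (Z s - (x - y))" for s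
  proof -
    let ?v = "norm (Z s - (x - y))"
    have 1: "an (Z s) \<le> an (x - y) + (1 + \<alpha>) * ?v" by (rule an_diff_le)
    have 2: "an (x - y) \<le> an (Z s) + (1 + \<alpha>) * ?v" using an_diff_le[of "x - y" "Z s"] by (simp add: norm_minus_commute)
    have "0 \<le> (1 + \<alpha>) * ?v" using alpha by simp
    then have "max 0 (R - an (Z s)) \<le> \<eta> + (1 + \<alpha>) * ?v" using r 2 by simp
    then have "Mc * an (Z s) + C * max 0 (R - an (Z s)) \<le> Mc * (an (x - y) + (1 + \<alpha>) * ?v) + C * (\<eta> + (1 + \<alpha>) * ?v)"
      using cpos C 1 by (intro add_mono mult_left_mono) auto
    then show ?thesis using b_an_large[of "sol x w s" "sol y w' s"] by (simp add: Z_def C_def algebra_simps)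
  qed
  from end_bound[OF this h1] show ?thesis by simp
qed

end

end

section \<open>One step of the coupling\<close>

lemma abs_sum_cube_le: "\<bar>u + v\<bar> ^ 3 \<le> 4 * \<bar>u\<bar> ^ 3 + 4 * \<bar>v :: real\<bar> ^ 3"
proof -
  have "\<bar>u + v\<bar> ^ 3 \<le> (\<bar>u\<bar> + \<bar>v\<bar>) ^ 3" by (intro power_mono) auto
  moreover have "4 * \<bar>u\<bar> ^ 3 + 4 * \<bar>v\<bar> ^ 3 - (\<bar>u\<bar> + \<bar>v\<bar>) ^ 3 = 3 * (\<bar>u\<bar> + \<bar>v\<bar>) * (\<bar>u\<bar> - \<bar>v\<bar>)\<^sup>2"
    by (simp add: power2_eq_square power3_eq_cube algebra_simps)
  moreover have "0 \<le> 3 * (\<bar>u\<bar> + \<bar>v\<bar>) * (\<bar>u\<bar> - \<bar>v\<bar>)\<^sup>2" by simp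
  ultimately show ?thesis by linarith
qed

context coupling_setting begin

abbreviation "c \<equiv> ctr_rate \<beta> ls R Mc \<alpha>"

text \<open>Each bound is consumed by one regime: large distance, small low part, and reflection, in
  this order.\<close>

lemma c_le: "c \<le> q * (1 - Mc)" "c \<le> q / (2 * \<alpha>)" "c \<le> 2 * ls * \<gamma>"
  by (auto simp: ctr_rate_def q_def)

lemma c_nonneg: "0 \<le> c"
  using q_pos cpos alpha ls gamma_pos by (simp add: ctr_rate_def q_def)

text \<open>Gains count with the smallest slope \<open>q\<close> and losses with the largest slope
  1. The crude slopes suffice for synchronous steps; only reflection needs the expansion of
  \<open>f\<close>.\<close>

lemma f_shift:
  assumes "0 \<le> a" "a \<le> r" "0 \<le> p" "0 \<le> \<rho>" "\<rho> \<le> r - a + p"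
  shows "f \<rho> \<le> f r - q * a + p"
proof -
  have "f \<rho> \<le> f (r - a + p)" using assms by (intro f_mono) auto
  also have "\<dots> \<le> f (r - a) + p" using f_increment_bounds(2)[of "r - a" "r - a + p"] assms by simp
  also have "f (r - a) \<le> f r - q * a" using f_increment_bounds(1)[of "r - a" r] assms by simp
  finally show ?thesis by simp
qed

lemma J_sync:
  "J x y w w \<le> 2 * (1 + L) * h\<^sup>2 * an (x - y)"
proof -
  have "J x y w w \<le> 2 * (1 + L) * h\<^sup>2 * norm (x - y) + 2 * norm (low (x - y)) * integral {0..h} (\<lambda>s. \<bar>0\<bar>)"
    by (rule J_bound) auto
  also have "\<dots> \<le> 2 * (1 + L) * h\<^sup>2 * an (x - y)" using L norm_le_an[of "x - y"] by (auto intro!: mult_left_mono)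
  finally show ?thesis .
qed

text \<open>\<open>C1\<close> and \<open>C3\<close> are the coefficients of \<open>J\<close> under
  (A1) and (A3). \<open>C2\<close> is the price of using (A3) slightly below \<open>R\<close>.
  \<open>K0\<close> expresses the drift error relative to \<open>f\<close>, using
  \<open>q * r \<le> f r\<close>. None of them involves \<open>h\<close>.\<close>

definition C1 :: real where "C1 = 1 + 2 * \<alpha> + \<beta>"
definition C2 :: real where "C2 = Mc + (1 + \<alpha>) * L"
definition C3 :: real where "C3 = 1 + \<alpha> + (1 + \<alpha>) * (Mc + C2)"
definition K0 :: real where "K0 = (C1 + C3) * (2 * (1 + L)) / q"

lemma C_nonneg: "0 \<le> C1" "0 \<le> C2" "0 \<le> C3" "0 \<le> K0"
  using alpha beta cpos L q_pos by (auto simp: C1_def C2_def C3_def K0_def)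

lemma drift_error:
  assumes "0 \<le> C" "C \<le> C1 + C3"
  shows "C * J x y w w \<le> K0 * h\<^sup>2 * f (an (x - y))"
proof -
  let ?r = "an (x - y)"
  have "C * J x y w w \<le> (C1 + C3) * (2 * (1 + L) * h\<^sup>2 * ?r)"
    using assms J_sync[of x y w] J_nonneg[where \<nu>="\<lambda>_. 0" and x=x and y=y and w=w and w'=w] by (intro mult_mono) auto
  also have "\<dots> = K0 * h\<^sup>2 * (q * ?r)" using q_pos by (simp add: K0_def)
  also have "\<dots> \<le> K0 * h\<^sup>2 * f ?r"
    using f_bounds[OF an_nonneg, of "x - y"] C_nonneg(4) by (intro mult_left_mono) auto
  finally show ?thesis .
qed

text \<open>With the low part below \<delta>, \<open>f r\<close> is at most
  \<open>\<delta> + \<alpha> * norm (high (x - y))\<close>. The distance decreases by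
  \<open>h * norm (high (x - y))\<close>, which covers the rate \<open>q / (2 * \<alpha>)\<close>
  with a factor 2 to spare; growth of the low part is charged to the error proportional to
  \<delta>.\<close>

lemma sync_low:
  assumes h1: "h \<le> 1" and low: "norm (low (x - y)) \<le> \<delta>"
  shows "f (an (flow x w - flow y w)) \<le> (1 - c * h) * f (an (x - y)) + h * ((c + \<beta>) * \<delta>) + K0 * h\<^sup>2 * f (an (x - y))"
proof -
  let ?l = "norm (low (x - y))" and ?u = "norm (high (x - y))" and ?r = "an (x - y)"
  have r: "?r = ?l + \<alpha> * ?u" by (simp add: alpha_norm_def)
  have J0: "0 \<le> J x y w w" using J_nonneg[where \<nu>="\<lambda>_. 0" and x=x and y=y and w=w and w'=w] by simp
  have "an (flow x w - flow y w) \<le> \<bar>1 - h + 0\<bar> * ?l + \<alpha> * (1 - h) * ?u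
     + h * ((\<beta> + 1) * ?l + (\<alpha> - 1) * ?u) + (1 + 2 * \<alpha> + \<beta>) * J x y w w"
    using end_bound_A1[where \<nu>="\<lambda>_. 0" and x=x and y=y and w=w and w'=w] h1 by simp
  also have "\<dots> = ?r - h * ?u + (h * \<beta> * ?l + C1 * J x y w w)"
    using h1 by (simp add: r C1_def algebra_simps)
  finally have b: "an (flow x w - flow y w) \<le> ?r - h * ?u + (h * \<beta> * ?l + C1 * J x y w w)" .
  have "h * ?u \<le> 1 * ?u" using h1 by (intro mult_right_mono) auto
  also have "\<dots> \<le> \<alpha> * ?u" using alpha by (intro mult_right_mono) auto
  finally have "h * ?u \<le> ?r" unfolding r using norm_ge_zero[of "low (x - y)"] by linarith
  then have "f (an (flow x w - flow y w)) \<le> f ?r - q * (h * ?u) + (h * \<beta> * ?l + C1 * J x y w w)"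
    using h beta C_nonneg J0 b an_nonneg by (intro f_shift) auto
  moreover have "C1 * J x y w w \<le> K0 * h\<^sup>2 * f ?r" using C_nonneg by (intro drift_error) auto
  moreover have "h * \<beta> * ?l \<le> h * \<beta> * \<delta>" using h beta low by (intro mult_left_mono) auto
  moreover have "c * h * f ?r - h * (c * \<delta>) \<le> q * (h * ?u)"
  proof -
    have "c * (f ?r - \<delta>) \<le> c * (\<alpha> * ?u)"
      using f_bounds[OF an_nonneg, of "x - y"] low c_nonneg by (intro mult_left_mono) (auto simp: r)
    also have "\<dots> \<le> q / (2 * \<alpha>) * (\<alpha> * ?u)" using c_le(2) alpha by (intro mult_right_mono) auto
    also have "\<dots> = q * ?u / 2" using alpha by simp
    also have "\<dots> \<le> q * ?u" using q_pos by simp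
    finally have "h * (c * (f ?r - \<delta>)) \<le> h * (q * ?u)" using h by (intro mult_left_mono) auto
    then show ?thesis by (simp add: algebra_simps)
  qed
  ultimately show ?thesis by (simp add: algebra_simps)
qed

text \<open>The linear drift contracts at rate 1 and the nonlinear drift gives back at most the
  fraction \<open>Mc\<close>, apart from the \<eta> error. Since \<open>f r \<le> r\<close>, the net
  rate \<open>1 - Mc\<close> weighted by the slope \<open>q\<close> dominates
  \<open>c\<close>.\<close>

lemma sync_far:
  assumes h1: "h \<le> 1" and far: "R - \<eta> \<le> an (x - y)" and \<eta>: "0 \<le> \<eta>"
  shows "f (an (flow x w - flow y w)) \<le> (1 - c * h) * f (an (x - y)) + h * (C2 * \<eta>) + K0 * h\<^sup>2 * f (an (x - y))"
proof -
  let ?l = "norm (low (x - y))" and ?u = "norm (high (x - y))" and ?r = "an (x - y)"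
  have r: "?r = ?l + \<alpha> * ?u" by (simp add: alpha_norm_def)
  have J0: "0 \<le> J x y w w" using J_nonneg[where \<nu>="\<lambda>_. 0" and x=x and y=y and w=w and w'=w] by simp
  have "an (flow x w - flow y w) \<le> \<bar>1 - h + 0\<bar> * ?l + \<alpha> * (1 - h) * ?u
     + h * (Mc * ?r + (Mc + (1 + \<alpha>) * L) * \<eta>) + (1 + \<alpha> + (1 + \<alpha>) * (Mc + (Mc + (1 + \<alpha>) * L))) * J x y w w"
    using end_bound_A3[where \<nu>="\<lambda>_. 0" and x=x and y=y and w=w and w'=w and \<eta>=\<eta>] h1 far \<eta> by simp
  also have "\<dots> = (1 - h) * ?r + h * (Mc * ?r + C2 * \<eta>) + C3 * J x y w w"
    using h1 by (simp add: r C3_def C2_def algebra_simps)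
  also have "\<dots> = ?r - h * ((1 - Mc) * ?r) + (h * (C2 * \<eta>) + C3 * J x y w w)" by (simp add: algebra_simps)
  finally have b: "an (flow x w - flow y w) \<le> ?r - h * ((1 - Mc) * ?r) + (h * (C2 * \<eta>) + C3 * J x y w w)" .
  have "h * ((1 - Mc) * ?r) \<le> 1 * (1 * ?r)" using h1 h cpos an_nonneg[of "x - y"] by (intro mult_mono) auto
  then have "f (an (flow x w - flow y w)) \<le> f ?r - q * (h * ((1 - Mc) * ?r)) + (h * (C2 * \<eta>) + C3 * J x y w w)"
    using h cpos \<eta> C_nonneg J0 b an_nonneg by (intro f_shift) auto
  moreover have "C3 * J x y w w \<le> K0 * h\<^sup>2 * f ?r" using C_nonneg by (intro drift_error) auto
  moreover have "c * h * f ?r \<le> q * (h * ((1 - Mc) * ?r))"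
  proof -
    have "c * f ?r \<le> (q * (1 - Mc)) * ?r"
      using f_bounds[OF an_nonneg, of "x - y"] f_nonneg[OF an_nonneg, of "x - y"] c_le(1) c_nonneg q_pos cpos by (intro mult_mono) auto
    then have "h * (c * f ?r) \<le> h * ((q * (1 - Mc)) * ?r)" using h by (intro mult_left_mono) auto
    then show ?thesis by (simp add: algebra_simps)
  qed
  ultimately show ?thesis by (simp add: algebra_simps)
qed

lemma cov_form_le: "cov_form z \<le> (norm (low z))\<^sup>2 / ls"
  unfolding cov_form_def low_norm2 sum_divide_distrib
  using ls ls_le by (intro sum_mono divide_left_mono) (auto intro!: mult_pos_pos lam_pos)

text \<open>With the preceding bound, \<open>(norm (low z))\<^sup>2 / cov_form z\<close> lies
  between \<open>ls\<close> and \<open>lmax\<close>. The lower bound feeds the contraction, the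
  upper one the error moments.\<close>

lemma cov_form_ge: "(norm (low z))\<^sup>2 \<le> lmax * cov_form z"
  unfolding cov_form_def low_norm2 sum_distrib_left
proof (rule sum_mono)
  fix k assume "k \<in> {..<n}"
  then have k: "0 < lam k" "lam k \<le> lmax" using lam_pos lam_le by auto
  have "(z \<bullet> e k)\<^sup>2 = lam k * ((z \<bullet> e k)\<^sup>2 / lam k)" using k by simp
  also have "\<dots> \<le> lmax * ((z \<bullet> e k)\<^sup>2 / lam k)" using k by (intro mult_right_mono) auto
  finally show "(z \<bullet> e k)\<^sup>2 \<le> lmax * ((z \<bullet> e k)\<^sup>2 / lam k)" .
qed

lemma cov_form_pos: "low z \<noteq> 0 \<Longrightarrow> 0 < cov_form z"
proof -
  assume z: "low z \<noteq> 0"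
  have "0 \<le> cov_form z" unfolding cov_form_def using lam_pos by (intro sum_nonneg divide_nonneg_pos) auto
  moreover have "cov_form z \<noteq> 0" using cov_form_ge[of z] z by auto
  ultimately show ?thesis by simp
qed

text \<open>Coefficient of \<open>h * sqrt h\<close> in a reflected step. The powers of
  \<open>sqrt (8 * lmax)\<close> bound moments of the Gaussian displacement. It grows as \<delta>
  shrinks but is free of \<open>h\<close>.\<close>

definition K1 :: "real \<Rightarrow> real \<Rightarrow> real" where
  "K1 \<delta> CT = CT * (4 * ((\<beta> + 1) * R) ^ 3 + 8 * sqrt (8 * lmax) ^ 3) + 16 * sqrt (8 * lmax) ^ 3 / \<delta>\<^sup>2
     + C1 * (2 * (1 + L) * R + 4 * sqrt (8 * lmax))"

lemma refl_diff:
  fixes w :: "real \<Rightarrow>\<^sub>C 'a"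
  shows "sqrt 2 *\<^sub>R (w s - refl_path z w s) = (2 * sqrt 2 / cov_form z * (w s \<bullet> cov_inv z)) *\<^sub>R low z"
  by (simp add: refl_path_def apply_skew_path skew_def algebra_simps)

text \<open>Here \<open>t\<close> is the Gaussian displacement of the norm of the low part and
  \<open>m\<close> bounds the drift of the distance. The end distance exceeds the nonnegative part
  of \<open>r + h * m + t\<close> by at most a cubic folding error and a multiple of
  \<open>J\<close>. Nonnegativity of \<open>Pol\<close> is recorded so that the expectation can be
  split in the extended reals.\<close>

lemma reflect_pathwise:
  fixes w :: "real \<Rightarrow>\<^sub>C 'a"
  assumes h1: "h \<le> 1/2" and low: "\<delta> \<le> norm (low (x - y))" and \<delta>: "0 < \<delta>" and near: "an (x - y) \<le> R - \<eta>"
    and taylor: "\<And>r Y. \<delta> \<le> r \<Longrightarrow> r \<le> R - \<eta> \<Longrightarrow> f (max 0 (r + Y)) \<le> f r + f1 r * Y + f2 r / 2 * Y\<^sup>2 + CT * \<bar>Y\<bar> ^ 3"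
    and CT: "0 \<le> CT"
  defines "r \<equiv> an (x - y)" and "\<kappa> \<equiv> norm (low (x - y)) * (2 * sqrt 2) / cov_form (x - y)"
    and "m \<equiv> \<beta> * norm (low (x - y)) - norm (high (x - y))"
  defines "t \<equiv> \<kappa> * (w h \<bullet> cov_inv (x - y))"
  defines "Pol \<equiv> f r + f1 r * (h * m + t) + f2 r / 2 * (h * m + t)\<^sup>2 + CT * (4 * \<bar>h * m\<bar> ^ 3 + 4 * \<bar>t\<bar> ^ 3) + 8 / \<delta>\<^sup>2 * \<bar>t\<bar> ^ 3
      + C1 * (2 * (1 + L) * h\<^sup>2 * r)"
  shows "f (an (flow x w - flow y (refl_path (x - y) w)))
      \<le> Pol + C1 * 2 * \<kappa> * integral {0..h} (\<lambda>s. \<bar>w s \<bullet> cov_inv (x - y)\<bar>)"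
    and "0 \<le> Pol"
proof -
  let ?z = "x - y" and ?w' = "refl_path (x - y) w"
  let ?l = "norm (low (x - y))" and ?u = "norm (high (x - y))"
  let ?qz = "cov_form (x - y)"
  define \<nu> where "\<nu> s = 2 * sqrt 2 / ?qz * (w s \<bullet> cov_inv ?z)" for s
  have l0: "0 < ?l" using low \<delta> by linarith
  have qz: "0 < ?qz" using l0 by (intro cov_form_pos) auto
  have \<kappa>: "0 \<le> \<kappa>" using qz by (simp add: \<kappa>_def)
  have \<nu>c: "continuous_on {0..h} \<nu>" unfolding \<nu>_def[abs_def] by (intro continuous_intros) auto
  have ww: "sqrt 2 *\<^sub>R (w s - ?w' s) = \<nu> s *\<^sub>R low ?z" for s unfolding \<nu>_def by (rule refl_diff)
  have t: "t = \<nu> h * ?l" by (simp add: t_def \<kappa>_def \<nu>_def)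
  let ?J = "J x y w ?w'"
  have J0: "0 \<le> ?J" using J_nonneg[OF \<nu>c ww] by simp
  have r: "r = ?l + \<alpha> * ?u" by (simp add: r_def alpha_norm_def)
  have "?J \<le> 2 * (1 + L) * h\<^sup>2 * norm ?z + 2 * ?l * integral {0..h} (\<lambda>s. \<bar>\<nu> s\<bar>)"
    by (rule J_bound[OF \<nu>c ww])
  also have "2 * (1 + L) * h\<^sup>2 * norm ?z \<le> 2 * (1 + L) * h\<^sup>2 * r"
    unfolding r_def using L norm_le_an[of "x - y"] by (intro mult_left_mono) auto
  also have "2 * ?l * integral {0..h} (\<lambda>s. \<bar>\<nu> s\<bar>) = 2 * \<kappa> * integral {0..h} (\<lambda>s. \<bar>w s \<bullet> cov_inv ?z\<bar>)"
    using qz by (simp add: \<nu>_def \<kappa>_def abs_mult)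
  finally have J: "?J \<le> 2 * (1 + L) * h\<^sup>2 * r + 2 * \<kappa> * integral {0..h} (\<lambda>s. \<bar>w s \<bullet> cov_inv ?z\<bar>)" by simp
  \<comment> \<open>If the multiplier becomes negative, \<open>\<bar>\<nu> h\<bar>\<close> is at
    least \<open>1/2\<close>, so the linear overshoot is dominated by a cube. Division by the square
    of the low norm, at least \<delta>, turns this into a cube of \<open>t\<close>.\<close>
  have a: "\<bar>1 - h + \<nu> h\<bar> * ?l \<le> (1 - h) * ?l + t + 8 / \<delta>\<^sup>2 * \<bar>t\<bar> ^ 3"
  proof (cases "0 \<le> 1 - h + \<nu> h")
    case True
    have "0 \<le> 8 / \<delta>\<^sup>2 * \<bar>t\<bar> ^ 3" by simp
    then show ?thesis using True by (simp add: t distrib_right)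
  next
    case False
    then have "1/2 \<le> \<bar>\<nu> h\<bar>" "\<nu> h < 0" using h1 by linarith+
    then have "(1/2)\<^sup>2 \<le> \<bar>\<nu> h\<bar>\<^sup>2" by (intro power_mono) auto
    then have "\<bar>\<nu> h\<bar> * 1 \<le> \<bar>\<nu> h\<bar> * (4 * \<bar>\<nu> h\<bar>\<^sup>2)" by (intro mult_left_mono) (auto simp: power2_eq_square)
    then have n3: "\<bar>\<nu> h\<bar> \<le> 4 * \<bar>\<nu> h\<bar> ^ 3" by (simp add: power2_eq_square power3_eq_cube)
    have "\<bar>1 - h + \<nu> h\<bar> * ?l = (1 - h) * ?l + t + 2 * (- (1 - h + \<nu> h)) * ?l" using False by (simp add: t algebra_simps)
    also have "2 * (- (1 - h + \<nu> h)) * ?l \<le> (8 * \<bar>\<nu> h\<bar> ^ 3) * ?l"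
      using n3 h1 \<open>\<nu> h < 0\<close> by (intro mult_right_mono) auto
    also have "\<dots> = 8 * \<bar>t\<bar> ^ 3 / ?l\<^sup>2" using l0 by (simp add: t abs_mult power_mult_distrib power2_eq_square power3_eq_cube)
    also have "\<dots> \<le> 8 * \<bar>t\<bar> ^ 3 / \<delta>\<^sup>2" using low \<delta> by (intro divide_left_mono power_mono mult_pos_pos) auto
    finally show ?thesis by simp
  qed
  have "an (flow x w - flow y ?w') \<le> \<bar>1 - h + \<nu> h\<bar> * ?l + \<alpha> * (1 - h) * ?u
     + h * ((\<beta> + 1) * ?l + (\<alpha> - 1) * ?u) + (1 + 2 * \<alpha> + \<beta>) * ?J"
    using h1 by (intro end_bound_A1[OF \<nu>c ww]) auto
  also have "\<dots> \<le> ((1 - h) * ?l + t + 8 / \<delta>\<^sup>2 * \<bar>t\<bar> ^ 3) + \<alpha> * (1 - h) * ?u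
     + h * ((\<beta> + 1) * ?l + (\<alpha> - 1) * ?u) + (1 + 2 * \<alpha> + \<beta>) * ?J" using a by simp
  also have "\<dots> = (r + (h * m + t)) + (8 / \<delta>\<^sup>2 * \<bar>t\<bar> ^ 3 + C1 * ?J)"
    by (simp add: r m_def C1_def algebra_simps)
  finally have b: "an (flow x w - flow y ?w') \<le> max 0 (r + (h * m + t)) + (8 / \<delta>\<^sup>2 * \<bar>t\<bar> ^ 3 + C1 * ?J)"
    by linarith
  have e0: "0 \<le> 8 / \<delta>\<^sup>2 * \<bar>t\<bar> ^ 3 + C1 * ?J" using J0 C_nonneg by simp
  have "f (an (flow x w - flow y ?w')) \<le> f (max 0 (r + (h * m + t)) + (8 / \<delta>\<^sup>2 * \<bar>t\<bar> ^ 3 + C1 * ?J))"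
    by (intro f_mono b an_nonneg)
  also have "\<dots> \<le> f (max 0 (r + (h * m + t))) + (8 / \<delta>\<^sup>2 * \<bar>t\<bar> ^ 3 + C1 * ?J)"
    using f_increment_bounds(2)[of "max 0 (r + (h * m + t))" "max 0 (r + (h * m + t)) + (8 / \<delta>\<^sup>2 * \<bar>t\<bar> ^ 3 + C1 * ?J)"] e0 by simp
  finally have F: "f (an (flow x w - flow y ?w')) \<le> f (max 0 (r + (h * m + t))) + (8 / \<delta>\<^sup>2 * \<bar>t\<bar> ^ 3 + C1 * ?J)" .
  have "0 \<le> \<alpha> * ?u" using alpha by simp
  then have "\<delta> \<le> r" using low unfolding r by linarith
  then have "f (max 0 (r + (h * m + t))) \<le> f r + f1 r * (h * m + t) + f2 r / 2 * (h * m + t)\<^sup>2 + CT * \<bar>h * m + t\<bar> ^ 3"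
    using near by (intro taylor) (auto simp: r_def)
  also have "CT * \<bar>h * m + t\<bar> ^ 3 \<le> CT * (4 * \<bar>h * m\<bar> ^ 3 + 4 * \<bar>t\<bar> ^ 3)"
    using CT by (intro mult_left_mono abs_sum_cube_le)
  finally have T: "f (max 0 (r + (h * m + t))) \<le> f r + f1 r * (h * m + t) + f2 r / 2 * (h * m + t)\<^sup>2 + CT * (4 * \<bar>h * m\<bar> ^ 3 + 4 * \<bar>t\<bar> ^ 3)" by simp
  have "C1 * ?J \<le> C1 * (2 * (1 + L) * h\<^sup>2 * r) + C1 * 2 * \<kappa> * integral {0..h} (\<lambda>s. \<bar>w s \<bullet> cov_inv ?z\<bar>)"
    using mult_left_mono[OF J C_nonneg(1)] by (simp add: distrib_left)
  then show "f (an (flow x w - flow y ?w')) \<le> Pol + C1 * 2 * \<kappa> * integral {0..h} (\<lambda>s. \<bar>w s \<bullet> cov_inv ?z\<bar>)"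
    using F T unfolding Pol_def by linarith
  have "0 \<le> f (max 0 (r + (h * m + t)))" by (intro f_nonneg) simp
  moreover have "0 \<le> C1 * (2 * (1 + L) * h\<^sup>2 * r)" using C_nonneg L an_nonneg[of "x - y"] by (simp add: r_def)
  moreover have "0 \<le> 8 / \<delta>\<^sup>2 * \<bar>t\<bar> ^ 3" by simp
  ultimately show "0 \<le> Pol" using T unfolding Pol_def by linarith
qed

text \<open>The linear term in the displacement is centred, the quadratic term meets the concavity
  of \<open>f\<close>, and the rest is of order \<open>h * sqrt h\<close>. The main terms are
  \<open>h\<close> times the left side of \<open>f2_generator\<close>.\<close>

lemma reflect_expectation:
  assumes h1: "h \<le> 1/2" and low: "\<delta> \<le> norm (low (x - y))" and \<delta>: "0 < \<delta>" and near: "an (x - y) \<le> R - \<eta>" and \<eta>: "0 \<le> \<eta>"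
    and taylor: "\<And>r Y. \<delta> \<le> r \<Longrightarrow> r \<le> R - \<eta> \<Longrightarrow> f (max 0 (r + Y)) \<le> f r + f1 r * Y + f2 r / 2 * Y\<^sup>2 + CT * \<bar>Y\<bar> ^ 3"
    and CT: "0 \<le> CT"
  shows "(\<integral>\<^sup>+\<omega>. ennreal (f (an (flow x (path 0 \<omega>) - flow y (refl_path (x - y) (path 0 \<omega>))))) \<partial>P)
     \<le> ennreal ((1 - c * h) * f (an (x - y)) + K1 \<delta> CT * (h * sqrt h))"
proof -
  define r where "r = an (x - y)"
  define qz where "qz = cov_form (x - y)"
  define l where "l = norm (low (x - y))"
  define \<kappa> where "\<kappa> = l * (2 * sqrt 2) / qz"
  define m where "m = \<beta> * l - norm (high (x - y))"
  define t where "t \<omega> = \<kappa> * (path 0 \<omega> h \<bullet> cov_inv (x - y))" for \<omega>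
  define I where "I \<omega> = integral {0..h} (\<lambda>s. \<bar>path 0 \<omega> s \<bullet> cov_inv (x - y)\<bar>)" for \<omega>
  define Q where "Q u = f r + f1 r * (h * m + u) + f2 r / 2 * (h * m + u)\<^sup>2 + CT * (4 * \<bar>h * m\<bar> ^ 3 + 4 * \<bar>u\<bar> ^ 3) + 8 / \<delta>\<^sup>2 * \<bar>u\<bar> ^ 3
      + C1 * (2 * (1 + L) * h\<^sup>2 * r)" for u
  have l0: "0 < l" using low \<delta> unfolding l_def by linarith
  have qz: "0 < qz" using l0 unfolding qz_def l_def by (intro cov_form_pos) auto
  have \<kappa>: "0 < \<kappa>" using qz l0 by (simp add: \<kappa>_def)
  define \<sigma> where "\<sigma> = \<kappa> * sqrt (h * qz)"
  have \<sigma>0: "0 < \<sigma>" using \<kappa> h qz by (simp add: \<sigma>_def)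
  \<comment> \<open>The factor 8 is the square of \<open>2 * sqrt 2\<close>: reflection doubles the
    noise and the equation scales it by \<open>sqrt 2\<close>.\<close>
  have \<sigma>2: "\<sigma>\<^sup>2 = 8 * h * (l\<^sup>2 / qz)"
  proof -
    have "\<sigma>\<^sup>2 = \<kappa>\<^sup>2 * (h * qz)" using h qz by (simp add: \<sigma>_def power_mult_distrib)
    also have "\<kappa>\<^sup>2 = 8 * l\<^sup>2 / qz\<^sup>2" by (simp add: \<kappa>_def power_mult_distrib power_divide)
    finally show ?thesis using qz by (simp add: power2_eq_square field_simps)
  qed
  have \<sigma>lo: "8 * ls * h \<le> \<sigma>\<^sup>2"
  proof -
    have "ls * qz \<le> l\<^sup>2" using cov_form_le[of "x - y"] ls by (simp add: qz_def l_def field_simps)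
    then have "ls \<le> l\<^sup>2 / qz" using qz by (simp add: field_simps)
    then have "8 * h * ls \<le> 8 * h * (l\<^sup>2 / qz)" using h by (intro mult_left_mono) auto
    then show ?thesis by (simp add: \<sigma>2 mult_ac)
  qed
  define s0 where "s0 = sqrt (8 * lmax)"
  have \<sigma>hi: "\<sigma> \<le> s0 * sqrt h"
  proof (rule power2_le_imp_le)
    have "l\<^sup>2 / qz \<le> lmax" using cov_form_ge[of "x - y"] qz by (simp add: qz_def l_def field_simps)
    moreover have "0 \<le> l\<^sup>2 / qz" using qz by simp
    ultimately have lm: "0 \<le> lmax" by linarith
    have "8 * h * (l\<^sup>2 / qz) \<le> 8 * h * lmax" using \<open>l\<^sup>2 / qz \<le> lmax\<close> h by (intro mult_left_mono) auto
    then show "\<sigma>\<^sup>2 \<le> (s0 * sqrt h)\<^sup>2" using lm h by (simp add: \<sigma>2 s0_def power_mult_distrib mult_ac)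
    show "0 \<le> s0 * sqrt h" using lm h by (simp add: s0_def)
  qed
  have s0: "0 \<le> s0"
  proof -
    have "0 < s0 * sqrt h" using \<sigma>0 \<sigma>hi by linarith
    then show ?thesis using h by (simp add: zero_less_mult_iff)
  qed
  have dist: "distributed P lborel t (\<lambda>x. ennreal (normal_density 0 \<sigma> x))"
  proof -
    have "distributed P lborel (\<lambda>\<omega>. path 0 \<omega> h \<bullet> cov_inv (x - y)) (\<lambda>x. ennreal (normal_density 0 (sqrt (h * qz)) x))"
      unfolding qz_def using qz h by (intro path_inner_distributed) (auto simp: qz_def)
    from normal_density_affine[OF this, of \<kappa> 0] show ?thesis
      using \<kappa> h qz by (simp add: t_def[abs_def] \<sigma>_def)
  qed
  note mom = normal_moments[OF dist \<sigma>0]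
  have tm[measurable]: "t \<in> borel_measurable P" using distributed_measurable[OF dist] by simp
  have point: "f (an (flow x (path 0 \<omega>) - flow y (refl_path (x - y) (path 0 \<omega>)))) \<le> Q (t \<omega>) + C1 * 2 * \<kappa> * I \<omega>" "0 \<le> Q (t \<omega>)" for \<omega>
    unfolding Q_def t_def I_def \<kappa>_def l_def qz_def m_def r_def
    by (rule reflect_pathwise(1)[OF h1 low \<delta> near _ CT], rule taylor; assumption)
       (rule reflect_pathwise(2)[OF h1 low \<delta> near _ CT], rule taylor; assumption)
  \<comment> \<open>Sorting by powers of \<open>t\<close> lets the Gaussian moments be inserted term
    by term.\<close>
  have Qexp: "Q (t \<omega>) = (f r + f1 r * (h * m) + f2 r / 2 * (h * m)\<^sup>2 + CT * (4 * \<bar>h * m\<bar> ^ 3) + C1 * (2 * (1 + L) * h\<^sup>2 * r))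
      + (f1 r + f2 r * (h * m)) * t \<omega> + f2 r / 2 * (t \<omega>)\<^sup>2 + (4 * CT + 8 / \<delta>\<^sup>2) * \<bar>t \<omega>\<bar> ^ 3" for \<omega>
    by (simp add: Q_def power2_eq_square algebra_simps)
  have Qint: "integrable P (\<lambda>\<omega>. Q (t \<omega>))" unfolding Qexp
    by (intro Bochner_Integration.integrable_add integrable_mult_right integrable_const mom(1,3,7))
  have "(\<integral>\<omega>. Q (t \<omega>) \<partial>P) = (f r + f1 r * (h * m) + f2 r / 2 * (h * m)\<^sup>2 + CT * (4 * \<bar>h * m\<bar> ^ 3) + C1 * (2 * (1 + L) * h\<^sup>2 * r))
      + (f1 r + f2 r * (h * m)) * 0 + f2 r / 2 * \<sigma>\<^sup>2 + (4 * CT + 8 / \<delta>\<^sup>2) * (\<integral>\<omega>. \<bar>t \<omega>\<bar> ^ 3 \<partial>P)"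
    unfolding Qexp using mom by (simp add: prob_space)
  also have "\<dots> \<le> f r - c * h * f r + (CT * (4 * ((\<beta> + 1) * R) ^ 3 + 8 * s0 ^ 3) + 16 * s0 ^ 3 / \<delta>\<^sup>2 + C1 * (2 * (1 + L) * R)) * (h * sqrt h)"
  proof -
    have r0: "0 \<le> r" "r \<le> R" using near \<eta> an_nonneg by (auto simp: r_def)
    have hh: "h \<le> 1" "h \<le> sqrt h"
    proof -
      show "h \<le> 1" using h1 by simp
      then have "h * h \<le> h * 1" using h by (intro mult_left_mono) auto
      then show "h \<le> sqrt h" using h by (intro real_le_rsqrt) (simp add: power2_eq_square)
    qed
    have "1 * norm (high (x - y)) \<le> \<alpha> * norm (high (x - y))" using alpha by (intro mult_right_mono) auto
    then have lr: "l \<le> r" "norm (high (x - y)) \<le> r"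
      using norm_ge_zero[of "high (x - y)"] norm_ge_zero[of "low (x - y)"]
      unfolding l_def r_def alpha_norm_def by linarith+
    \<comment> \<open>The decay of the high part is given up here: in this regime the rate comes
      from the noise alone.\<close>
    have m1: "m \<le> \<beta> * r" using lr beta mult_left_mono[of l r \<beta>] norm_ge_zero[of "high (x - y)"] unfolding m_def by linarith
    have m2: "\<bar>m\<bar> \<le> (\<beta> + 1) * R"
    proof -
      have "0 \<le> \<beta> * l" using beta l0 by simp
      moreover have "\<beta> * l \<le> \<beta> * R" using lr r0 beta by (intro mult_left_mono) auto
      ultimately show ?thesis using lr r0 norm_ge_zero[of "high (x - y)"] unfolding m_def distrib_right by linarith
    qed
    have main: "f1 r * (h * m) + f2 r / 2 * (h * m)\<^sup>2 + f2 r / 2 * \<sigma>\<^sup>2 \<le> - (c * h * f r)"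
    proof -
      have f2: "f2 r \<le> 0" using r0 by (intro f2_nonpos)
      have 1: "f1 r * (h * m) \<le> f1 r * (h * (\<beta> * r))"
        using f1_bounds[OF r0(1)] q_pos h m1 by (intro mult_left_mono) auto
      have 2: "f2 r / 2 * (h * m)\<^sup>2 \<le> 0" using f2 by (intro mult_nonpos_nonneg) auto
      \<comment> \<open>As \<open>f2 r\<close> is nonpositive, the lower bound on the variance is
        the useful one; it produces the coefficient \<open>4 * ls\<close> in the differential
        inequality.\<close>
      have 3: "f2 r / 2 * \<sigma>\<^sup>2 \<le> f2 r / 2 * (8 * ls * h)" using f2 \<sigma>lo by (intro mult_left_mono_neg) auto
      have "h * (\<beta> * r * f1 r + 4 * ls * f2 r) \<le> h * (- (2 * ls * \<gamma>) * f r)"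
        using f2_generator[OF r0(1)] h by (intro mult_left_mono) auto
      also have "\<dots> \<le> - (c * h * f r)"
      proof -
        have "c * (h * f r) \<le> (2 * ls * \<gamma>) * (h * f r)" using c_le(3) f_nonneg[OF r0(1)] h by (intro mult_right_mono) auto
        then show ?thesis by (simp add: algebra_simps)
      qed
      finally show ?thesis using 1 2 3 by (simp add: algebra_simps)
    qed
    have cube: "\<bar>h * m\<bar> ^ 3 \<le> ((\<beta> + 1) * R) ^ 3 * (h * sqrt h)"
    proof -
      have "\<bar>h * m\<bar> ^ 3 = h ^ 3 * \<bar>m\<bar> ^ 3" using h by (simp add: abs_mult power_mult_distrib)
      also have "\<dots> \<le> (h * sqrt h) * ((\<beta> + 1) * R) ^ 3"
      proof (intro mult_mono power_mono m2)
        have "h ^ 3 = h * (h * h)" by (simp add: power3_eq_cube)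
        also have "\<dots> \<le> h * (1 * sqrt h)" using h hh by (intro mult_left_mono mult_mono) auto
        finally show "h ^ 3 \<le> h * sqrt h" by simp
      qed (use h in auto)
      finally show ?thesis by (simp add: mult.commute)
    qed
    have "(\<integral>\<omega>. \<bar>t \<omega>\<bar> ^ 3 \<partial>P) \<le> 2 * \<sigma> ^ 3" by (rule mom(8))
    also have "\<dots> \<le> 2 * (s0 * sqrt h) ^ 3" using \<sigma>hi \<sigma>0 by (intro mult_left_mono power_mono) auto
    also have "\<dots> = 2 * s0 ^ 3 * (h * sqrt h)" using h by (simp add: power_mult_distrib power3_eq_cube)
    finally have t3: "(\<integral>\<omega>. \<bar>t \<omega>\<bar> ^ 3 \<partial>P) \<le> 2 * s0 ^ 3 * (h * sqrt h)" .
    have A: "CT * (4 * \<bar>h * m\<bar> ^ 3) \<le> CT * (4 * (((\<beta> + 1) * R) ^ 3 * (h * sqrt h)))" using CT cube by (intro mult_left_mono) auto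
    have B: "C1 * (2 * (1 + L) * h\<^sup>2 * r) \<le> C1 * (2 * (1 + L) * (h * sqrt h) * R)"
      using C_nonneg L r0 h hh by (intro mult_left_mono mult_mono) (auto simp: power2_eq_square)
    have C: "(4 * CT + 8 / \<delta>\<^sup>2) * (\<integral>\<omega>. \<bar>t \<omega>\<bar> ^ 3 \<partial>P) \<le> (4 * CT + 8 / \<delta>\<^sup>2) * (2 * s0 ^ 3 * (h * sqrt h))"
      using CT t3 by (intro mult_left_mono) auto
    show ?thesis using main A B C by (simp add: algebra_simps)
  qed
  finally have EQ: "(\<integral>\<omega>. Q (t \<omega>) \<partial>P) \<le> f r - c * h * f r + (CT * (4 * ((\<beta> + 1) * R) ^ 3 + 8 * s0 ^ 3) + 16 * s0 ^ 3 / \<delta>\<^sup>2 + C1 * (2 * (1 + L) * R)) * (h * sqrt h)" .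
  have EQ0: "0 \<le> (\<integral>\<omega>. Q (t \<omega>) \<partial>P)" using point(2) by (intro Bochner_Integration.integral_nonneg) auto
  have Im[measurable]: "I \<in> borel_measurable P" unfolding I_def[abs_def] using qz by (intro path_time_integral(2)) (simp add: qz_def)
  have I0: "0 \<le> I \<omega>" for \<omega> unfolding I_def
    by (intro Henstock_Kurzweil_Integration.integral_nonneg integrable_continuous_interval continuous_intros) auto
  have "(\<integral>\<^sup>+\<omega>. ennreal (C1 * 2 * \<kappa> * I \<omega>) \<partial>P) = ennreal (C1 * 2 * \<kappa>) * (\<integral>\<^sup>+\<omega>. ennreal (I \<omega>) \<partial>P)"
    using C_nonneg \<kappa> I0 by (subst nn_integral_cmult[symmetric]) (auto simp: ennreal_mult)
  also have "\<dots> \<le> ennreal (C1 * 2 * \<kappa>) * ennreal (h * sqrt (h * qz))"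
    using path_time_integral(1)[of "x - y"] qz unfolding I_def[abs_def] qz_def by (intro mult_left_mono) auto
  also have "\<dots> = ennreal (C1 * 2 * (h * \<sigma>))"
    using C_nonneg \<kappa> h qz by (simp add: ennreal_mult[symmetric] \<sigma>_def mult_ac)
  also have "\<dots> \<le> ennreal (C1 * 4 * s0 * (h * sqrt h))"
  proof (rule ennreal_leI)
    have "h * \<sigma> \<le> h * (s0 * sqrt h)" using \<sigma>hi h by (intro mult_left_mono) auto
    then have "C1 * 2 * (h * \<sigma>) \<le> C1 * 2 * (h * (s0 * sqrt h))" by (rule mult_left_mono) (use C_nonneg in simp)
    also have "\<dots> \<le> C1 * 4 * (h * (s0 * sqrt h))" using C_nonneg s0 h by (intro mult_right_mono) auto
    finally show "C1 * 2 * (h * \<sigma>) \<le> C1 * 4 * s0 * (h * sqrt h)" by (simp add: mult_ac)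
  qed
  finally have EI: "(\<integral>\<^sup>+\<omega>. ennreal (C1 * 2 * \<kappa> * I \<omega>) \<partial>P) \<le> ennreal (C1 * 4 * s0 * (h * sqrt h))" .
  have Qm: "(\<lambda>\<omega>. Q (t \<omega>)) \<in> borel_measurable P" using Qint by auto
  have "(\<integral>\<^sup>+\<omega>. ennreal (f (an (flow x (path 0 \<omega>) - flow y (refl_path (x - y) (path 0 \<omega>))))) \<partial>P)
     \<le> (\<integral>\<^sup>+\<omega>. ennreal (Q (t \<omega>)) + ennreal (C1 * 2 * \<kappa> * I \<omega>) \<partial>P)"
  proof (rule nn_integral_mono)
    fix \<omega>
    have "0 \<le> C1 * 2 * \<kappa> * I \<omega>" using C_nonneg \<kappa> I0[of \<omega>] by simp
    then have "ennreal (Q (t \<omega>) + C1 * 2 * \<kappa> * I \<omega>) = ennreal (Q (t \<omega>)) + ennreal (C1 * 2 * \<kappa> * I \<omega>)"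
      using point(2)[of \<omega>] by (rule ennreal_plus[rotated])
    then show "ennreal (f (an (flow x (path 0 \<omega>) - flow y (refl_path (x - y) (path 0 \<omega>)))))
        \<le> ennreal (Q (t \<omega>)) + ennreal (C1 * 2 * \<kappa> * I \<omega>)" using ennreal_leI[OF point(1)[of \<omega>]] by simp
  qed
  also have "\<dots> = (\<integral>\<^sup>+\<omega>. ennreal (Q (t \<omega>)) \<partial>P) + (\<integral>\<^sup>+\<omega>. ennreal (C1 * 2 * \<kappa> * I \<omega>) \<partial>P)"
    using Qm by (intro nn_integral_add) auto
  also have "(\<integral>\<^sup>+\<omega>. ennreal (Q (t \<omega>)) \<partial>P) = ennreal (\<integral>\<omega>. Q (t \<omega>) \<partial>P)"
    using point(2) by (intro nn_integral_eq_integral Qint) auto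
  also have "\<dots> + (\<integral>\<^sup>+\<omega>. ennreal (C1 * 2 * \<kappa> * I \<omega>) \<partial>P) \<le> ennreal (\<integral>\<omega>. Q (t \<omega>) \<partial>P) + ennreal (C1 * 4 * s0 * (h * sqrt h))"
    using EI by (intro add_left_mono)
  also have "\<dots> = ennreal ((\<integral>\<omega>. Q (t \<omega>) \<partial>P) + C1 * 4 * s0 * (h * sqrt h))"
    using EQ0 C_nonneg s0 h by (intro ennreal_plus[symmetric]) auto
  also have "\<dots> \<le> ennreal ((1 - c * h) * f r + K1 \<delta> CT * (h * sqrt h))"
  proof (rule ennreal_leI)
    have "K1 \<delta> CT = CT * (4 * ((\<beta> + 1) * R) ^ 3 + 8 * s0 ^ 3) + 16 * s0 ^ 3 / \<delta>\<^sup>2 + C1 * (2 * (1 + L) * R) + C1 * 4 * s0"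
      by (simp add: K1_def s0_def distrib_left)
    then have "K1 \<delta> CT * (h * sqrt h) = (CT * (4 * ((\<beta> + 1) * R) ^ 3 + 8 * s0 ^ 3) + 16 * s0 ^ 3 / \<delta>\<^sup>2 + C1 * (2 * (1 + L) * R)) * (h * sqrt h)
        + C1 * 4 * s0 * (h * sqrt h)" by (simp only: distrib_right)
    moreover have "(1 - c * h) * f r = f r - c * h * f r" by (simp add: left_diff_distrib)
    ultimately show "(\<integral>\<omega>. Q (t \<omega>) \<partial>P) + C1 * 4 * s0 * (h * sqrt h) \<le> (1 - c * h) * f r + K1 \<delta> CT * (h * sqrt h)"
      using EQ by linarith
  qed
  finally show ?thesis by (simp add: r_def)
qed

end

section \<open>Iterating the coupling\<close>

lemma wasserstein_le: "\<gamma> \<in> couplings \<mu> \<nu> \<Longrightarrow> wasserstein d \<mu> \<nu> \<le> (\<integral>\<^sup>+z. ennreal (d (fst z) (snd z)) \<partial>\<gamma>)"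
  unfolding wasserstein_def by (rule INF_lower)

context coupling_setting begin

text \<open>The pairs on which reflection is used. The set is closed, hence Borel, and on it the low
  part is bounded away from 0, so that the reflection depends continuously on the pair.\<close>

definition region :: "real \<Rightarrow> real \<Rightarrow> ('a \<times> 'a) set" where
  "region \<delta> \<eta> = {z. \<delta> \<le> norm (low (fst z - snd z)) \<and> an (fst z - snd z) \<le> R - \<eta>}"

definition coupled :: "real \<Rightarrow> real \<Rightarrow> 'a \<times> 'a \<Rightarrow> 'w \<Rightarrow> 'a \<times> 'a" where
  "coupled \<delta> \<eta> z \<omega> = (flow (fst z) (path 0 \<omega>),
     flow (snd z) (if z \<in> region \<delta> \<eta> then refl_path (fst z - snd z) (path 0 \<omega>) else path 0 \<omega>))"

definition ckern :: "real \<Rightarrow> real \<Rightarrow> 'a \<times> 'a \<Rightarrow> ('a \<times> 'a) measure" where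
  "ckern \<delta> \<eta> z = distr P borel (coupled \<delta> \<eta> z)"

lemma region_closed: "closed (region \<delta> \<eta>)"
proof -
  have "continuous_on UNIV (\<lambda>z :: 'a \<times> 'a. norm (low (fst z - snd z)))"
    by (intro continuous_intros continuous_on_compose2[OF linear_continuous_on[OF bounded_linear_low, of UNIV]]) auto
  moreover have "continuous_on UNIV (\<lambda>z :: 'a \<times> 'a. an (fst z - snd z))"
    by (intro continuous_on_compose2[OF an_continuous[of UNIV]] continuous_intros) auto
  ultimately show ?thesis
    unfolding region_def by (intro closed_Collect_conj closed_Collect_le continuous_on_const)
qed

lemma region_cov_form: "0 < \<delta> \<Longrightarrow> z \<in> region \<delta> \<eta> \<Longrightarrow> 0 < cov_form (fst z - snd z)"
  by (intro cov_form_pos) (auto simp: region_def)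

lemma coupled_measurable: "coupled \<delta> \<eta> z \<in> borel_measurable P"
proof -
  have "continuous_on UNIV (\<lambda>w. (flow (fst z) w, flow (snd z) (if z \<in> region \<delta> \<eta> then refl_path (fst z - snd z) w else w)))"
    by (cases "z \<in> region \<delta> \<eta>") (auto intro!: continuous_intros flow_continuous refl_path_continuous)
  from measurable_compose[OF path_measurable borel_measurable_continuous_onI[OF this]]
  show ?thesis by (simp add: coupled_def[abs_def])
qed

lemma ckern_measurable:
  assumes \<delta>: "0 < \<delta>"
  shows "ckern \<delta> \<eta> \<in> borel \<rightarrow>\<^sub>M subprob_algebra borel"
  unfolding ckern_def[abs_def]
proof (rule kernel_measurable[where S="region \<delta> \<eta>"])
  show "prob_space P" by (rule prob_space_axioms)
  show "region \<delta> \<eta> \<in> sets borel" using region_closed by simp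
  show "coupled \<delta> \<eta> z \<in> borel_measurable P" for z by (rule coupled_measurable)
  fix \<omega>
  have "continuous_on (- region \<delta> \<eta>) (\<lambda>z. (flow (fst z) (path 0 \<omega>), flow (snd z) (path 0 \<omega>)))"
    by (intro continuous_intros flow_continuous)
  then show "continuous_on (- region \<delta> \<eta>) (\<lambda>z. coupled \<delta> \<eta> z \<omega>)"
    by (rule continuous_on_eq) (auto simp: coupled_def)
  have cf: "continuous_on (region \<delta> \<eta>) (\<lambda>z. cov_form (fst z - snd z))"
    unfolding cov_form_def divide_inverse by (intro continuous_intros)
  have ci: "continuous_on (region \<delta> \<eta>) (\<lambda>z. cov_inv (fst z - snd z))"
    unfolding cov_inv_def divide_inverse by (intro continuous_intros)
  have cl: "continuous_on (region \<delta> \<eta>) (\<lambda>z. low (fst z - snd z))"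
    unfolding low_proj_def by (intro continuous_intros)
  have ca: "continuous_on (region \<delta> \<eta>) (\<lambda>z. (2 / cov_form (fst z - snd z)) *\<^sub>R cov_inv (fst z - snd z))"
    using region_cov_form[OF \<delta>] by (intro continuous_intros cf ci) force
  have "continuous_on (region \<delta> \<eta>) (\<lambda>z. refl_path (fst z - snd z) (path 0 \<omega>))"
    using ca cl unfolding refl_path_def continuous_on_def by (auto intro!: skew_path_tendsto)
  then have "continuous_on (region \<delta> \<eta>) (\<lambda>z. (flow (fst z) (path 0 \<omega>), flow (snd z) (refl_path (fst z - snd z) (path 0 \<omega>))))"
    by (intro continuous_intros flow_continuous)
  then show "continuous_on (region \<delta> \<eta>) (\<lambda>z. coupled \<delta> \<eta> z \<omega>)"
    by (rule continuous_on_eq) (auto simp: coupled_def)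
qed

lemma fst_measurable: "fst \<in> (borel :: ('a \<times> 'a) measure) \<rightarrow>\<^sub>M borel"
  and snd_measurable: "snd \<in> (borel :: ('a \<times> 'a) measure) \<rightarrow>\<^sub>M borel"
  by (auto intro!: borel_measurable_continuous_onI continuous_intros)

lemma ckern_fst: "distr (ckern \<delta> \<eta> z) borel fst = kern (path 0) (fst z)"
  unfolding ckern_def kern_def
  by (subst distr_distr[OF fst_measurable coupled_measurable]) (simp add: comp_def coupled_def)

lemma ckern_snd:
  assumes "0 < \<delta>"
  shows "distr (ckern \<delta> \<eta> z) borel snd = kern (path 0) (snd z)"
proof -
  have "distr (ckern \<delta> \<eta> z) borel snd
     = kern (\<lambda>\<omega>. if z \<in> region \<delta> \<eta> then refl_path (fst z - snd z) (path 0 \<omega>) else path 0 \<omega>) (snd z)"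
    unfolding ckern_def kern_def
    by (subst distr_distr[OF snd_measurable coupled_measurable]) (simp add: comp_def coupled_def)
  then show ?thesis using kern_reflect[OF region_cov_form[OF assms, of z \<eta>]] by (cases "z \<in> region \<delta> \<eta>") auto
qed

abbreviation "d2 \<equiv> \<lambda>x y. f (an (x - y))"

lemma d2_measurable: "(\<lambda>z. ennreal (d2 (fst z) (snd z))) \<in> borel_measurable borel"
proof -
  have "continuous_on UNIV (\<lambda>z :: 'a \<times> 'a. f (an (fst z - snd z)))"
    by (intro continuous_on_compose2[OF f_cont] continuous_on_compose2[OF an_continuous[of UNIV]] continuous_intros)
       (auto simp: an_nonneg)
  from borel_measurable_continuous_onI[OF this] show ?thesis by simp
qed

text \<open>All regimes are brought to one form, a factor on the old distance plus an additive
  error, so that the one-step bounds can be iterated whichever region a pair lies in.\<close>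

lemma ckern_cost:
  assumes n: "0 < n" and h1: "h \<le> 1/2" and \<delta>: "0 < \<delta>" and \<eta>: "0 < \<eta>" and CT: "0 \<le> CT"
    and taylor: "\<And>r Y. \<delta> \<le> r \<Longrightarrow> r \<le> R - \<eta> \<Longrightarrow> f (max 0 (r + Y)) \<le> f r + f1 r * Y + f2 r / 2 * Y\<^sup>2 + CT * \<bar>Y\<bar> ^ 3"
    and \<epsilon>: "(c + \<beta>) * \<delta> \<le> \<epsilon>" "C2 * \<eta> \<le> \<epsilon>"
  shows "(\<integral>\<^sup>+v. ennreal (d2 (fst v) (snd v)) \<partial>ckern \<delta> \<eta> z)
     \<le> ennreal ((1 - c * h + K0 * h\<^sup>2) * d2 (fst z) (snd z) + (h * \<epsilon> + K1 \<delta> CT * (h * sqrt h)))"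
proof -
  let ?x = "fst z" and ?y = "snd z"
  let ?r = "an (?x - ?y)"
  have lmax: "0 \<le> lmax" using lam_pos[OF n] lam_le[OF n] by linarith
  have K1: "0 \<le> K1 \<delta> CT"
    using lmax CT C_nonneg L R beta \<delta> by (auto simp: K1_def intro!: add_nonneg_nonneg mult_nonneg_nonneg divide_nonneg_nonneg)
  have fr: "0 \<le> f ?r" by (intro f_nonneg an_nonneg)
  have err: "0 \<le> K0 * h\<^sup>2 * f ?r" using fr C_nonneg by simp
  have \<epsilon>0: "0 \<le> \<epsilon>" using \<epsilon>(2) C_nonneg \<eta> by (meson less_imp_le mult_nonneg_nonneg order_trans)
  have eq: "(\<integral>\<^sup>+v. ennreal (d2 (fst v) (snd v)) \<partial>ckern \<delta> \<eta> z) = (\<integral>\<^sup>+\<omega>. ennreal (d2 (fst (coupled \<delta> \<eta> z \<omega>)) (snd (coupled \<delta> \<eta> z \<omega>))) \<partial>P)"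
    unfolding ckern_def using d2_measurable by (intro nn_integral_distr[OF coupled_measurable]) simp
  show ?thesis
  proof (cases "z \<in> region \<delta> \<eta>")
    case True
    then have z: "\<delta> \<le> norm (low (?x - ?y))" "?r \<le> R - \<eta>" by (auto simp: region_def)
    have "(\<integral>\<^sup>+\<omega>. ennreal (f (an (flow ?x (path 0 \<omega>) - flow ?y (refl_path (?x - ?y) (path 0 \<omega>))))) \<partial>P)
       \<le> ennreal ((1 - c * h) * f ?r + K1 \<delta> CT * (h * sqrt h))"
      by (rule reflect_expectation[OF h1 z(1) \<delta> z(2) less_imp_le[OF \<eta>] _ CT]) (rule taylor; assumption)
    also have "\<dots> \<le> ennreal ((1 - c * h + K0 * h\<^sup>2) * f ?r + (h * \<epsilon> + K1 \<delta> CT * (h * sqrt h)))"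
      using err h \<epsilon>0 by (intro ennreal_leI) (simp add: distrib_right)
    finally show ?thesis unfolding eq using True by (simp add: coupled_def)
  next
    case False
    have b: "f (an (flow ?x w - flow ?y w)) \<le> (1 - c * h) * f ?r + h * \<epsilon> + K0 * h\<^sup>2 * f ?r" for w
    proof (cases "norm (low (?x - ?y)) \<le> \<delta>")
      case True
      have "f (an (flow ?x w - flow ?y w)) \<le> (1 - c * h) * f ?r + h * ((c + \<beta>) * \<delta>) + K0 * h\<^sup>2 * f ?r"
        using h1 True by (intro sync_low) auto
      moreover have "h * ((c + \<beta>) * \<delta>) \<le> h * \<epsilon>" using h \<epsilon>(1) by (intro mult_left_mono) auto
      ultimately show ?thesis by linarith
    next
      case F: False
      then have "R - \<eta> \<le> ?r" using False by (auto simp: region_def)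
      then have "f (an (flow ?x w - flow ?y w)) \<le> (1 - c * h) * f ?r + h * (C2 * \<eta>) + K0 * h\<^sup>2 * f ?r"
        using h1 \<eta> by (intro sync_far) auto
      moreover have "h * (C2 * \<eta>) \<le> h * \<epsilon>" using h \<epsilon>(2) by (intro mult_left_mono) auto
      ultimately show ?thesis by linarith
    qed
    have "(\<integral>\<^sup>+\<omega>. ennreal (f (an (flow ?x (path 0 \<omega>) - flow ?y (path 0 \<omega>)))) \<partial>P)
      \<le> (\<integral>\<^sup>+\<omega>. ennreal ((1 - c * h) * f ?r + h * \<epsilon> + K0 * h\<^sup>2 * f ?r) \<partial>P)"
      by (intro nn_integral_mono ennreal_leI b)
    also have "\<dots> = ennreal ((1 - c * h) * f ?r + h * \<epsilon> + K0 * h\<^sup>2 * f ?r)" by (simp add: emeasure_space_1)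
    also have "\<dots> \<le> ennreal ((1 - c * h + K0 * h\<^sup>2) * f ?r + (h * \<epsilon> + K1 \<delta> CT * (h * sqrt h)))"
      using h K1 by (intro ennreal_leI) (simp add: distrib_right)
    finally have *: "(\<integral>\<^sup>+\<omega>. ennreal (f (an (flow ?x (path 0 \<omega>) - flow ?y (path 0 \<omega>)))) \<partial>P)
      \<le> ennreal ((1 - c * h + K0 * h\<^sup>2) * f ?r + (h * \<epsilon> + K1 \<delta> CT * (h * sqrt h)))" .
    then show ?thesis unfolding eq using False by (simp add: coupled_def)
  qed
qed

section \<open>Composition of couplings over the time grid\<close>

abbreviation "pk j x \<equiv> distr P borel (X x (real j * h))"

text \<open>Solutions are given for each starting point separately, so measurability in that point
  has to be derived: it propagates along the grid by composition with the measurable one-step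
  kernel.\<close>

lemma pk_measurable: "pk j \<in> borel \<rightarrow>\<^sub>M subprob_algebra borel"
proof (induction j)
  case 0
  have "pk 0 = return borel" by (auto simp: X_0_law)
  then show ?case using return_measurable[of "borel :: 'a measure"] by simp
next
  case (Suc j)
  show ?case unfolding markov by (rule measurable_bind2[OF Suc kern_measurable[OF path_measurable]])
qed

lemma bind_pk_Suc:
  assumes "sets \<mu> = sets borel"
  shows "\<mu> \<bind> pk (Suc j) = (\<mu> \<bind> pk j) \<bind> kern (path 0)"
  unfolding markov
  by (rule bind_assoc[symmetric, OF _ kern_measurable[OF path_measurable]])
     (use pk_measurable[of j] in \<open>simp add: measurable_cong_sets[OF assms refl]\<close>)

lemma couplings_step:
  assumes \<delta>: "0 < \<delta>" and \<Gamma>: "\<Gamma> \<in> couplings (\<mu> \<bind> pk j) (\<nu> \<bind> pk j)"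
    and \<mu>\<nu>: "sets \<mu> = sets borel" "sets \<nu> = sets borel"
  shows "\<Gamma> \<bind> ckern \<delta> \<eta> \<in> couplings (\<mu> \<bind> pk (Suc j)) (\<nu> \<bind> pk (Suc j))"
proof -
  have g: "sets \<Gamma> = sets borel" "distr \<Gamma> borel fst = \<mu> \<bind> pk j" "distr \<Gamma> borel snd = \<nu> \<bind> pk j"
    using \<Gamma> by (auto simp: couplings_def)
  have sp: "space \<Gamma> \<noteq> {}" using sets_eq_imp_space_eq[OF g(1)] by simp
  have km: "ckern \<delta> \<eta> \<in> \<Gamma> \<rightarrow>\<^sub>M subprob_algebra borel"
    using ckern_measurable[OF \<delta>] by (simp add: measurable_cong_sets[OF g(1) refl])
  have fm: "fst \<in> \<Gamma> \<rightarrow>\<^sub>M borel" and sm: "snd \<in> \<Gamma> \<rightarrow>\<^sub>M borel"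
    using fst_measurable snd_measurable by (simp_all add: measurable_cong_sets[OF g(1) refl])
  have pm: "kern (path 0) \<in> borel \<rightarrow>\<^sub>M subprob_algebra borel" by (rule kern_measurable[OF path_measurable])
  have "distr (\<Gamma> \<bind> ckern \<delta> \<eta>) borel fst = \<Gamma> \<bind> (\<lambda>z. kern (path 0) (fst z))"
    by (subst distr_bind[OF km sp fst_measurable]) (simp add: ckern_fst)
  also have "\<dots> = \<mu> \<bind> pk (Suc j)" unfolding bind_pk_Suc[OF \<mu>\<nu>(1)] g(2)[symmetric] by (rule bind_distr[OF fm pm sp, symmetric])
  finally have 1: "distr (\<Gamma> \<bind> ckern \<delta> \<eta>) borel fst = \<mu> \<bind> pk (Suc j)" .
  have "distr (\<Gamma> \<bind> ckern \<delta> \<eta>) borel snd = \<Gamma> \<bind> (\<lambda>z. kern (path 0) (snd z))"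
    by (subst distr_bind[OF km sp snd_measurable]) (simp add: ckern_snd[OF \<delta>])
  also have "\<dots> = \<nu> \<bind> pk (Suc j)" unfolding bind_pk_Suc[OF \<mu>\<nu>(2)] g(3)[symmetric] by (rule bind_distr[OF sm pm sp, symmetric])
  finally have 2: "distr (\<Gamma> \<bind> ckern \<delta> \<eta>) borel snd = \<nu> \<bind> pk (Suc j)" .
  have "sets (\<Gamma> \<bind> ckern \<delta> \<eta>) = sets borel" by (rule sets_bind_measurable[OF km sp])
  with 1 2 show ?thesis by (simp add: couplings_def)
qed

text \<open>Composition multiplies the factors \<open>A\<close> and adds the errors. That the
  coupling is a probability measure is carried along because the additive error is integrated
  against it.\<close>

lemma coupling_iterate:
  assumes \<Gamma>: "\<Gamma> \<in> couplings \<mu> \<nu>" and \<mu>\<nu>: "prob_space \<mu>" "sets \<mu> = sets borel" "sets \<nu> = sets borel" and \<delta>: "0 < \<delta>"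
    and AB: "0 \<le> A" "A \<le> 1" "0 \<le> B'"
    and cost: "\<And>z. (\<integral>\<^sup>+v. ennreal (d2 (fst v) (snd v)) \<partial>ckern \<delta> \<eta> z) \<le> ennreal (A * d2 (fst z) (snd z) + B')"
  shows "\<exists>\<Gamma>'\<in>couplings (\<mu> \<bind> pk j) (\<nu> \<bind> pk j). prob_space \<Gamma>' \<and> (\<integral>\<^sup>+v. ennreal (d2 (fst v) (snd v)) \<partial>\<Gamma>')
     \<le> ennreal (A ^ j) * (\<integral>\<^sup>+v. ennreal (d2 (fst v) (snd v)) \<partial>\<Gamma>) + ennreal (real j * B')"
proof (induction j)
  case 0
  have "pk 0 = return borel" by (auto simp: X_0_law)
  then have "\<mu> \<bind> pk 0 = \<mu>" "\<nu> \<bind> pk 0 = \<nu>" using \<mu>\<nu> by (auto simp: bind_return'')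
  moreover have "prob_space \<Gamma>"
  proof (rule prob_space_distrD)
    show "fst \<in> \<Gamma> \<rightarrow>\<^sub>M borel" using fst_measurable measurable_cong_sets[of \<Gamma> borel] \<Gamma> by (auto simp: couplings_def)
    show "prob_space (distr \<Gamma> borel fst)" using \<Gamma> \<mu>\<nu> by (simp add: couplings_def)
  qed
  ultimately show ?case using \<Gamma> by (intro bexI[of _ \<Gamma>]) auto
next
  case (Suc j)
  let ?E = "\<lambda>\<Gamma>. \<integral>\<^sup>+v. ennreal (d2 (fst v) (snd v)) \<partial>\<Gamma>"
  from Suc obtain \<Gamma>' where g: "\<Gamma>' \<in> couplings (\<mu> \<bind> pk j) (\<nu> \<bind> pk j)" "prob_space \<Gamma>'"
    "?E \<Gamma>' \<le> ennreal (A ^ j) * ?E \<Gamma> + ennreal (real j * B')" by blast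
  interpret G: prob_space \<Gamma>' by fact
  have sg: "sets \<Gamma>' = sets borel" using g(1) by (simp add: couplings_def)
  have km: "ckern \<delta> \<eta> \<in> \<Gamma>' \<rightarrow>\<^sub>M subprob_algebra borel"
    using ckern_measurable[OF \<delta>] by (simp add: measurable_cong_sets[OF sg refl])
  have dm: "(\<lambda>z. ennreal (d2 (fst z) (snd z))) \<in> borel_measurable \<Gamma>'"
    using d2_measurable by (simp add: measurable_cong_sets[OF sg refl])
  have "?E (\<Gamma>' \<bind> ckern \<delta> \<eta>) = (\<integral>\<^sup>+z. ?E (ckern \<delta> \<eta> z) \<partial>\<Gamma>')"
    by (rule nn_integral_bind[OF d2_measurable km])
  also have "\<dots> \<le> (\<integral>\<^sup>+z. ennreal A * ennreal (d2 (fst z) (snd z)) + ennreal B' \<partial>\<Gamma>')"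
  proof (rule nn_integral_mono)
    fix z
    have "0 \<le> f (an (fst z - snd z))" by (intro f_nonneg an_nonneg)
    then have "ennreal (A * d2 (fst z) (snd z) + B') = ennreal A * ennreal (d2 (fst z) (snd z)) + ennreal B'"
      using AB by (simp add: ennreal_mult)
    then show "?E (ckern \<delta> \<eta> z) \<le> ennreal A * ennreal (d2 (fst z) (snd z)) + ennreal B'" using cost[of z] by simp
  qed
  also have "\<dots> = ennreal A * ?E \<Gamma>' + ennreal B'"
    using dm by (simp add: nn_integral_add nn_integral_cmult G.emeasure_space_1)
  also have "\<dots> \<le> ennreal A * (ennreal (A ^ j) * ?E \<Gamma> + ennreal (real j * B')) + ennreal B'"
    using g(3) by (intro add_right_mono mult_left_mono) auto
  also have "\<dots> = ennreal (A ^ Suc j) * ?E \<Gamma> + ennreal (A * (real j * B') + B')"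
    using AB by (simp add: distrib_left ennreal_mult[symmetric] mult.assoc[symmetric] add.assoc flip: ennreal_plus)
  also have "\<dots> \<le> ennreal (A ^ Suc j) * ?E \<Gamma> + ennreal (real (Suc j) * B')"
  proof (intro add_left_mono ennreal_leI)
    \<comment> \<open>Old errors are not discounted, so the total stays linear in the number of
      steps, hence linear in time after division by \<open>h\<close>.\<close>
    have "A * (real j * B') \<le> 1 * (real j * B')" using AB by (intro mult_right_mono) auto
    then show "A * (real j * B') + B' \<le> real (Suc j) * B'" by (simp add: algebra_simps)
  qed
  finally have E: "?E (\<Gamma>' \<bind> ckern \<delta> \<eta>) \<le> ennreal (A ^ Suc j) * ?E \<Gamma> + ennreal (real (Suc j) * B')" .
  have "prob_space (ckern \<delta> \<eta> z)" for z unfolding ckern_def by (rule prob_space_distr[OF coupled_measurable])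
  then have "ckern \<delta> \<eta> \<in> borel \<rightarrow>\<^sub>M prob_algebra borel"
    using ckern_measurable[OF \<delta>] by (intro measurable_prob_algebraI) auto
  moreover have "\<Gamma>' \<in> space (prob_algebra borel)" using sg g(2) by (simp add: space_prob_algebra)
  ultimately have "prob_space (\<Gamma>' \<bind> ckern \<delta> \<eta>)" by (intro prob_space_bind')
  with E couplings_step[OF \<delta> g(1) \<mu>\<nu>(2,3)] show ?case by blast
qed

end

section \<open>Contraction\<close>

lemma ennreal_le_mult_INF:
  assumes "0 < a" "\<And>i. i \<in> I \<Longrightarrow> (w :: ennreal) \<le> ennreal a * F i"
  shows "w \<le> ennreal a * (INF i\<in>I. F i)"
proof -
  have inv: "ennreal a * ennreal (1 / a) = 1" using assms(1) by (simp add: ennreal_mult[symmetric])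
  have "ennreal (1 / a) * w \<le> F i" if "i \<in> I" for i
  proof -
    have "ennreal (1 / a) * w \<le> ennreal (1 / a) * (ennreal a * F i)" using assms(2)[OF that] by (intro mult_left_mono) auto
    also have "\<dots> = F i" using inv by (simp add: mult.assoc[symmetric] mult.commute)
    finally show ?thesis .
  qed
  then have "ennreal (1 / a) * w \<le> (INF i\<in>I. F i)" by (rule INF_greatest)
  then have "ennreal a * (ennreal (1 / a) * w) \<le> ennreal a * (INF i\<in>I. F i)" by (intro mult_left_mono) auto
  then show ?thesis using inv by (simp add: mult.assoc[symmetric])
qed

text \<open>The data of the coupling without a step size, so that \<open>h\<close> can be chosen and
  varied inside a proof.\<close>

locale sde_contraction =
  alpha_normed e n \<alpha> + contraction_profile \<beta> ls R
  for e :: "nat \<Rightarrow> 'a::{real_inner,banach}" and n \<alpha> \<beta> ls R +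
  fixes b :: "'a \<Rightarrow> 'a" and L :: real and P :: "'w measure" and B lam X
    and Ll Lh Hl Hh Mc lmax :: real
  assumes P: "prob_space P" and BM: "indep_brownians P B" and X: "\<And>x. sde_solution P e lam B b x (X x)"
    and L: "0 \<le> L" and b_lip: "\<And>x y. norm (b x - b y) \<le> L * norm (x - y)"
    and n: "0 < n" and lam_pos: "\<And>k. k < n \<Longrightarrow> 0 < lam k"
    and cpos: "0 \<le> Hh" "0 \<le> Ll" "0 \<le> Lh" "0 \<le> Hl" "0 \<le> Mc" "Mc < 1"
    and alpha_eq: "Lh + \<alpha> * Hh = \<alpha> - 1" and beta_eq: "Ll + \<alpha> * Hl = \<beta> + 1"
    and A1_high: "\<And>x y. norm (high_proj e n (b x) - high_proj e n (b y))
                    \<le> Hl * norm (low_proj e n x - low_proj e n y) + Hh * norm (high_proj e n x - high_proj e n y)"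
    and A1_low: "\<And>x y. norm (low_proj e n (b x) - low_proj e n (b y))
                    \<le> Ll * norm (low_proj e n x - low_proj e n y) + Lh * norm (high_proj e n x - high_proj e n y)"
    and A3: "\<And>x y. R \<le> alpha_norm e n \<alpha> (x - y) \<Longrightarrow>
                    alpha_norm e n \<alpha> (b x - b y) \<le> Mc * alpha_norm e n \<alpha> (x - y)"
    and ls_le: "\<And>k. k < n \<Longrightarrow> ls \<le> lam k" and lam_le: "\<And>k. k < n \<Longrightarrow> lam k \<le> lmax"
begin

lemma coupling_setting:
  assumes "0 < h" "(1 + L) * h \<le> 1 / 2"
  shows "coupling_setting b L h P B e lam X n \<alpha> \<beta> ls R Ll Lh Hl Hh Mc lmax"
proof -
  interpret prob_space P by (rule P)
  show ?thesis
    by unfold_locales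
      (use assms BM X L b_lip lam_pos cpos alpha_eq beta_eq A1_high A1_low A3 ls_le lam_le orthonormal_basis_vectors in auto)
qed

abbreviation "c \<equiv> ctr_rate \<beta> ls R Mc \<alpha>"
abbreviation "d2 \<equiv> \<lambda>x y. f (an (x - y))"
abbreviation "cost \<Gamma> \<equiv> \<integral>\<^sup>+v. ennreal (d2 (fst v) (snd v)) \<partial>\<Gamma>"
abbreviation "pt t x \<equiv> distr P borel (X x t)"

lemma c_pos: "0 < c"
  using cpos alpha ls gamma_pos phi_pos[of R] by (simp add: ctr_rate_def)

text \<open>The loss \<epsilon> in the rate absorbs the error proportional to \<open>f\<close>. The
  two error terms of size at most \<open>\<epsilon> * h\<close> per step, from the thresholds and
  from the expansion, accumulate to \<open>2 * \<epsilon> * t\<close>.\<close>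

lemma approximate_contraction:
  assumes \<mu>: "prob_space \<mu>" "sets \<mu> = sets borel" and \<nu>: "sets \<nu> = sets borel"
    and \<Gamma>: "\<Gamma> \<in> couplings \<mu> \<nu>" and t: "0 \<le> t" and \<epsilon>: "0 < \<epsilon>" "\<epsilon> \<le> c"
  shows "wasserstein d2 (\<mu> \<bind> pt t) (\<nu> \<bind> pt t) \<le> ennreal (exp (- (c - \<epsilon>) * t)) * cost \<Gamma> + ennreal (2 * \<epsilon> * t)"
proof -
  \<comment> \<open>Naming these constants outside the locale with a step size makes their
    independence of \<open>h\<close> explicit; the thresholds can be fixed first.\<close>
  define C2 where "C2 = coupling_setting.C2 L \<alpha> Mc"
  define K0 where "K0 = coupling_setting.K0 L \<alpha> \<beta> ls R Mc"
  \<comment> \<open>The added 1 keeps both denominators positive; the absolute value below is taken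
    because the sign of \<open>C2\<close> is not at hand before a step size is fixed.\<close>
  define \<delta> where "\<delta> = \<epsilon> / (c + \<beta> + 1)"
  define \<eta> where "\<eta> = \<epsilon> / (\<bar>C2\<bar> + 1)"
  have c0: "0 < c" by (rule c_pos)
  have \<delta>: "0 < \<delta>" "(c + \<beta>) * \<delta> \<le> \<epsilon>"
  proof -
    have p: "0 < c + \<beta> + 1" using c0 beta by linarith
    then show "0 < \<delta>" using \<epsilon> by (simp add: \<delta>_def)
    have "(c + \<beta>) * \<epsilon> \<le> (c + \<beta> + 1) * \<epsilon>" using \<epsilon> by (intro mult_right_mono) auto
    then show "(c + \<beta>) * \<delta> \<le> \<epsilon>" using p by (simp add: \<delta>_def pos_divide_le_eq mult.commute)
  qed
  have \<eta>: "0 < \<eta>" "C2 * \<eta> \<le> \<epsilon>"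
  proof -
    have p: "0 < \<bar>C2\<bar> + 1" by linarith
    then show "0 < \<eta>" using \<epsilon> by (simp add: \<eta>_def)
    have "C2 * \<epsilon> \<le> (\<bar>C2\<bar> + 1) * \<epsilon>" using \<epsilon> by (intro mult_right_mono) auto
    then show "C2 * \<eta> \<le> \<epsilon>" using p by (simp add: \<eta>_def pos_divide_le_eq mult.commute)
  qed
  obtain CT where CT: "0 \<le> CT"
    "\<And>r Y. \<delta> \<le> r \<Longrightarrow> r \<le> R - \<eta> \<Longrightarrow> f (max 0 (r + Y)) \<le> f r + f1 r * Y + f2 r / 2 * Y\<^sup>2 + CT * \<bar>Y\<bar> ^ 3"
    using f_taylor[OF \<delta>(1) \<eta>(1)] by blast
  define K1 where "K1 = coupling_setting.K1 L \<alpha> \<beta> R lmax \<delta> CT"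
  have bound: "wasserstein d2 (\<mu> \<bind> pt (real N * h)) (\<nu> \<bind> pt (real N * h))
      \<le> ennreal (exp (- (c - \<epsilon>) * (real N * h))) * cost \<Gamma> + ennreal (2 * \<epsilon> * (real N * h))"
    if h: "0 < h" "h < 1/2" "(1 + L) * h < 1/2" "c * h < 1" "K0 * h < \<epsilon>" "K1 * sqrt h < \<epsilon>" for h N
  proof -
    interpret cs: coupling_setting b L h P B e lam X n \<alpha> \<beta> ls R Ll Lh Hl Hh Mc lmax
      using h by (intro coupling_setting) auto
    define A where "A = 1 - (c - \<epsilon>) * h"
    have "(c - \<epsilon>) * h \<le> c * h" using \<epsilon> h by (intro mult_right_mono) auto
    moreover have "0 \<le> (c - \<epsilon>) * h" using \<epsilon> h by simp
    ultimately have A: "0 \<le> A" "A \<le> 1" using h(4) unfolding A_def by linarith+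
    have cost: "(\<integral>\<^sup>+v. ennreal (d2 (fst v) (snd v)) \<partial>cs.ckern \<delta> \<eta> z) \<le> ennreal (A * d2 (fst z) (snd z) + 2 * \<epsilon> * h)" for z
    proof -
      have "(\<integral>\<^sup>+v. ennreal (d2 (fst v) (snd v)) \<partial>cs.ckern \<delta> \<eta> z)
        \<le> ennreal ((1 - c * h + K0 * h\<^sup>2) * d2 (fst z) (snd z) + (h * \<epsilon> + K1 * (h * sqrt h)))"
        unfolding K0_def K1_def
        by (rule cs.ckern_cost[OF n less_imp_le[OF h(2)] \<delta>(1) \<eta>(1) CT(1) _ \<delta>(2) \<eta>(2)[unfolded C2_def]])
           (rule CT(2); assumption)
      also have "\<dots> \<le> ennreal (A * d2 (fst z) (snd z) + 2 * \<epsilon> * h)"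
      proof (rule ennreal_leI)
        have "K0 * h * h \<le> \<epsilon> * h" using h by (intro mult_right_mono) auto
        then have "1 - c * h + K0 * h\<^sup>2 \<le> A" by (simp add: A_def power2_eq_square algebra_simps)
        then have "(1 - c * h + K0 * h\<^sup>2) * d2 (fst z) (snd z) \<le> A * d2 (fst z) (snd z)"
          by (intro mult_right_mono f_nonneg an_nonneg)
        moreover have "K1 * sqrt h * h \<le> \<epsilon> * h" using h by (intro mult_right_mono) auto
        ultimately show "(1 - c * h + K0 * h\<^sup>2) * d2 (fst z) (snd z) + (h * \<epsilon> + K1 * (h * sqrt h)) \<le> A * d2 (fst z) (snd z) + 2 * \<epsilon> * h"
          by (simp add: algebra_simps)
      qed
      finally show ?thesis .
    qed
    obtain \<Gamma>' where G: "\<Gamma>' \<in> couplings (\<mu> \<bind> pt (real N * h)) (\<nu> \<bind> pt (real N * h))"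
      "cost \<Gamma>' \<le> ennreal (A ^ N) * cost \<Gamma> + ennreal (real N * (2 * \<epsilon> * h))"
      using cs.coupling_iterate[OF \<Gamma> \<mu> \<nu> \<delta>(1) A _ cost, of N] \<epsilon> h by auto
    have "A ^ N \<le> exp (- ((c - \<epsilon>) * h)) ^ N"
      using A(1) exp_ge_add_one_self[of "- ((c - \<epsilon>) * h)"] by (intro power_mono) (auto simp: A_def)
    also have "\<dots> = exp (- (c - \<epsilon>) * (real N * h))" by (simp add: exp_of_nat_mult[symmetric] algebra_simps)
    finally have AN: "A ^ N \<le> exp (- (c - \<epsilon>) * (real N * h))" .
    have "wasserstein d2 (\<mu> \<bind> pt (real N * h)) (\<nu> \<bind> pt (real N * h)) \<le> cost \<Gamma>'" by (rule wasserstein_le[OF G(1)])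
    also have "\<dots> \<le> ennreal (A ^ N) * cost \<Gamma> + ennreal (real N * (2 * \<epsilon> * h))" by (rule G(2))
    also have "\<dots> \<le> ennreal (exp (- (c - \<epsilon>) * (real N * h))) * cost \<Gamma> + ennreal (2 * \<epsilon> * (real N * h))"
      by (intro add_mono mult_right_mono ennreal_leI AN) (auto simp: mult_ac)
    finally show ?thesis .
  qed
  have ev: "\<forall>\<^sub>F h in at_right 0. 0 < h \<and> h < 1/2 \<and> (1 + L) * h < 1/2 \<and> c * h < 1 \<and> K0 * h < \<epsilon> \<and> K1 * sqrt h < \<epsilon>"
  proof -
    have lin: "\<forall>\<^sub>F h in at_right 0. k * h < a" if "0 < a" for k a :: real
    proof (rule order_tendstoD(2)[OF _ that])
      show "((\<lambda>h. k * h) \<longlongrightarrow> 0) (at_right 0)" by (rule tendsto_eq_intros refl | simp)+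
    qed
    have "\<forall>\<^sub>F h in at_right 0. K1 * sqrt h < \<epsilon>"
    proof (rule order_tendstoD(2)[OF _ \<epsilon>(1)])
      show "((\<lambda>h. K1 * sqrt h) \<longlongrightarrow> 0) (at_right 0)" by (rule tendsto_eq_intros refl | simp)+
    qed
    then show ?thesis
      using lin[of "1/2" 1] lin[of "1/2" "1 + L"] lin[of 1 c] lin[OF \<epsilon>(1), of K0]
      by (intro eventually_conj eventually_at_right_less) auto
  qed
  show ?thesis
  proof (cases "t = 0")
    \<comment> \<open>At time 0 no step is taken, and any admissible \<open>h\<close> serves;
      \<open>t / real N\<close> would not be a positive step.\<close>
    case True
    obtain h where "0 < h \<and> h < 1/2 \<and> (1 + L) * h < 1/2 \<and> c * h < 1 \<and> K0 * h < \<epsilon> \<and> K1 * sqrt h < \<epsilon>"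
      using eventually_happens[OF ev] by (auto simp: trivial_limit_at_right_real)
    then show ?thesis using bound[of h 0] True by simp
  next
    case False
    then have t: "0 < t" using t by simp
    \<comment> \<open>With steps of length \<open>t / N\<close> the time \<open>t\<close> is itself
      a grid point, so nothing has to be interpolated.\<close>
    have "filterlim (\<lambda>N. t / real N) (at_right 0) sequentially"
      unfolding filterlim_at
    proof
      show "(\<lambda>N. t / real N) \<longlonglongrightarrow> 0" by (rule lim_const_over_n)
      show "\<forall>\<^sub>F N in sequentially. t / real N \<in> {0<..} \<and> t / real N \<noteq> 0"
        using eventually_gt_at_top[of 0] by eventually_elim (use t in auto)
    qed
    then have "\<forall>\<^sub>F N in sequentially. 0 < t / real N \<and> t / real N < 1/2 \<and> (1 + L) * (t / real N) < 1/2 \<and> c * (t / real N) < 1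
        \<and> K0 * (t / real N) < \<epsilon> \<and> K1 * sqrt (t / real N) < \<epsilon>"
      using ev by (rule filterlim_iff[THEN iffD1, rule_format])
    then obtain N where N: "0 < t / real N" "t / real N < 1/2" "(1 + L) * (t / real N) < 1/2" "c * (t / real N) < 1"
        "K0 * (t / real N) < \<epsilon>" "K1 * sqrt (t / real N) < \<epsilon>"
      using eventually_happens[of _ sequentially] by fastforce
    moreover have "real N * (t / real N) = t" using N(1) t by (cases "N = 0") auto
    ultimately show ?thesis using bound[of "t / real N" N] by simp
  qed
qed

lemma contraction_coupling:
  assumes \<mu>: "prob_space \<mu>" "sets \<mu> = sets borel" and \<nu>: "sets \<nu> = sets borel"
    and \<Gamma>: "\<Gamma> \<in> couplings \<mu> \<nu>" and t: "0 \<le> t"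
  shows "wasserstein d2 (\<mu> \<bind> pt t) (\<nu> \<bind> pt t) \<le> ennreal (exp (- c * t)) * cost \<Gamma>"
proof (cases "cost \<Gamma>")
  \<comment> \<open>The exponential is positive, so the right side is infinite.\<close>
  case top
  then show ?thesis by (simp add: ennreal_mult_top)
next
  case (real E)
  define \<epsilon> where "\<epsilon> k = c / real (Suc k)" for k
  have \<epsilon>: "0 < \<epsilon> k" "\<epsilon> k \<le> c" for k
    using c_pos by (auto simp: \<epsilon>_def pos_divide_le_eq)
  have \<epsilon>lim: "\<epsilon> \<longlonglongrightarrow> 0" unfolding \<epsilon>_def[abs_def] by (rule LIMSEQ_Suc[OF lim_const_over_n])
  have "(\<lambda>k. ennreal (exp (- (c - \<epsilon> k) * t) * E + 2 * \<epsilon> k * t)) \<longlonglongrightarrow> ennreal (exp (- (c - 0) * t) * E + 2 * 0 * t)"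
    by (intro tendsto_ennrealI tendsto_intros \<epsilon>lim)
  moreover have "wasserstein d2 (\<mu> \<bind> pt t) (\<nu> \<bind> pt t) \<le> ennreal (exp (- (c - \<epsilon> k) * t) * E + 2 * \<epsilon> k * t)" for k
  proof -
    have "ennreal (exp (- (c - \<epsilon> k) * t)) * ennreal E + ennreal (2 * \<epsilon> k * t) = ennreal (exp (- (c - \<epsilon> k) * t) * E + 2 * \<epsilon> k * t)"
      using real(1) t \<epsilon>(1)[of k] by (simp add: ennreal_mult)
    then show ?thesis using approximate_contraction[OF \<mu> \<nu> \<Gamma> t \<epsilon>[of k]] real(2) by simp
  qed
  ultimately have "wasserstein d2 (\<mu> \<bind> pt t) (\<nu> \<bind> pt t) \<le> ennreal (exp (- (c - 0) * t) * E + 2 * 0 * t)"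
    by (intro LIMSEQ_le_const) auto
  then show ?thesis using real by (simp add: ennreal_mult)
qed

lemma contraction:
  assumes "prob_space \<mu>" "sets \<mu> = sets borel" "sets \<nu> = sets borel" "0 \<le> t"
  shows "wasserstein d2 (\<mu> \<bind> pt t) (\<nu> \<bind> pt t) \<le> ennreal (exp (- c * t)) * wasserstein d2 \<mu> \<nu>"
  unfolding wasserstein_def[of d2 \<mu> \<nu>]
  by (rule ennreal_le_mult_INF[OF exp_gt_zero contraction_coupling[OF assms(1-3) _ assms(4)]])

end

theorem mainTheorem3:
  fixes e :: "nat \<Rightarrow> 'a::{real_inner,banach}"
    and lam :: "nat \<Rightarrow> real"
    and b :: "'a \<Rightarrow> 'a"
    and n :: nat
    and Ll Lh Hl Hh R Mc :: real
    and P :: "'w measure"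
    and B :: "nat \<Rightarrow> real \<Rightarrow> 'w \<Rightarrow> real"
    and X :: "'a \<Rightarrow> real \<Rightarrow> 'w \<Rightarrow> 'a"
    and p :: "real \<Rightarrow> 'a \<Rightarrow> 'a measure"
  defines "\<alpha> \<equiv> (1 + Lh) / (1 - Hh)"
    and "\<beta> \<equiv> (1 + Lh) / (1 - Hh) * Hl + Ll - 1"
    and "ls \<equiv> Min (lam ` {..<n})"
  assumes basis: "orthonormal_basis e"
    and lam_nonneg: "\<forall>k. 0 \<le> lam k"
    and lam_summable: "summable lam"
    and b_lipschitz: "\<exists>L. \<forall>x y. norm (b x - b y) \<le> L * norm (x - y)"
    and n_pos: "1 \<le> n"
    and A1_consts: "0 \<le> Hh" "Hh < 1" "0 \<le> Ll" "0 \<le> Lh" "0 \<le> Hl"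
    and A1_high: "\<forall>x y. norm (high_proj e n (b x) - high_proj e n (b y))
                    \<le> Hl * norm (low_proj e n x - low_proj e n y) + Hh * norm (high_proj e n x - high_proj e n y)"
    and A1_low: "\<forall>x y. norm (low_proj e n (b x) - low_proj e n (b y))
                    \<le> Ll * norm (low_proj e n x - low_proj e n y) + Lh * norm (high_proj e n x - high_proj e n y)"
    and A2: "\<forall>k<n. 0 < lam k"
    and A3_consts: "0 < R" "0 \<le> Mc" "Mc < 1"
    and A3: "\<forall>x y. R \<le> alpha_norm e n \<alpha> (x - y) \<longrightarrow>
                    alpha_norm e n \<alpha> (b x - b y) \<le> Mc * alpha_norm e n \<alpha> (x - y)"
    and beta_nonneg: "0 \<le> \<beta>"
    and prob: "prob_space P"
    and BM: "indep_brownians P B"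
    and sol: "\<forall>x. sde_solution P e lam B b x (X x)"
    and kernel: "\<forall>t x. p t x = distr P borel (X x t)"
  shows "strict_mono_on {0..} (ctr_f \<beta> ls R)
       \<and> concave_on {0..} (ctr_f \<beta> ls R)
       \<and> continuous_on {0..} (ctr_f \<beta> ls R)
       \<and> ctr_f \<beta> ls R 0 = 0
       \<and> (\<forall>r. 0 < r \<and> r < R \<longrightarrow> (\<exists>D. (ctr_f \<beta> ls R has_real_derivative D) (at r)
              \<and> 1/2 \<le> D * exp (\<beta> / (8 * ls) * r\<^sup>2) \<and> D * exp (\<beta> / (8 * ls) * r\<^sup>2) \<le> 1))
       \<and> (\<forall>r\<ge>R. ctr_f \<beta> ls R r
              = ctr_f \<beta> ls R R + 1/2 * exp (- (\<beta> / (8 * ls)) * R\<^sup>2) * (r - R))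
       \<and> (\<forall>x y. ctr_f \<beta> ls R (alpha_norm e n \<alpha> (x - y)) = 0 \<longleftrightarrow> x = y)
       \<and> (\<forall>x y. ctr_f \<beta> ls R (alpha_norm e n \<alpha> (x - y)) = ctr_f \<beta> ls R (alpha_norm e n \<alpha> (y - x)))
       \<and> (\<forall>x y z. ctr_f \<beta> ls R (alpha_norm e n \<alpha> (x - z))
              \<le> ctr_f \<beta> ls R (alpha_norm e n \<alpha> (x - y)) + ctr_f \<beta> ls R (alpha_norm e n \<alpha> (y - z)))
       \<and> (\<exists>c1 c2. 0 < c1 \<and> 0 < c2 \<and> (\<forall>x y.
              c1 * norm (x - y) \<le> ctr_f \<beta> ls R (alpha_norm e n \<alpha> (x - y))
            \<and> ctr_f \<beta> ls R (alpha_norm e n \<alpha> (x - y)) \<le> c2 * norm (x - y)))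
       \<and> (\<forall>\<mu>\<in>first_moment_measures. \<forall>\<nu>\<in>first_moment_measures. \<forall>t\<ge>0.
              wasserstein (\<lambda>x y. ctr_f \<beta> ls R (alpha_norm e n \<alpha> (x - y)))
                 (kernel_act \<mu> (p t)) (kernel_act \<nu> (p t))
            \<le> ennreal (exp (- ctr_rate \<beta> ls R Mc \<alpha> * t))
               * wasserstein (\<lambda>x y. ctr_f \<beta> ls R (alpha_norm e n \<alpha> (x - y))) \<mu> \<nu>)
       \<and> (0 < \<beta> \<longrightarrow> ctr_rate \<beta> ls R Mc \<alpha>
              \<ge> 1/2 * exp (- (\<beta> / (8 * ls)) * R\<^sup>2) * min (min \<beta> (1 - Mc)) (1 / (2 * \<alpha>)))"
proof -
  obtain L0 where L0: "\<And>x y. norm (b x - b y) \<le> L0 * norm (x - y)" using b_lipschitz by blast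
  define L where "L = max 0 L0"
  have L: "0 \<le> L" "\<And>x y. norm (b x - b y) \<le> L * norm (x - y)"
  proof -
    show "norm (b x - b y) \<le> L * norm (x - y)" for x y
      using L0[of x y] mult_right_mono[of L0 L "norm (x - y)"] by (simp add: L_def)
  qed (simp add: L_def)
  define lmax where "lmax = Max (lam ` {..<n})"
  have fin: "finite (lam ` {..<n})" "lam ` {..<n} \<noteq> {}" using n_pos by (auto simp: lessThan_empty_iff)
  have alpha_mult: "\<alpha> * (1 - Hh) = 1 + Lh" using A1_consts by (simp add: \<alpha>_def)
  interpret sde_contraction e n \<alpha> \<beta> ls R b L P B lam X Ll Lh Hl Hh Mc lmax
  proof (intro sde_contraction.intro alpha_normed.intro low_modes.intro alpha_normed_axioms.intro
      contraction_profile.intro sde_contraction_axioms.intro)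
    show "e i \<bullet> e j = (if i = j then 1 else 0)" for i j using basis by (simp add: orthonormal_basis_def)
    show "1 \<le> \<alpha>" using A1_consts by (simp add: \<alpha>_def pos_le_divide_eq)
    show "0 < ls" unfolding ls_def using fin A2 by (subst Min_gr_iff) auto
    show "Lh + \<alpha> * Hh = \<alpha> - 1" using alpha_mult by (simp add: algebra_simps)
    show "Ll + \<alpha> * Hl = \<beta> + 1" by (simp add: \<alpha>_def \<beta>_def)
    show "ls \<le> lam k" if "k < n" for k unfolding ls_def using that fin by (intro Min_le) auto
    show "lam k \<le> lmax" if "k < n" for k unfolding lmax_def using that fin by (intro Max_ge) auto
    show "0 < n" using n_pos by simp
    show "0 < lam k" if "k < n" for k using A2 that by blast
    show "sde_solution P e lam B b x (X x)" for x using sol by blast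
    show "norm (high_proj e n (b x) - high_proj e n (b y))
        \<le> Hl * norm (low_proj e n x - low_proj e n y) + Hh * norm (high_proj e n x - high_proj e n y)" for x y
      using A1_high by blast
    show "norm (low_proj e n (b x) - low_proj e n (b y))
        \<le> Ll * norm (low_proj e n x - low_proj e n y) + Lh * norm (high_proj e n x - high_proj e n y)" for x y
      using A1_low by blast
    show "alpha_norm e n \<alpha> (b x - b y) \<le> Mc * alpha_norm e n \<alpha> (x - y)" if "R \<le> alpha_norm e n \<alpha> (x - y)" for x y
      using A3 that by blast
  qed (fact beta_nonneg A3_consts prob BM L A1_consts)+
  have q_eq: "q = 1/2 * exp (- (\<beta> / (8 * ls)) * R\<^sup>2)" by (simp add: q_def ctr_phi_def)
  have deriv: "\<exists>D. (f has_real_derivative D) (at r) \<and> 1/2 \<le> D * exp (\<beta> / (8 * ls) * r\<^sup>2) \<and> D * exp (\<beta> / (8 * ls) * r\<^sup>2) \<le> 1"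
    if r: "0 < r" "r < R" for r
  proof (intro exI[of _ "f1 r"] conjI)
    show "(f has_real_derivative f1 r) (at r)" using f_deriv[of r] r by (intro has_derivative_interior_atLeast) auto
    have "f1 r * exp (\<beta> / (8 * ls) * r\<^sup>2) = g r * (exp (- (\<beta> / (8 * ls)) * r\<^sup>2) * exp (\<beta> / (8 * ls) * r\<^sup>2))"
      using r by (simp add: f1_def ctr_phi_def)
    also have "\<dots> = g r" by (simp add: exp_add[symmetric])
    finally show "1/2 \<le> f1 r * exp (\<beta> / (8 * ls) * r\<^sup>2)" "f1 r * exp (\<beta> / (8 * ls) * r\<^sup>2) \<le> 1"
      using g_bounds[of r] r by auto
  qed
  have zero: "f (an (x - y)) = 0 \<longleftrightarrow> x = y" for x y
  proof
    assume "f (an (x - y)) = 0"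
    then have "q * an (x - y) \<le> 0" using f_bounds[OF an_nonneg, of "x - y"] by simp
    then have "an (x - y) = 0" using q_pos an_nonneg[of "x - y"] by (simp add: mult_le_0_iff)
    then show "x = y" by (simp add: an_eq_0)
  qed (simp add: an_0 f_0)
  have tri: "f (an (x - z)) \<le> f (an (x - y)) + f (an (y - z))" for x y z
  proof -
    have "f (an (x - z)) \<le> f (an (x - y) + an (y - z))"
      using an_triangle[of "x - y" "y - z"] by (intro f_mono an_nonneg) simp
    also have "\<dots> \<le> f (an (x - y)) + f (an (y - z))" by (intro f_subadditive an_nonneg)
    finally show ?thesis .
  qed
  \<comment> \<open>The slopes of \<open>f\<close> lie between \<open>q\<close> and 1, and the
    weighted norm lies between the norm and \<open>1 + \<alpha>\<close> times the norm.\<close>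
  have equiv: "q * norm (x - y) \<le> f (an (x - y)) \<and> f (an (x - y)) \<le> (1 + \<alpha>) * norm (x - y)" for x y
  proof
    have "q * norm (x - y) \<le> q * an (x - y)" using q_pos norm_le_an[of "x - y"] by simp
    then show "q * norm (x - y) \<le> f (an (x - y))" using f_bounds[OF an_nonneg, of "x - y"] by simp
    show "f (an (x - y)) \<le> (1 + \<alpha>) * norm (x - y)"
      using f_bounds[OF an_nonneg, of "x - y"] an_le_norm[of "x - y"] by simp
  qed
  have rate: "1/2 * exp (- (\<beta> / (8 * ls)) * R\<^sup>2) * min (min \<beta> (1 - Mc)) (1 / (2 * \<alpha>)) \<le> c" if "0 < \<beta>"
  proof -
    let ?m = "min (min \<beta> (1 - Mc)) (1 / (2 * \<alpha>))"
    have "q * ?m \<le> q * (1 - Mc)" "q * ?m \<le> q * (1 / (2 * \<alpha>))" "q * ?m \<le> q * \<beta>"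
      using q_pos by (intro mult_left_mono; simp)+
    moreover have "q * \<beta> \<le> 2 * ls * \<gamma>" using gamma_lower_bound[OF that] by (simp add: mult.commute)
    ultimately have "q * ?m \<le> c" by (auto simp: ctr_rate_def q_def)
    then show ?thesis by (simp only: q_eq)
  qed
  have contr: "wasserstein d2 (kernel_act \<mu> (p t)) (kernel_act \<nu> (p t)) \<le> ennreal (exp (- c * t)) * wasserstein d2 \<mu> \<nu>"
    if "\<mu> \<in> first_moment_measures" "\<nu> \<in> first_moment_measures" "0 \<le> t" for \<mu> \<nu> t
  proof -
    have "p t = pt t" using kernel by auto
    then show ?thesis
      unfolding kernel_act_def using that by (simp only:) (intro contraction; simp add: first_moment_measures_def)
  qed
  show ?thesis
  proof (intro conjI allI impI ballI)
    show "strict_mono_on {0..} f" by (rule f_strict_mono)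
    show "concave_on {0..} f" by (rule f_concave)
    show "continuous_on {0..} f" by (rule f_cont)
    show "f 0 = 0" by (rule f_0)
    show "\<exists>D. (f has_real_derivative D) (at r) \<and> 1/2 \<le> D * exp (\<beta> / (8 * ls) * r\<^sup>2) \<and> D * exp (\<beta> / (8 * ls) * r\<^sup>2) \<le> 1"
      if "0 < r \<and> r < R" for r using that deriv by blast
    show "f r = f R + 1/2 * exp (- (\<beta> / (8 * ls)) * R\<^sup>2) * (r - R)" if "R \<le> r" for r
      using f_affine[OF that] by (simp only: q_eq)
    show "f (an (x - y)) = 0 \<longleftrightarrow> x = y" for x y by (rule zero)
    show "f (an (x - y)) = f (an (y - x))" for x y by (simp only: an_commute[of x y])
    show "f (an (x - z)) \<le> f (an (x - y)) + f (an (y - z))" for x y z by (rule tri)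
    show "\<exists>c1 c2. 0 < c1 \<and> 0 < c2 \<and> (\<forall>x y. c1 * norm (x - y) \<le> f (an (x - y)) \<and> f (an (x - y)) \<le> c2 * norm (x - y))"
      using q_pos alpha equiv by (intro exI[of _ q] exI[of _ "1 + \<alpha>"]) auto
    show "wasserstein d2 (kernel_act \<mu> (p t)) (kernel_act \<nu> (p t)) \<le> ennreal (exp (- c * t)) * wasserstein d2 \<mu> \<nu>"
      if "\<mu> \<in> first_moment_measures" "\<nu> \<in> first_moment_measures" "0 \<le> t" for \<mu> \<nu> t
      using that by (rule contr)
    show "1/2 * exp (- (\<beta> / (8 * ls)) * R\<^sup>2) * min (min \<beta> (1 - Mc)) (1 / (2 * \<alpha>)) \<le> c" if "0 < \<beta>"
      using that by (rule rate)
  qed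
qed

end
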